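(* Suppose Assumptions (A1)–(A6) listed in the context hold. Let $\mathsf T$ be the stopping time of the AQuTe-CUSUM procedure with detection threshold $\nu=\log\gamma$ and window size $w=w(\gamma)$ such that $w\to\infty$ and $w=o(\log\gamma)$ as $\gamma\to\infty$. Let $\mathsf{KL}_M=\max_{\tau\in[\tau_{\min},\tau_{\max}]}\mathsf{KL}(\theta_1,\tau)$. Then, as $\gamma\to\infty$, $$\mathrm{WADD}(\mathsf T)\le\frac{\log\gamma}{\mathsf{KL}_M}(1+o(1)).$$ Thus the AQuTe-CUSUM procedure is first-order asymptotically optimal, i.e. $\mathrm{WADD}(\mathsf T)=\frac{\log\gamma}{\mathsf{KL}_M}(1+o(1))$ as $\gamma\to\infty$, matching to first order the smallest WADD among all joint quantization-and-detection procedures with average run length at least $\gamma$.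
   Context: Data model. $\{p_X(\cdot;\theta):\theta\in\Theta\}$, $\Theta\subset\mathbb R$, is a parametric family of densities on $\mathcal X\subseteq\mathbb R$. The independent observations $X_t\in\mathcal X$, $t=1,2,\dots$, have density $p_X(\cdot;\theta_0)$ for $t=1,\dots,\kappa$ and density $p_X(\cdot;\theta_1)$ for $t\ge\kappa+1$, where $\kappa\in\{0,1,2,\dots\}$ is a deterministic unknown change-point. The parameter $\theta_0$ is known; $\theta_1$ is unknown and belongs to a compact set $\Theta_1\subset\Theta$ with $\theta_0\notin\Theta_1$. 1-bit measurements. The $X_t$ are not observed; one observes $B_t=1$ if $X_t\le\tau_t$ and $B_t=-1$ if $X_t>\tau_t$, where the threshold $\tau_t$ lies in the interior of $\mathcal X$ and in a fixed bounded interval $[\tau_{\min},\tau_{\max}]$ with $\tau_{\min},\tau_{\max}\in\mathcal X$. For $b\in\{-1,1\}$, $p_B(b;\theta,\tau)$ is the probability that the bit equals $b$ when $X\sim p_X(\cdot;\theta)$ and the threshold is $\tau$: $p_B(1;\theta,\tau)=\int_{\{x\in\mathcal X:x\le\tau\}}p_X(x;\theta)\,dx$ and $p_B(-1;\theta,\tau)=\int_{\{x\in\mathcal X:x>\tau\}}p_X(x;\theta)\,dx$. Let $\mathscr F_t=\sigma\{B_1,\dots,B_t\}$, with $\mathscr F_0$ trivial. 1-bit KL divergence: $\mathsf{KL}(\theta,\tau)=\sum_{b\in\{-1,1\}}p_B(b;\theta,\tau)\log\frac{p_B(b;\theta,\tau)}{p_B(b;\theta_0,\tau)}$. Joint procedures.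 A joint procedure is a pair $(\pi,\mathsf T)$, where $\pi=\{\tau_t\}_{t\ge1}$ is a quantization policy such that each $\tau_t\in[\tau_{\min},\tau_{\max}]$ is $\mathscr F_{t-1}$-measurable, and $\mathsf T$ is a stopping time with respect to $\{\mathscr F_t\}$. Its average run length is $\mathsf E_\infty^\pi[\mathsf T]$, the expectation when all samples are pre-change ($\kappa=\infty$). AQuTe-CUSUM procedure, with window size $w\ge1$ and detection threshold $\nu$. The thresholds $\tau_1,\dots,\tau_w\in[\tau_{\min},\tau_{\max}]$ are initialized randomly, and $\mathsf S_1=\dots=\mathsf S_w=0$. For $t>w$: (i) $\hat\theta_{t-1}=\arg\max_{\theta\in\Theta_1}\sum_{s=t-w}^{t-1}\log p_B(B_s;\theta,\tau_s)$ (an $\mathscr F_{t-1}$-measurable maximizer); (ii) $\tau_t=\arg\max_{\tau\in[\tau_{\min},\tau_{\max}]}\mathsf{KL}(\hat\theta_{t-1},\tau)$; (iii) $B_t$ is observed using threshold $\tau_t$; (iv) $\mathsf S_t=\mathsf S_{t-1}^++\log\frac{p_B(B_t;\hat\theta_{t-1},\tau_t)}{p_B(B_t;\theta_0,\tau_t)}$, where $x^+=\max\{x,0\}$. The stopping time is $\mathsf T=\inf\{t>w:\mathsf S_t\ge\nu\}$. Delay metric. $\mathsf E_\kappa^{\theta}$ denotes expectation when this procedure is used, the change occurs at time $\kappa$, and the post-change parameter is $\theta$. $\mathrm{WADD}(\mathsf T)=\sup_{\kappa\ge0}\operatorname{ess\,sup}\,\mathsf E_\kappa^{\theta}[(\mathsf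 T-\kappa)^+\mid\mathscr F_\kappa]$, evaluated at the true post-change parameter $\theta=\theta_1$. Assumptions. Write $q(\theta,\tau)=p_B(1;\theta,\tau)$. (A1) $\Theta_1\subset\mathbb R$ is compact and $\theta_1$ belongs to the interior of $\Theta_1$. (A2) $q(\theta,\tau)$ is jointly three times continuously differentiable in $(\theta,\tau)$ on $\Theta_1\times[\tau_{\min},\tau_{\max}]$, and all its first-, second- and third-order partial derivatives are uniformly bounded there. (A3) There exists $\delta\in(0,1/2)$ such that $\delta\le q(\theta,\tau)\le1-\delta$ for all $(\theta,\tau)\in\Theta_1\times[\tau_{\min},\tau_{\max}]$. (A4) For any $\tau\in[\tau_{\min},\tau_{\max}]$ and every $\varepsilon>0$ there exists $c_\varepsilon>0$ such that $\inf_{|u-\theta|\ge\varepsilon}\mathsf D(\theta,u;\tau)\ge c_\varepsilon$ (with $\theta,u\in\Theta_1$), where $\mathsf D(\theta,u;\tau)=\sum_{b\in\{-1,1\}}p_B(b;\theta,\tau)\log\frac{p_B(b;\theta,\tau)}{p_B(b;u,\tau)}\ge0$. (A5) There exists a constant $I_0>0$ such that for all $\tau\in[\tau_{\min},\tau_{\max}]$, $\frac{(\partial_\theta q(\theta_1,\tau))^2}{q(\theta_1,\tau)\{1-q(\theta_1,\tau)\}}\ge I_0$. (A6) For each $\theta$ in a neighborhood of $\theta_1$, the maximizer $\tau^\star(\theta)\in\arg\max_{\tau\in[\tau_{\min},\tau_{\max}]}\mathsf{KL}(\theta,\tau)$ is unique and interior, and $\partial^2_{\tau\tau}\mathsf{KL}(\theta_1,\tau^\star(\theta_1))<0$.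 *)

theory Defs
  imports "HOL-Probability.Probability" "HOL-Library.Landau_Symbols"
begin

section \<open>Data model\<close>

definition density_family :: "real set \<Rightarrow> real set \<Rightarrow> (real \<Rightarrow> real \<Rightarrow> real) \<Rightarrow> bool" where
  "density_family \<X> \<Theta> p \<longleftrightarrow> \<X> \<in> sets borel \<and>
     (\<forall>\<theta>\<in>\<Theta>. set_integrable lborel \<X> (\<lambda>x. p x \<theta>) \<and> (\<forall>x\<in>\<X>. 0 \<le> p x \<theta>) \<and>
            (LINT x:\<X>|lborel. p x \<theta>) = 1)"

definition obs_law :: "real set \<Rightarrow> (real \<Rightarrow> real \<Rightarrow> real) \<Rightarrow> real \<Rightarrow> real measure" where
  "obs_law \<X> p \<theta> = density lborel (\<lambda>x. ennreal (indicator \<X> x * p x \<theta>))"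

definition path_law ::
    "real set \<Rightarrow> (real \<Rightarrow> real \<Rightarrow> real) \<Rightarrow> real \<Rightarrow> real \<Rightarrow> enat \<Rightarrow> (nat \<Rightarrow> real) measure" where
  "path_law \<X> p \<theta>0 \<theta> \<kappa> =
     (\<Pi>\<^sub>M t\<in>{1..}. obs_law \<X> p (if enat t \<le> \<kappa> then \<theta>0 else \<theta>))"

text \<open>A sample point is a pair of a seed, drawn from an auxiliary probability space \<open>U\<close> and used only
  for the random initialization of the thresholds, and the independent sequence of observations.
  The change-point \<open>\<infinity>\<close> stands for "no change".\<close>

definition sample_law ::
    "'u measure \<Rightarrow> real set \<Rightarrow> (real \<Rightarrow> real \<Rightarrow> real) \<Rightarrow> real \<Rightarrow> real \<Rightarrow> enat
      \<Rightarrow> ('u \<times> (nat \<Rightarrow> real)) measure" where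
  "sample_law U \<X> p \<theta>0 \<theta> \<kappa> = U \<Otimes>\<^sub>M path_law \<X> p \<theta>0 \<theta> \<kappa>"

text \<open>This is the space of every \<open>sample_law\<close>, whatever the parameters and the change-point.\<close>

definition sample_space :: "'u measure \<Rightarrow> ('u \<times> (nat \<Rightarrow> real)) set" where
  "sample_space U = space (U \<Otimes>\<^sub>M (\<Pi>\<^sub>M t\<in>{1::nat..}. (borel :: real measure)))"

section \<open>One-bit measurements and divergences\<close>

definition one_bit_prob ::
    "real set \<Rightarrow> (real \<Rightarrow> real \<Rightarrow> real) \<Rightarrow> int \<Rightarrow> real \<Rightarrow> real \<Rightarrow> real" where
  "one_bit_prob \<X> p b \<theta> \<tau> =
     (if b = 1 then (LINT x:{x\<in>\<X>. x \<le> \<tau>}|lborel. p x \<theta>)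
               else (LINT x:{x\<in>\<X>. x > \<tau>}|lborel. p x \<theta>))"

text \<open>The summand \<open>a * ln (a / c)\<close> of a divergence, with \<open>0 ln (0 / c) = 0\<close> and
  \<open>a ln (a / 0) = \<infinity>\<close> for \<open>a > 0\<close>; the totalised real logarithm and division would
  make the latter \<open>0\<close>.\<close>

definition kl_term :: "real \<Rightarrow> real \<Rightarrow> ereal" where
  "kl_term a c = (if a = 0 then 0 else if c = 0 then \<infinity> else ereal (a * ln (a / c)))"

definition one_bit_div ::
    "real set \<Rightarrow> (real \<Rightarrow> real \<Rightarrow> real) \<Rightarrow> real \<Rightarrow> real \<Rightarrow> real \<Rightarrow> ereal" where
  "one_bit_div \<X> p \<theta> u \<tau> =
     (\<Sum>b\<in>{-1, 1}. kl_term (one_bit_prob \<X> p b \<theta> \<tau>) (one_bit_prob \<X> p b u \<tau>))"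

definition one_bit_KL ::
    "real set \<Rightarrow> (real \<Rightarrow> real \<Rightarrow> real) \<Rightarrow> real \<Rightarrow> real \<Rightarrow> real \<Rightarrow> ereal" where
  "one_bit_KL \<X> p \<theta>0 \<theta> \<tau> = one_bit_div \<X> p \<theta> \<theta>0 \<tau>"

text \<open>The maximal divergence over the thresholds, written as a supremum. Assumption \<open>assm_A6\<close> below makes this supremum attained and finite.\<close>

definition KL_max ::
    "real set \<Rightarrow> (real \<Rightarrow> real \<Rightarrow> real) \<Rightarrow> real \<Rightarrow> real \<Rightarrow> real \<Rightarrow> real \<Rightarrow> ereal" where
  "KL_max \<X> p \<theta>0 \<theta>1 \<tau>min \<tau>max = (SUP \<tau>\<in>{\<tau>min..\<tau>max}. one_bit_KL \<X> p \<theta>0 \<theta>1 \<tau>)"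

definition obs_bit ::
    "(nat \<Rightarrow> 'u \<times> (nat \<Rightarrow> real) \<Rightarrow> real) \<Rightarrow> nat \<Rightarrow> 'u \<times> (nat \<Rightarrow> real) \<Rightarrow> int" where
  "obs_bit \<tau> t \<omega> = (if snd \<omega> t \<le> \<tau> t \<omega> then 1 else -1)"

section \<open>Joint procedures and their performance\<close>

text \<open>The sigma-algebra generated by the bits up to time \<open>n\<close>. The index type is \<open>enat\<close> because
  \<open>stopping_time\<close> requires the filtration to be indexed by the range of the stopping time.\<close>

definition bit_filtration ::
    "'u measure \<Rightarrow> (nat \<Rightarrow> 'u \<times> (nat \<Rightarrow> real) \<Rightarrow> real) \<Rightarrow> enat \<Rightarrow> ('u \<times> (nat \<Rightarrow> real)) measure" where
  "bit_filtration U \<tau> n =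
     sigma (sample_space U)
       {obs_bit \<tau> s -` A \<inter> sample_space U | s A. 1 \<le> s \<and> enat s \<le> n}"

definition joint_procedure ::
    "'u measure \<Rightarrow> real \<Rightarrow> real \<Rightarrow> (nat \<Rightarrow> 'u \<times> (nat \<Rightarrow> real) \<Rightarrow> real)
      \<Rightarrow> ('u \<times> (nat \<Rightarrow> real) \<Rightarrow> enat) \<Rightarrow> bool" where
  "joint_procedure U \<tau>min \<tau>max \<tau> T \<longleftrightarrow>
     (\<forall>t\<ge>1. \<tau> t \<in> borel_measurable (bit_filtration U \<tau> (enat (t - 1))) \<and>
            (\<forall>\<omega>\<in>sample_space U. \<tau> t \<omega> \<in> {\<tau>min..\<tau>max})) \<and>
     stopping_time (bit_filtration U \<tau>) T"

text \<open>With no change the second parameter of the sample law is irrelevant.\<close>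

definition ARL ::
    "'u measure \<Rightarrow> real set \<Rightarrow> (real \<Rightarrow> real \<Rightarrow> real) \<Rightarrow> real
      \<Rightarrow> ('u \<times> (nat \<Rightarrow> real) \<Rightarrow> enat) \<Rightarrow> ennreal" where
  "ARL U \<X> p \<theta>0 T = (\<integral>\<^sup>+ \<omega>. ennreal_of_enat (T \<omega>) \<partial>sample_law U \<X> p \<theta>0 \<theta>0 \<infinity>)"

text \<open>Subtraction on \<open>enat\<close> is truncated, so \<open>T \<omega> - \<kappa>\<close> is the positive part.\<close>

definition WADD ::
    "'u measure \<Rightarrow> real set \<Rightarrow> (real \<Rightarrow> real \<Rightarrow> real) \<Rightarrow> real \<Rightarrow> real
      \<Rightarrow> (nat \<Rightarrow> 'u \<times> (nat \<Rightarrow> real) \<Rightarrow> real) \<Rightarrow> ('u \<times> (nat \<Rightarrow> real) \<Rightarrow> enat) \<Rightarrow> ennreal" where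
  "WADD U \<X> p \<theta>0 \<theta> \<tau> T =
     (SUP \<kappa>::nat. esssup (sample_law U \<X> p \<theta>0 \<theta> (enat \<kappa>))
        (nn_cond_exp (sample_law U \<X> p \<theta>0 \<theta> (enat \<kappa>)) (bit_filtration U \<tau> (enat \<kappa>))
           (\<lambda>\<omega>. ennreal_of_enat (T \<omega> - enat \<kappa>))))"

definition optimal_WADD ::
    "'u measure \<Rightarrow> real set \<Rightarrow> (real \<Rightarrow> real \<Rightarrow> real) \<Rightarrow> real \<Rightarrow> real \<Rightarrow> real \<Rightarrow> real \<Rightarrow> real \<Rightarrow> ennreal" where
  "optimal_WADD U \<X> p \<theta>0 \<theta> \<tau>min \<tau>max \<gamma> =
     (INF (\<tau>, T)\<in>{(\<tau>, T). joint_procedure U \<tau>min \<tau>max \<tau> T \<and> ennreal \<gamma> \<le> ARL U \<X> p \<theta>0 T}.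
        WADD U \<X> p \<theta>0 \<theta> \<tau> T)"

section \<open>The AQuTe-CUSUM procedure\<close>

text \<open>The information available to the procedure at time \<open>n \<ge> w\<close>: the (possibly random) initial
  thresholds and the bits up to time \<open>n\<close>. With deterministic initial thresholds this is
  \<open>bit_filtration\<close>.\<close>

definition aqute_info ::
    "'u measure \<Rightarrow> nat \<Rightarrow> (nat \<Rightarrow> 'u \<times> (nat \<Rightarrow> real) \<Rightarrow> real) \<Rightarrow> nat \<Rightarrow> ('u \<times> (nat \<Rightarrow> real)) measure" where
  "aqute_info U w \<tau> n =
     sigma (sample_space U)
       ({\<tau> s -` A \<inter> sample_space U | s A. s \<in> {1..w} \<and> A \<in> sets borel} \<union>
        {obs_bit \<tau> s -` A \<inter> sample_space U | s A. s \<in> {1..n}})"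

definition aqute_cusum ::
    "'u measure \<Rightarrow> real set \<Rightarrow> (real \<Rightarrow> real \<Rightarrow> real) \<Rightarrow> real \<Rightarrow> real set \<Rightarrow> real \<Rightarrow> real \<Rightarrow> nat \<Rightarrow> real
      \<Rightarrow> (nat \<Rightarrow> 'u \<times> (nat \<Rightarrow> real) \<Rightarrow> real) \<Rightarrow> (nat \<Rightarrow> 'u \<times> (nat \<Rightarrow> real) \<Rightarrow> real)
      \<Rightarrow> (nat \<Rightarrow> 'u \<times> (nat \<Rightarrow> real) \<Rightarrow> real) \<Rightarrow> ('u \<times> (nat \<Rightarrow> real) \<Rightarrow> enat) \<Rightarrow> bool" where
  "aqute_cusum U \<X> p \<theta>0 \<Theta>1 \<tau>min \<tau>max w \<nu> \<tau> \<theta>h S T \<longleftrightarrow>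
     1 \<le> w \<and>
     (\<forall>t\<in>{1..w}. (\<exists>V\<in>borel_measurable U. (\<forall>u\<in>space U. V u \<in> {\<tau>min..\<tau>max}) \<and>
                     (\<forall>\<omega>\<in>sample_space U. \<tau> t \<omega> = V (fst \<omega>))) \<and>
                 (\<forall>\<omega>\<in>sample_space U. S t \<omega> = 0)) \<and>
     (\<forall>t>w. \<theta>h (t - 1) \<in> borel_measurable (aqute_info U w \<tau> (t - 1)) \<and>
            \<tau> t \<in> borel_measurable (aqute_info U w \<tau> (t - 1)) \<and>
            (\<forall>\<omega>\<in>sample_space U.
               is_arg_max (\<lambda>\<theta>. \<Sum>s=t-w..t-1. ln (one_bit_prob \<X> p (obs_bit \<tau> s \<omega>) \<theta> (\<tau> s \<omega>)))
                 (\<lambda>\<theta>. \<theta> \<in> \<Theta>1) (\<theta>h (t - 1) \<omega>) \<and>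
               is_arg_max (one_bit_KL \<X> p \<theta>0 (\<theta>h (t - 1) \<omega>))
                 (\<lambda>x. x \<in> {\<tau>min..\<tau>max}) (\<tau> t \<omega>) \<and>
               S t \<omega> = max (S (t - 1) \<omega>) 0 +
                 ln (one_bit_prob \<X> p (obs_bit \<tau> t \<omega>) (\<theta>h (t - 1) \<omega>) (\<tau> t \<omega>) /
                     one_bit_prob \<X> p (obs_bit \<tau> t \<omega>) \<theta>0 (\<tau> t \<omega>)))) \<and>
     (\<forall>\<omega>\<in>sample_space U. T \<omega> = Inf {enat t | t. w < t \<and> \<nu> \<le> S t \<omega>})"

section \<open>Assumptions\<close>

definition assm_A1 :: "real set \<Rightarrow> real \<Rightarrow> bool" where
  "assm_A1 \<Theta>1 \<theta>1 \<longleftrightarrow> compact \<Theta>1 \<and> \<theta>1 \<in> interior \<Theta>1"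

text \<open>\<open>D i j\<close> is the partial derivative of order \<open>i\<close> in the parameter and \<open>j\<close> in the threshold;
  derivatives at boundary points are taken within the domain.\<close>

definition assm_A2 ::
    "real set \<Rightarrow> (real \<Rightarrow> real \<Rightarrow> real) \<Rightarrow> real set \<Rightarrow> real \<Rightarrow> real \<Rightarrow> bool" where
  "assm_A2 \<X> p \<Theta>1 \<tau>min \<tau>max \<longleftrightarrow>
     (\<exists>D :: nat \<Rightarrow> nat \<Rightarrow> real \<Rightarrow> real \<Rightarrow> real. \<exists>C.
        (\<forall>\<theta>\<in>\<Theta>1. \<forall>\<tau>\<in>{\<tau>min..\<tau>max}. D 0 0 \<theta> \<tau> = one_bit_prob \<X> p 1 \<theta> \<tau>) \<and>
        (\<forall>i j. i + j < 3 \<longrightarrow> (\<forall>\<theta>\<in>\<Theta>1. \<forall>\<tau>\<in>{\<tau>min..\<tau>max}.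
           ((\<lambda>x. D i j x \<tau>) has_real_derivative D (Suc i) j \<theta> \<tau>) (at \<theta> within \<Theta>1) \<and>
           (D i j \<theta> has_real_derivative D i (Suc j) \<theta> \<tau>) (at \<tau> within {\<tau>min..\<tau>max}))) \<and>
        (\<forall>i j. i + j \<le> 3 \<longrightarrow> continuous_on (\<Theta>1 \<times> {\<tau>min..\<tau>max}) (\<lambda>(\<theta>, \<tau>). D i j \<theta> \<tau>)) \<and>
        (\<forall>i j. 1 \<le> i + j \<and> i + j \<le> 3 \<longrightarrow>
           (\<forall>\<theta>\<in>\<Theta>1. \<forall>\<tau>\<in>{\<tau>min..\<tau>max}. \<bar>D i j \<theta> \<tau>\<bar> \<le> C)))"

definition assm_A3 ::
    "real set \<Rightarrow> (real \<Rightarrow> real \<Rightarrow> real) \<Rightarrow> real set \<Rightarrow> real \<Rightarrow> real \<Rightarrow> bool" where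
  "assm_A3 \<X> p \<Theta>1 \<tau>min \<tau>max \<longleftrightarrow>
     (\<exists>\<delta>\<in>{0<..<1/2}. \<forall>\<theta>\<in>\<Theta>1. \<forall>\<tau>\<in>{\<tau>min..\<tau>max}. one_bit_prob \<X> p 1 \<theta> \<tau> \<in> {\<delta>..1 - \<delta>})"

definition assm_A4 ::
    "real set \<Rightarrow> (real \<Rightarrow> real \<Rightarrow> real) \<Rightarrow> real set \<Rightarrow> real \<Rightarrow> real \<Rightarrow> bool" where
  "assm_A4 \<X> p \<Theta>1 \<tau>min \<tau>max \<longleftrightarrow>
     (\<forall>\<tau>\<in>{\<tau>min..\<tau>max}. \<forall>\<epsilon>>0. \<exists>c>0.
        ereal c \<le> (INF (\<theta>, u)\<in>{(\<theta>, u). \<theta> \<in> \<Theta>1 \<and> u \<in> \<Theta>1 \<and> \<epsilon> \<le> \<bar>u - \<theta>\<bar>}. one_bit_div \<X> p \<theta> u \<tau>))"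

definition assm_A5 ::
    "real set \<Rightarrow> (real \<Rightarrow> real \<Rightarrow> real) \<Rightarrow> real \<Rightarrow> real \<Rightarrow> real \<Rightarrow> bool" where
  "assm_A5 \<X> p \<theta>1 \<tau>min \<tau>max \<longleftrightarrow>
     (\<exists>I0>0. \<forall>\<tau>\<in>{\<tau>min..\<tau>max}.
        I0 \<le> (deriv (\<lambda>\<theta>. one_bit_prob \<X> p 1 \<theta> \<tau>) \<theta>1)\<^sup>2 /
              (one_bit_prob \<X> p 1 \<theta>1 \<tau> * (1 - one_bit_prob \<X> p 1 \<theta>1 \<tau>)))"

text \<open>A negative second derivative at the maximizer presupposes that the divergence is finite and
  differentiable near it, which is what the function \<open>g\<close> expresses. In particular the maximum is
  finite, so both bits have positive probability under \<open>\<theta>0\<close> wherever they do under \<open>\<theta>1\<close>.\<close>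

definition assm_A6 ::
    "real set \<Rightarrow> (real \<Rightarrow> real \<Rightarrow> real) \<Rightarrow> real \<Rightarrow> real \<Rightarrow> real \<Rightarrow> real \<Rightarrow> bool" where
  "assm_A6 \<X> p \<theta>0 \<theta>1 \<tau>min \<tau>max \<longleftrightarrow>
     (\<forall>\<^sub>F \<theta> in nhds \<theta>1. \<exists>\<tau>s\<in>{\<tau>min<..<\<tau>max}.
        \<forall>\<tau>. is_arg_max (one_bit_KL \<X> p \<theta>0 \<theta>) (\<lambda>x. x \<in> {\<tau>min..\<tau>max}) \<tau> \<longleftrightarrow> \<tau> = \<tau>s) \<and>
     (\<exists>\<tau>s g g' c. is_arg_max (one_bit_KL \<X> p \<theta>0 \<theta>1) (\<lambda>x. x \<in> {\<tau>min..\<tau>max}) \<tau>s \<and>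
        (\<forall>\<^sub>F \<tau> in nhds \<tau>s. one_bit_KL \<X> p \<theta>0 \<theta>1 \<tau> = ereal (g \<tau>) \<and>
                          (g has_real_derivative g' \<tau>) (at \<tau>)) \<and>
        (g' has_real_derivative c) (at \<tau>s) \<and> c < 0)"

end

theory Submission
  imports Defs "HOL-Real_Asymp.Real_Asymp"
begin

text \<open>Lower bounds: under a change at \<open>\<kappa>\<close> the log-likelihood ratio of the bits against no change,
  stopped at \<open>T\<close>, has conditional mean at most \<open>KL\<^sub>M\<close> times the conditional mean delay \<open>d\<close>. By
  convexity of the exponential, the alarm comes within a horizon \<open>K d\<close> with conditional probability at least
  about \<open>exp (- KL\<^sub>M d / (1 - 1 / K))\<close> when there is no change. For a joint procedure this
  happens in every block of length \<open>K d\<close>, which bounds its average run length. AQuTe-CUSUM may stop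
  depending on a seed that the bits do not reveal, so there only \<open>\<kappa> = 0\<close> is used and the early alarm is
  compared with the bound \<open>m / \<gamma>\<close> on the probability of an alarm up to \<open>m\<close> that the Shiryaev--Roberts
  martingale provides.

  Upper bounds: each increment of the statistic has conditional mean close to \<open>KL\<^sub>M\<close> unless the
  estimate is far from \<open>\<theta>1\<close>. That bad event at time \<open>n\<close> has small probability given the past of
  \<open>n - w\<close>, and \<open>{T > n}\<close> is contained in \<open>{T > n - w}\<close>, so summing the increments up to \<open>T\<close>
  costs only a factor close to one and a term \<open>O(w)\<close>.\<close>

section \<open>Adapted bits and change of measure\<close>

text \<open>The thresholds depend on earlier bits, so the bits are neither independent nor
  identically distributed. What survives is that, given the past, the next bit is Bernoulli with a
  mean determined by the current threshold. Every estimate below is therefore a one-step estimate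
  that is uniform over thresholds, iterated along the past; compactness of the parameter and
  threshold sets supplies the uniformity. Mean delays are rewritten as series of survival
  probabilities, so that both bounds handle only events known at a finite time, and random sums up
  to an alarm become sums over deterministic times. Two notions of the past compete: the worst-case
  delay conditions on bits alone, while AQuTe-CUSUM also uses its seed. An upper bound given the
  larger past passes to the smaller one. A lower bound does not: conditioning on survival is
  possible only if survival is an event of the bits. A poor estimate and survival at the same time
  are dependent through the shared window. Conditioning \<open>w\<close> steps earlier puts the
  whole window into the future, at the price of comparing survival at two times.\<close>

lemma ennreal_convex_combination:
  assumes "0 \<le> q" "q \<le> 1" "0 \<le> x" "0 \<le> y"
  shows "ennreal q * ennreal x + ennreal (1 - q) * ennreal y = ennreal (q * x + (1 - q) * y)"
  using assms by (simp add: ennreal_mult[symmetric] ennreal_plus[symmetric] del: ennreal_plus)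

lemma abs_ln_ratio_le:
  fixes e :: real
  assumes "0 < e" "a \<in> {e..1}" "b \<in> {e..1}"
  shows "\<bar>ln (a / b)\<bar> \<le> - ln e"
proof -
  have "ln e \<le> ln a" "ln a \<le> 0" "ln e \<le> ln b" "ln b \<le> 0" using assms by auto
  moreover have "ln (a / b) = ln a - ln b" using assms by (simp add: ln_div)
  ultimately show ?thesis by linarith
qed

text \<open>Index \<open>n\<close> is the state just before bit \<open>Suc n\<close>:
  \<open>H n\<close> is the information then available, \<open>E n\<close> the event that this bit
  is 1, \<open>q0 n\<close> and \<open>q1 n\<close> its conditional probabilities without and with
  the change. \<open>H_Suc_split\<close> says that one step adds nothing but this bit, which permits
  induction over events. \<open>law_H_0\<close> lets \<open>H 0\<close> carry a seed whose law
  ignores the change-point.\<close>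

locale bit_model =
  fixes M :: "enat \<Rightarrow> 'a measure" and H :: "nat \<Rightarrow> 'a measure" and E :: "nat \<Rightarrow> 'a set"
    and q0 q1 :: "nat \<Rightarrow> 'a \<Rightarrow> real" and \<eta> :: real
  assumes prob_space_law: "prob_space (M k)"
    and subalgebra_law: "subalgebra (M k) (H n)"
    and sets_H_Suc: "sets (H n) \<subseteq> sets (H (Suc n))"
    and E_sets: "E n \<in> sets (H (Suc n))"
    and q0_measurable: "q0 n \<in> borel_measurable (H n)"
    and q1_measurable: "q1 n \<in> borel_measurable (H n)"
    and \<eta>_pos: "0 < \<eta>"
    and q0_bounds: "\<omega> \<in> space (H n) \<Longrightarrow> q0 n \<omega> \<in> {\<eta>..1 - \<eta>}"
    and q1_bounds: "\<omega> \<in> space (H n) \<Longrightarrow> q1 n \<omega> \<in> {\<eta>..1 - \<eta>}"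
    and H_Suc_split: "A \<in> sets (H (Suc n)) \<Longrightarrow>
          \<exists>A1\<in>sets (H n). \<exists>A2\<in>sets (H n). A = (A1 \<inter> E n) \<union> (A2 - E n)"
    and law_H_0: "A \<in> sets (H 0) \<Longrightarrow> emeasure (M k) A = emeasure (M \<infinity>) A"
    and one_step: "A \<in> sets (H n) \<Longrightarrow> emeasure (M k) (A \<inter> E n) =
          (\<integral>\<^sup>+\<omega>. ennreal (if enat (Suc n) \<le> k then q0 n \<omega> else q1 n \<omega>) * indicator A \<omega> \<partial>M k)"
begin

definition bit_prob :: "enat \<Rightarrow> nat \<Rightarrow> 'a \<Rightarrow> real" where
  "bit_prob k n \<omega> = (if enat (Suc n) \<le> k then q0 n \<omega> else q1 n \<omega>)"

lemma space_law: "space (M k) = space (H n)"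
  using subalgebra_law by (auto simp: subalgebra_def)

lemma space_H: "space (H n) = space (H 0)"
  using space_law by metis

lemma space_law_0: "space (M k) = space (H 0)"
  using space_law by metis

lemma sets_H_mono: "m \<le> n \<Longrightarrow> sets (H m) \<subseteq> sets (H n)"
  by (rule lift_Suc_mono_le[of "\<lambda>n. sets (H n)"]) (use sets_H_Suc in auto)

lemma sets_H_law: "A \<in> sets (H n) \<Longrightarrow> A \<in> sets (M k)"
  using subalgebra_law by (auto simp: subalgebra_def)

lemma measurable_H_mono: "f \<in> measurable (H m) N \<Longrightarrow> m \<le> n \<Longrightarrow> f \<in> measurable (H n) N"
  using sets_H_mono[of m n] space_H[of m] space_H[of n]
  by (auto simp: measurable_def)

lemma measurable_H_law: "f \<in> measurable (H n) N \<Longrightarrow> f \<in> measurable (M k) N"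
  by (rule measurable_from_subalg[OF subalgebra_law])

lemma E_sets_H: "s < n \<Longrightarrow> E s \<in> sets (H n)"
  using E_sets[of s] sets_H_mono[of "Suc s" n] by auto

lemma E_law: "E n \<in> sets (M k)"
  using E_sets sets_H_law by blast

lemma \<eta>_le: "\<eta> \<le> 1 / 2"
proof -
  interpret prob_space "M 0" by (rule prob_space_law)
  obtain \<omega> where "\<omega> \<in> space (H 0)" using not_empty space_law by fastforce
  from q0_bounds[OF this] show ?thesis by auto
qed

lemma bit_prob_measurable: "bit_prob k n \<in> borel_measurable (H n)"
  unfolding bit_prob_def[abs_def] using q0_measurable q1_measurable by simp

lemma bit_prob_bounds: "\<omega> \<in> space (H n) \<Longrightarrow> bit_prob k n \<omega> \<in> {\<eta>..1 - \<eta>}"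
  using q0_bounds q1_bounds by (auto simp: bit_prob_def)

lemma bit_prob_01:
  assumes "\<omega> \<in> space (H n)" shows "0 < bit_prob k n \<omega>" "bit_prob k n \<omega> < 1"
  using bit_prob_bounds[OF assms, of k] \<eta>_pos by auto

text \<open>The hypothesis \<open>eq\<close> identifies \<open>g\<close> as the conditional
  expectation of the indicator of \<open>B\<close> given \<open>H n\<close>, so an \<open>f\<close>
  known at time \<open>n\<close> can be pulled out.\<close>

lemma nn_integral_indicator_eq:
  fixes f g :: "'a \<Rightarrow> ennreal"
  assumes f: "f \<in> borel_measurable (H n)" and g: "g \<in> borel_measurable (H n)" and B[measurable]: "B \<in> sets (M k)"
    and eq: "\<And>A. A \<in> sets (H n) \<Longrightarrow> emeasure (M k) (A \<inter> B) = (\<integral>\<^sup>+\<omega>. g \<omega> * indicator A \<omega> \<partial>M k)"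
  shows "(\<integral>\<^sup>+\<omega>. f \<omega> * indicator B \<omega> \<partial>M k) = (\<integral>\<^sup>+\<omega>. f \<omega> * g \<omega> \<partial>M k)"
proof -
  interpret prob_space "M k" by (rule prob_space_law)
  interpret finite_measure_subalgebra "M k" "H n"
    by unfold_locales (rule subalgebra_law)
  have "AE \<omega> in M k. g \<omega> = nn_cond_exp (M k) (H n) (indicator B) \<omega>"
  proof (rule nn_cond_exp_charact[OF _ _ g])
    fix A assume A: "A \<in> sets (H n)"
    have "(\<integral>\<^sup>+\<omega>\<in>A. indicator B \<omega> \<partial>M k) = (\<integral>\<^sup>+\<omega>. indicator (A \<inter> B) \<omega> \<partial>M k)"
      by (intro nn_integral_cong) (auto split: split_indicator)
    also have "\<dots> = emeasure (M k) (A \<inter> B)"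
      using A sets_H_law by (intro nn_integral_indicator) auto
    finally show "(\<integral>\<^sup>+\<omega>\<in>A. indicator B \<omega> \<partial>M k) = (\<integral>\<^sup>+\<omega>\<in>A. g \<omega> \<partial>M k)" using eq[OF A] by simp
  qed simp
  then have "(\<integral>\<^sup>+\<omega>. f \<omega> * g \<omega> \<partial>M k) = (\<integral>\<^sup>+\<omega>. f \<omega> * nn_cond_exp (M k) (H n) (indicator B) \<omega> \<partial>M k)"
    by (intro nn_integral_cong_AE) auto
  also have "\<dots> = (\<integral>\<^sup>+\<omega>. f \<omega> * indicator B \<omega> \<partial>M k)"
    by (rule nn_cond_exp_intg[OF f]) simp
  finally show ?thesis by simp
qed

lemma one_step_compl:
  assumes A: "A \<in> sets (H n)"
  shows "emeasure (M k) (A - E n) = (\<integral>\<^sup>+\<omega>. ennreal (1 - bit_prob k n \<omega>) * indicator A \<omega> \<partial>M k)"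
proof -
  interpret prob_space "M k" by (rule prob_space_law)
  have [measurable]: "A \<in> events" "E n \<in> events" "bit_prob k n \<in> borel_measurable (M k)"
    by (rule sets_H_law[OF A] E_law measurable_H_law[OF bit_prob_measurable])+
  have "emeasure (M k) (A \<inter> E n) + emeasure (M k) (A - E n) = emeasure (M k) A"
    by (subst plus_emeasure) (auto intro!: arg_cong[where f="emeasure (M k)"])
  also have "\<dots> = (\<integral>\<^sup>+\<omega>. indicator A \<omega> \<partial>M k)" by simp
  also have "\<dots> = (\<integral>\<^sup>+\<omega>. ennreal (bit_prob k n \<omega>) * indicator A \<omega> + ennreal (1 - bit_prob k n \<omega>) * indicator A \<omega> \<partial>M k)"
    using bit_prob_01[of _ n k] space_law[of k n]
    by (intro nn_integral_cong) (simp add: distrib_right[symmetric] ennreal_plus[symmetric] less_imp_le del: ennreal_plus)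
  also have "\<dots> = emeasure (M k) (A \<inter> E n) + (\<integral>\<^sup>+\<omega>. ennreal (1 - bit_prob k n \<omega>) * indicator A \<omega> \<partial>M k)"
    by (subst nn_integral_add) (auto simp: one_step[OF A, folded bit_prob_def])
  finally show ?thesis by (simp add: emeasure_eq_measure)
qed

lemma nn_integral_step:
  fixes f g :: "'a \<Rightarrow> ennreal"
  assumes f: "f \<in> borel_measurable (H n)" and g: "g \<in> borel_measurable (H n)"
  shows "(\<integral>\<^sup>+\<omega>. (if \<omega> \<in> E n then f \<omega> else g \<omega>) \<partial>M k)
    = (\<integral>\<^sup>+\<omega>. ennreal (bit_prob k n \<omega>) * f \<omega> + ennreal (1 - bit_prob k n \<omega>) * g \<omega> \<partial>M k)"
proof -
  have bm[measurable]: "bit_prob k n \<in> borel_measurable (H n)" by (rule bit_prob_measurable)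
  have [measurable]: "f \<in> borel_measurable (M k)" "g \<in> borel_measurable (M k)"
      "bit_prob k n \<in> borel_measurable (M k)" "E n \<in> sets (M k)"
    by (rule measurable_H_law[OF f] measurable_H_law[OF g] measurable_H_law[OF bm] E_law)+
  have "(\<integral>\<^sup>+\<omega>. (if \<omega> \<in> E n then f \<omega> else g \<omega>) \<partial>M k)
      = (\<integral>\<^sup>+\<omega>. f \<omega> * indicator (E n) \<omega> + g \<omega> * indicator (space (M k) - E n) \<omega> \<partial>M k)"
    by (intro nn_integral_cong) (auto split: split_indicator)
  also have "\<dots> = (\<integral>\<^sup>+\<omega>. f \<omega> * indicator (E n) \<omega> \<partial>M k) + (\<integral>\<^sup>+\<omega>. g \<omega> * indicator (space (M k) - E n) \<omega> \<partial>M k)"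
    by (rule nn_integral_add) auto
  also have "(\<integral>\<^sup>+\<omega>. f \<omega> * indicator (E n) \<omega> \<partial>M k) = (\<integral>\<^sup>+\<omega>. f \<omega> * ennreal (bit_prob k n \<omega>) \<partial>M k)"
    by (rule nn_integral_indicator_eq[OF f]) (auto simp: one_step[folded bit_prob_def])
  also have "(\<integral>\<^sup>+\<omega>. g \<omega> * indicator (space (M k) - E n) \<omega> \<partial>M k) = (\<integral>\<^sup>+\<omega>. g \<omega> * ennreal (1 - bit_prob k n \<omega>) \<partial>M k)"
  proof (rule nn_integral_indicator_eq[OF g])
    fix A assume A: "A \<in> sets (H n)"
    have "A \<inter> (space (M k) - E n) = A - E n" using sets.sets_into_space[OF A] space_law[of k n] by auto
    then show "emeasure (M k) (A \<inter> (space (M k) - E n)) = (\<integral>\<^sup>+\<omega>. ennreal (1 - bit_prob k n \<omega>) * indicator A \<omega> \<partial>M k)"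
      by (simp add: one_step_compl[OF A])
  qed auto
  also have "(\<integral>\<^sup>+\<omega>. f \<omega> * ennreal (bit_prob k n \<omega>) \<partial>M k) + (\<integral>\<^sup>+\<omega>. g \<omega> * ennreal (1 - bit_prob k n \<omega>) \<partial>M k)
      = (\<integral>\<^sup>+\<omega>. f \<omega> * ennreal (bit_prob k n \<omega>) + g \<omega> * ennreal (1 - bit_prob k n \<omega>) \<partial>M k)"
    by (rule nn_integral_add[symmetric]) auto
  finally show ?thesis by (simp add: mult.commute)
qed

lemma integrable_bounded:
  fixes f :: "'a \<Rightarrow> real"
  assumes "f \<in> borel_measurable (M k)" "\<And>\<omega>. \<omega> \<in> space (M k) \<Longrightarrow> \<bar>f \<omega>\<bar> \<le> C"
  shows "integrable (M k) f"
proof -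
  interpret prob_space "M k" by (rule prob_space_law)
  show ?thesis using assms by (intro integrable_const_bound[where B=C] AE_I2) auto
qed

lemma integrable_indicator: "A \<in> sets (M k) \<Longrightarrow> integrable (M k) (indicator A :: 'a \<Rightarrow> real)"
  by (intro integrable_bounded[where C=1]) (auto split: split_indicator)

text \<open>Adding the bound \<open>C\<close> makes both branches nonnegative, so that
  \<open>nn_integral_step\<close> applies; \<open>C\<close> cancels because the branch probabilities
  sum to one.\<close>

lemma integral_step:
  fixes f g :: "'a \<Rightarrow> real"
  assumes f: "f \<in> borel_measurable (H n)" and g: "g \<in> borel_measurable (H n)"
    and fb: "\<And>\<omega>. \<omega> \<in> space (H n) \<Longrightarrow> \<bar>f \<omega>\<bar> \<le> C" and gb: "\<And>\<omega>. \<omega> \<in> space (H n) \<Longrightarrow> \<bar>g \<omega>\<bar> \<le> C"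
  shows "(\<integral>\<omega>. (if \<omega> \<in> E n then f \<omega> else g \<omega>) \<partial>M k)
    = (\<integral>\<omega>. bit_prob k n \<omega> * f \<omega> + (1 - bit_prob k n \<omega>) * g \<omega> \<partial>M k)"
proof -
  interpret prob_space "M k" by (rule prob_space_law)
  let ?F = "\<lambda>\<omega>. if \<omega> \<in> E n then f \<omega> else g \<omega>"
    and ?G = "\<lambda>\<omega>. bit_prob k n \<omega> * f \<omega> + (1 - bit_prob k n \<omega>) * g \<omega>"
  have [measurable]: "f \<in> borel_measurable (M k)" "g \<in> borel_measurable (M k)"
      "bit_prob k n \<in> borel_measurable (M k)" "E n \<in> sets (M k)"
    by (rule measurable_H_law[OF f] measurable_H_law[OF g] measurable_H_law[OF bit_prob_measurable] E_law)+
  have conv: "\<bar>?G \<omega>\<bar> \<le> C \<and> 0 \<le> ?G \<omega> + C \<and> 0 \<le> f \<omega> + C \<and> 0 \<le> g \<omega> + C \<and> 0 \<le> bit_prob k n \<omega> \<and> bit_prob k n \<omega> \<le> 1"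
    if "\<omega> \<in> space (M k)" for \<omega>
  proof -
    have w: "\<omega> \<in> space (H n)" using that space_law[of k n] by simp
    note b = bit_prob_01[OF w, of k]
    have "?G \<omega> \<le> C" "- ?G \<omega> \<le> C"
      using convex_bound_le[of "f \<omega>" C "g \<omega>" "bit_prob k n \<omega>" "1 - bit_prob k n \<omega>"]
        convex_bound_le[of "- f \<omega>" C "- g \<omega>" "bit_prob k n \<omega>" "1 - bit_prob k n \<omega>"] fb[OF w] gb[OF w] b
      by auto
    then show ?thesis using fb[OF w] gb[OF w] b by auto
  qed
  have F_int: "integrable (M k) ?F"
    using fb gb space_law[of k n] by (intro integrable_bounded[where C=C]) auto
  have G_int: "integrable (M k) ?G"
    using conv by (intro integrable_bounded[where C=C]) auto
  have "(\<integral>\<^sup>+\<omega>. ennreal (?F \<omega> + C) \<partial>M k) = (\<integral>\<^sup>+\<omega>. (if \<omega> \<in> E n then ennreal (f \<omega> + C) else ennreal (g \<omega> + C)) \<partial>M k)"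
    by (intro nn_integral_cong) auto
  also have "\<dots> = (\<integral>\<^sup>+\<omega>. ennreal (bit_prob k n \<omega>) * ennreal (f \<omega> + C) + ennreal (1 - bit_prob k n \<omega>) * ennreal (g \<omega> + C) \<partial>M k)"
    using f g by (intro nn_integral_step) auto
  also have "\<dots> = (\<integral>\<^sup>+\<omega>. ennreal (?G \<omega> + C) \<partial>M k)"
    using conv by (intro nn_integral_cong, subst ennreal_convex_combination) (auto simp: algebra_simps)
  finally have "ennreal (\<integral>\<omega>. ?F \<omega> + C \<partial>M k) = ennreal (\<integral>\<omega>. ?G \<omega> + C \<partial>M k)"
    using conv F_int G_int fb gb space_law[of k n]
    by (subst (asm) (1 2) nn_integral_eq_integral) (auto intro!: AE_I2 simp: minus_le_iff add_increasing)
  moreover have "0 \<le> (\<integral>\<omega>. ?F \<omega> + C \<partial>M k)" "0 \<le> (\<integral>\<omega>. ?G \<omega> + C \<partial>M k)"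
    using conv by (force intro!: integral_nonneg_AE AE_I2)+
  ultimately have "(\<integral>\<omega>. ?F \<omega> + C \<partial>M k) = (\<integral>\<omega>. ?G \<omega> + C \<partial>M k)" by simp
  then show ?thesis using F_int G_int by (simp del: Bochner_Integration.integral_diff)
qed

section \<open>Likelihood ratios and change of measure\<close>

definition inv_lr :: "nat \<Rightarrow> 'a \<Rightarrow> real" where
  "inv_lr s \<omega> = (if \<omega> \<in> E s then q0 s \<omega> / q1 s \<omega> else (1 - q0 s \<omega>) / (1 - q1 s \<omega>))"

lemma inv_lr_measurable: "s < n \<Longrightarrow> inv_lr s \<in> borel_measurable (H n)"
proof -
  assume s: "s < n"
  have [measurable]: "q0 s \<in> borel_measurable (H n)" "q1 s \<in> borel_measurable (H n)" "E s \<in> sets (H n)"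
    using measurable_H_mono[OF q0_measurable, of s n] measurable_H_mono[OF q1_measurable, of s n]
      E_sets_H[OF s] s by auto
  show ?thesis unfolding inv_lr_def[abs_def] by measurable
qed

lemma inv_lr_pos: "\<omega> \<in> space (H n) \<Longrightarrow> 0 < inv_lr s \<omega>"
  using q0_bounds[of \<omega> s] q1_bounds[of \<omega> s] \<eta>_pos space_H[of n] space_H[of s] by (auto simp: inv_lr_def)

text \<open>No change is in the numerator, because integrals under a change at \<open>k\<close> are
  to yield probabilities under no change. Bits up to time \<open>k\<close> have the same conditional
  law in both models and contribute no factor.\<close>

definition inv_lr_prod :: "nat \<Rightarrow> nat \<Rightarrow> 'a \<Rightarrow> real" where
  "inv_lr_prod k n \<omega> = (\<Prod>s\<in>{k..<n}. inv_lr s \<omega>)"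

lemma inv_lr_prod_measurable: "inv_lr_prod k n \<in> borel_measurable (H n)"
  unfolding inv_lr_prod_def[abs_def] by (intro borel_measurable_prod inv_lr_measurable) auto

lemma inv_lr_prod_pos: "\<omega> \<in> space (H m) \<Longrightarrow> 0 < inv_lr_prod k n \<omega>"
  unfolding inv_lr_prod_def using inv_lr_pos by (intro prod_pos) auto

text \<open>The identity on events says that \<open>M k\<close> restricted to \<open>H n\<close> has
  density \<open>g\<close> with respect to the restriction of \<open>M l\<close>; it then extends to
  integrals of functions known at time \<open>n\<close>.\<close>

lemma nn_integral_H_cong:
  assumes "\<And>A. A \<in> sets (H n) \<Longrightarrow> emeasure (M k) A = (\<integral>\<^sup>+\<omega>. g \<omega> * indicator A \<omega> \<partial>M l)"
    and g: "g \<in> borel_measurable (H n)" and f: "f \<in> borel_measurable (H n)"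
  shows "(\<integral>\<^sup>+\<omega>. f \<omega> \<partial>M k) = (\<integral>\<^sup>+\<omega>. g \<omega> * f \<omega> \<partial>M l)"
proof -
  let ?K = "restr_to_subalg (M k) (H n)" and ?L = "restr_to_subalg (M l) (H n)"
  have [measurable_cong]: "sets ?K = sets (H n)" "sets ?L = sets (H n)"
    using sets_restr_to_subalg[OF subalgebra_law] by auto
  have eq: "?K = density ?L g"
  proof (rule measure_eqI)
    fix A assume "A \<in> sets ?K"
    then have A[measurable]: "A \<in> sets (H n)" using sets_restr_to_subalg[OF subalgebra_law] by auto
    have "emeasure (density ?L g) A = (\<integral>\<^sup>+\<omega>. g \<omega> * indicator A \<omega> \<partial>?L)"
      using g A by (intro emeasure_density) auto
    also have "\<dots> = (\<integral>\<^sup>+\<omega>. g \<omega> * indicator A \<omega> \<partial>M l)"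
      using g A by (intro nn_integral_subalgebra2[OF subalgebra_law]) auto
    finally show "emeasure ?K A = emeasure (density ?L g) A"
      using assms(1)[OF A] emeasure_restr_to_subalg[OF subalgebra_law A] by simp
  qed (simp add: sets_restr_to_subalg[OF subalgebra_law])
  have "(\<integral>\<^sup>+\<omega>. f \<omega> \<partial>M k) = (\<integral>\<^sup>+\<omega>. f \<omega> \<partial>?K)"
    by (rule nn_integral_subalgebra2[OF subalgebra_law f, symmetric])
  also have "\<dots> = (\<integral>\<^sup>+\<omega>. g \<omega> * f \<omega> \<partial>?L)"
    unfolding eq using f g by (intro nn_integral_density) auto
  also have "\<dots> = (\<integral>\<^sup>+\<omega>. g \<omega> * f \<omega> \<partial>M l)"
    using f g by (intro nn_integral_subalgebra2[OF subalgebra_law]) auto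
  finally show ?thesis .
qed

text \<open>By induction on time: \<open>H_Suc_split\<close> writes an event as two earlier events
  glued along the newest bit, and the induction hypothesis, extended to functions, applies to both.
  A bit after the change contributes one factor; a bit before it contributes none, since both laws
  use \<open>q0\<close> there.\<close>

lemma change_of_measure:
  assumes "A \<in> sets (H n)"
  shows "emeasure (M \<infinity>) A = (\<integral>\<^sup>+\<omega>. ennreal (inv_lr_prod k n \<omega>) * indicator A \<omega> \<partial>M (enat k))"
  using assms
proof (induction n arbitrary: A)
  case 0
  have "(\<integral>\<^sup>+\<omega>. indicator A \<omega> \<partial>M (enat k)) = emeasure (M (enat k)) A"
    using 0 sets_H_law by (intro nn_integral_indicator) auto
  then show ?case using law_H_0[OF 0, of "enat k"] by (simp add: inv_lr_prod_def)
next
  case (Suc n)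
  obtain A1 A2 where A1[measurable]: "A1 \<in> sets (H n)" and A2[measurable]: "A2 \<in> sets (H n)"
    and A: "A = (A1 \<inter> E n) \<union> (A2 - E n)" using H_Suc_split[OF Suc.prems] by blast
  have [measurable]: "q0 n \<in> borel_measurable (H n)" "q1 n \<in> borel_measurable (H n)"
      "inv_lr_prod k n \<in> borel_measurable (H n)"
    by (rule q0_measurable q1_measurable inv_lr_prod_measurable)+
  let ?L = "inv_lr_prod k n"
  have *: "(\<integral>\<^sup>+\<omega>. f \<omega> \<partial>M \<infinity>) = (\<integral>\<^sup>+\<omega>. ennreal (?L \<omega>) * f \<omega> \<partial>M (enat k))"
    if "f \<in> borel_measurable (H n)" for f :: "'a \<Rightarrow> ennreal"
    using Suc.IH that by (intro nn_integral_H_cong) auto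
  have "A \<in> sets (M \<infinity>)" using Suc.prems sets_H_law by blast
  then have "emeasure (M \<infinity>) A = (\<integral>\<^sup>+\<omega>. indicator A \<omega> \<partial>M \<infinity>)" by simp
  also have "\<dots> = (\<integral>\<^sup>+\<omega>. (if \<omega> \<in> E n then indicator A1 \<omega> else indicator A2 \<omega>) \<partial>M \<infinity>)"
    by (intro nn_integral_cong) (auto simp: A split: split_indicator)
  also have "\<dots> = (\<integral>\<^sup>+\<omega>. ennreal (q0 n \<omega>) * indicator A1 \<omega> + ennreal (1 - q0 n \<omega>) * indicator A2 \<omega> \<partial>M \<infinity>)"
    by (subst nn_integral_step) (auto simp: bit_prob_def)
  also have "\<dots> = (\<integral>\<^sup>+\<omega>. ennreal (?L \<omega>) * (ennreal (q0 n \<omega>) * indicator A1 \<omega> + ennreal (1 - q0 n \<omega>) * indicator A2 \<omega>) \<partial>M (enat k))"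
    by (rule *) measurable
  also have "\<dots> = (\<integral>\<^sup>+\<omega>. ennreal (inv_lr_prod k (Suc n) \<omega>) * indicator A \<omega> \<partial>M (enat k))"
  proof (cases "k \<le> n")
    case True
    have bp: "bit_prob (enat k) n = q1 n" using True by (auto simp: bit_prob_def)
    \<comment> \<open>Each branch is multiplied and divided by its probability after the change,
      which exhibits the new likelihood factor.\<close>
    have rw: "ennreal x * (ennreal y * a + ennreal z * b) =
        ennreal p * (ennreal (x * (y / p)) * a) + ennreal (1 - p) * (ennreal (x * (z / (1 - p))) * b)"
      if "0 < p" "p < 1" "0 \<le> x" "0 \<le> y" "0 \<le> z" for x y z p :: real and a b :: ennreal
    proof -
      have "x * y = p * (x * (y / p))" "x * z = (1 - p) * (x * (z / (1 - p)))"
        using that by (auto simp: field_simps)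
      then have "ennreal x * ennreal y = ennreal p * ennreal (x * (y / p))"
        "ennreal x * ennreal z = ennreal (1 - p) * ennreal (x * (z / (1 - p)))"
        using that by (metis ennreal_mult'' ennreal_mult' divide_nonneg_pos mult_nonneg_nonneg less_imp_le diff_gt_0_iff_gt)+
      then show ?thesis by (simp add: distrib_left mult.assoc[symmetric])
    qed
    have pr: "inv_lr_prod k (Suc n) \<omega> = ?L \<omega> * inv_lr n \<omega>" for \<omega>
      using True by (simp add: inv_lr_prod_def)
    have "(\<integral>\<^sup>+\<omega>. ennreal (inv_lr_prod k (Suc n) \<omega>) * indicator A \<omega> \<partial>M (enat k))
       = (\<integral>\<^sup>+\<omega>. (if \<omega> \<in> E n then ennreal (?L \<omega> * (q0 n \<omega> / q1 n \<omega>)) * indicator A1 \<omega>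
             else ennreal (?L \<omega> * ((1 - q0 n \<omega>) / (1 - q1 n \<omega>))) * indicator A2 \<omega>) \<partial>M (enat k))"
      by (intro nn_integral_cong) (auto simp: pr inv_lr_def A split: split_indicator)
    also have "\<dots> = (\<integral>\<^sup>+\<omega>. ennreal (q1 n \<omega>) * (ennreal (?L \<omega> * (q0 n \<omega> / q1 n \<omega>)) * indicator A1 \<omega>) +
        ennreal (1 - q1 n \<omega>) * (ennreal (?L \<omega> * ((1 - q0 n \<omega>) / (1 - q1 n \<omega>))) * indicator A2 \<omega>) \<partial>M (enat k))"
      by (subst nn_integral_step) (auto simp: bp)
    also have "\<dots> = (\<integral>\<^sup>+\<omega>. ennreal (?L \<omega>) * (ennreal (q0 n \<omega>) * indicator A1 \<omega> + ennreal (1 - q0 n \<omega>) * indicator A2 \<omega>) \<partial>M (enat k))"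
    proof (intro nn_integral_cong rw[symmetric])
      fix \<omega> assume "\<omega> \<in> space (M (enat k))"
      then have w: "\<omega> \<in> space (H n)" using space_law by metis
      show "0 < q1 n \<omega>" "q1 n \<omega> < 1" "0 \<le> q0 n \<omega>" "0 \<le> 1 - q0 n \<omega>" "0 \<le> inv_lr_prod k n \<omega>"
        using q0_bounds[OF w] q1_bounds[OF w] \<eta>_pos inv_lr_prod_pos[OF w, of k n] by auto
    qed
    finally show ?thesis by simp
  next
    case False
    have bp: "bit_prob (enat k) n = q0 n" using False by (auto simp: bit_prob_def)
    have L: "?L \<omega> = 1" "inv_lr_prod k (Suc n) \<omega> = 1" for \<omega> using False by (auto simp: inv_lr_prod_def)
    have "(\<integral>\<^sup>+\<omega>. indicator A \<omega> \<partial>M (enat k)) = (\<integral>\<^sup>+\<omega>. (if \<omega> \<in> E n then indicator A1 \<omega> else indicator A2 \<omega>) \<partial>M (enat k))"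
      by (intro nn_integral_cong) (auto simp: A split: split_indicator)
    also have "\<dots> = (\<integral>\<^sup>+\<omega>. ennreal (q0 n \<omega>) * indicator A1 \<omega> + ennreal (1 - q0 n \<omega>) * indicator A2 \<omega> \<partial>M (enat k))"
      by (subst nn_integral_step) (auto simp: bp)
    finally show ?thesis by (simp add: L)
  qed
  finally show ?case .
qed

end

section \<open>Early alarms\<close>

text \<open>The divergence of two Bernoulli laws as a real number. It is applied only to means
  strictly between 0 and 1, where it agrees with the extended-real
  \<open>one_bit_div\<close>.\<close>

definition bit_kl :: "real \<Rightarrow> real \<Rightarrow> real" where
  "bit_kl p q = p * ln (p / q) + (1 - p) * ln ((1 - p) / (1 - q))"

context bit_model
begin

definition alive :: "('a \<Rightarrow> enat) \<Rightarrow> nat \<Rightarrow> 'a set" where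
  "alive T n = {\<omega> \<in> space (H 0). enat n < T \<omega>}"

text \<open>The stopping-time property for \<open>H\<close>, expressed at finite times only, because
  \<open>H\<close> has no member for time infinity.\<close>

definition adapted_time :: "('a \<Rightarrow> enat) \<Rightarrow> bool" where
  "adapted_time T \<longleftrightarrow> (\<forall>n. alive T n \<in> sets (H n))"

lemma alive_sets: "adapted_time T \<Longrightarrow> m \<le> n \<Longrightarrow> alive T m \<in> sets (H n)"
  using sets_H_mono by (auto simp: adapted_time_def)

lemma alive_law: "adapted_time T \<Longrightarrow> alive T n \<in> sets (M k)"
  using alive_sets[of T n n] sets_H_law by auto

lemma alive_antimono: "m \<le> n \<Longrightarrow> alive T n \<subseteq> alive T m"
  by (auto simp: alive_def) (meson enat_ord_simps(1) le_less_trans)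

lemma adapted_time_measurable:
  assumes "adapted_time T"
  shows "T \<in> measurable (M k) (count_space UNIV)"
proof -
  have *: "T -` {x} \<inter> space (M k) \<in> sets (M k)" for x
  proof (cases x)
    case (enat n)
    have "T -` {enat n} \<inter> space (M k) = (if n = 0 then space (M k) else alive T (n - 1)) - alive T n"
    proof (intro set_eqI)
      fix \<omega> show "\<omega> \<in> T -` {enat n} \<inter> space (M k) \<longleftrightarrow>
          \<omega> \<in> (if n = 0 then space (M k) else alive T (n - 1)) - alive T n"
        by (cases "T \<omega>") (auto simp: alive_def space_law_0)
    qed
    then show ?thesis using alive_law[OF assms] enat by simp
  next
    case infinity
    have "T -` {\<infinity>} \<inter> space (M k) = (\<Inter>n. alive T n)"
    proof (intro set_eqI iffI)
      fix \<omega> assume *: "\<omega> \<in> (\<Inter>n. alive T n)"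
      then have "\<And>n. enat n < T \<omega>" and w: "\<omega> \<in> space (M k)" by (auto simp: alive_def space_law_0)
      then have "T \<omega> = \<infinity>" by (metis less_irrefl not_infinity_eq)
      with w show "\<omega> \<in> T -` {\<infinity>} \<inter> space (M k)" by auto
    qed (auto simp: alive_def space_law_0)
    then show ?thesis using alive_law[OF assms] infinity by (auto intro!: sets.countable_INT'')
  qed
  show ?thesis
    by (subst measurable_count_space_eq_countable) (auto intro: *)
qed

text \<open>The tail-sum formula for the truncated difference. All delays are estimated through this
  series.\<close>

lemma nn_integral_delay:
  assumes T: "adapted_time T" and A: "A \<in> sets (M l)"
  shows "(\<integral>\<^sup>+\<omega>. ennreal_of_enat (T \<omega> - enat k) * indicator A \<omega> \<partial>M l)
    = (\<Sum>j. emeasure (M l) (A \<inter> alive T (k + j)))"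
proof -
  have [measurable]: "T \<in> measurable (M l) (count_space UNIV)" by (rule adapted_time_measurable[OF T])
  have [measurable]: "A \<in> sets (M l)" by fact
  have "(\<integral>\<^sup>+\<omega>. ennreal_of_enat (T \<omega> - enat k) * indicator A \<omega> \<partial>M l)
      = (\<integral>\<^sup>+\<omega>. ennreal_of_enat (if \<omega> \<in> A then T \<omega> - enat k else 0) \<partial>M l)"
    by (intro nn_integral_cong) (auto split: split_indicator)
  also have "\<dots> = (\<Sum>j. emeasure (M l) {\<omega> \<in> space (M l). enat j < (if \<omega> \<in> A then T \<omega> - enat k else 0)})"
    by (rule nn_integral_enat_function) measurable
  moreover have "{\<omega> \<in> space (M l). enat j < (if \<omega> \<in> A then T \<omega> - enat k else 0)} = A \<inter> alive T (k + j)" for j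
  proof -
    have "enat j < t - enat k \<longleftrightarrow> enat (k + j) < t" for t
      by (cases t) auto
    then show ?thesis using sets.sets_into_space[OF A]
      by (auto simp: alive_def space_law_0 split: if_splits)
  qed
  ultimately show ?thesis by simp
qed

lemma sum_alive_le_delay:
  assumes T: "adapted_time T" and A: "A \<in> sets (M l)" and d: "0 \<le> d"
    and *: "(\<integral>\<^sup>+\<omega>. ennreal_of_enat (T \<omega> - enat k) * indicator A \<omega> \<partial>M l) \<le> ennreal d * emeasure (M l) A"
  shows "(\<Sum>s\<in>{k..<k + m}. measure (M l) (A \<inter> alive T s)) \<le> d * measure (M l) A"
proof -
  interpret prob_space "M l" by (rule prob_space_law)
  have "(\<Sum>s\<in>{k..<k + m}. measure (M l) (A \<inter> alive T s)) = (\<Sum>j<m. measure (M l) (A \<inter> alive T (k + j)))"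
    using sum.shift_bounds_nat_ivl[of "\<lambda>s. prob (A \<inter> alive T s)" 0 k m] by (simp add: atLeast0LessThan add.commute)
  moreover have "ennreal \<dots> = (\<Sum>j<m. emeasure (M l) (A \<inter> alive T (k + j)))"
    by (simp add: emeasure_eq_measure sum_ennreal)
  moreover have "\<dots> \<le> (\<Sum>j. emeasure (M l) (A \<inter> alive T (k + j)))"
    by (rule sum_le_suminf) auto
  moreover have "\<dots> \<le> ennreal (d * prob A)"
    using * nn_integral_delay[OF T A, of k] d by (simp add: emeasure_eq_measure ennreal_mult)
  ultimately have "ennreal (\<Sum>s\<in>{k..<k + m}. prob (A \<inter> alive T s)) \<le> ennreal (d * prob A)"
    by simp
  then show ?thesis using d by (simp add: ennreal_le_iff)
qed

lemma inv_lr_bounds: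
  assumes "\<omega> \<in> space (H n)"
  shows "\<eta> \<le> inv_lr s \<omega>" "inv_lr s \<omega> \<le> 1 / \<eta>"
proof -
  have w: "\<omega> \<in> space (H s)" using assms space_H[of n] space_H[of s] by auto
  have *: "\<eta> \<le> x / y \<and> x / y \<le> 1 / \<eta>" if "\<eta> \<le> x" "x \<le> 1" "\<eta> \<le> y" "y \<le> 1" for x y
    using that \<eta>_pos mult_mono[of \<eta> x y 1] mult_mono[of x 1 \<eta> y]
    by (auto simp: field_simps)
  show "\<eta> \<le> inv_lr s \<omega>" "inv_lr s \<omega> \<le> 1 / \<eta>"
    using *[of "q0 s \<omega>" "q1 s \<omega>"] *[of "1 - q0 s \<omega>" "1 - q1 s \<omega>"] q0_bounds[OF w] q1_bounds[OF w] \<eta>_pos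
    by (auto simp: inv_lr_def)
qed

lemma law_eq_on_past:
  assumes "A \<in> sets (H k)" shows "emeasure (M \<infinity>) A = emeasure (M (enat k)) A"
  using change_of_measure[OF assms, of k] sets_H_law[OF assms, of "enat k"]
  by (simp add: inv_lr_prod_def)

text \<open>The heart of the lower bound: with \<open>llr\<close> the log-likelihood ratio stopped at \<open>T\<close>, the tangent
  inequality \<open>exp (- llr) \<ge> exp (- c) * (1 + c - llr)\<close> turns the mean of \<open>llr\<close>, at most \<open>I\<close> times
  the mean delay, into a lower bound on the probability of an early alarm without change.\<close>

lemma early_alarm_prob:
  assumes T: "adapted_time T" and A: "A \<in> sets (H k)" and AT: "A \<subseteq> alive T k"
    and d: "0 \<le> d"
    and delay: "(\<integral>\<^sup>+\<omega>. ennreal_of_enat (T \<omega> - enat k) * indicator A \<omega> \<partial>M (enat k))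
      \<le> ennreal d * emeasure (M (enat k)) A"
    and I: "\<And>n \<omega>. \<omega> \<in> space (H 0) \<Longrightarrow> bit_kl (q1 n \<omega>) (q0 n \<omega>) \<le> I" "0 \<le> I"
    and m: "0 < m" and c: "I * d + 2 \<le> (1 + c) * (1 - d / real m)" "-1 \<le> c"
  shows "exp (- c) * measure (M \<infinity>) A \<le> measure (M \<infinity>) (A - alive T (k + m))"
proof -
  let ?P = "M (enat k)"
  interpret P: prob_space ?P by (rule prob_space_law)
  interpret Q: prob_space "M \<infinity>" by (rule prob_space_law)
  let ?\<Omega> = "space (H 0)"
  \<comment> \<open>Freezing the factors at 1 once \<open>T\<close> has occurred makes
    \<open>L\<close> the inverse likelihood ratio stopped at \<open>T\<close>, so its logarithm
    accumulates divergence only while no alarm has been raised.\<close>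
  define V where "V s \<omega> = (if \<omega> \<in> alive T s then inv_lr s \<omega> else 1)" for s \<omega>
  define L where "L n \<omega> = (\<Prod>s\<in>{k..<n}. V s \<omega>)" for n \<omega>
  have spP: "space ?P = ?\<Omega>" by (rule space_law_0)
  have A_law[measurable]: "A \<in> sets ?P" using A by (rule sets_H_law)
  have A_H: "A \<in> sets (H n)" if "k \<le> n" for n using A sets_H_mono[OF that] by auto
  have alive_P[measurable]: "alive T n \<in> sets ?P" for n by (rule alive_law[OF T])
  have [measurable]: "q0 n \<in> borel_measurable (H n)" "q1 n \<in> borel_measurable (H n)" for n
    by (rule q0_measurable q1_measurable)+
  have V_meas: "V s \<in> borel_measurable (H n)" if "s < n" for s n
  proof -
    have [measurable]: "alive T s \<in> sets (H n)" "inv_lr s \<in> borel_measurable (H n)"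
      using alive_sets[OF T, of s n] inv_lr_measurable[OF that] that by auto
    show ?thesis unfolding V_def[abs_def] by measurable
  qed
  have L_meas: "L n \<in> borel_measurable (H n)" for n
    unfolding L_def[abs_def] by (intro borel_measurable_prod V_meas) auto
  have L_meas_P[measurable]: "L n \<in> borel_measurable ?P" for n
    by (rule measurable_H_law[OF L_meas])
  have V_bounds: "\<eta> \<le> V s \<omega>" "V s \<omega> \<le> 1 / \<eta>" "0 < V s \<omega>" if "\<omega> \<in> ?\<Omega>" for s \<omega>
    using inv_lr_bounds[of \<omega> 0 s] that \<eta>_pos \<eta>_le by (auto simp: V_def field_simps)
  have L_pos: "0 < L n \<omega>" if "\<omega> \<in> ?\<Omega>" for n \<omega>
    unfolding L_def using V_bounds(3)[OF that] by (intro prod_pos) auto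
  have L_le: "L n \<omega> \<le> (1 / \<eta>) ^ (n - k)" if "\<omega> \<in> ?\<Omega>" for n \<omega>
  proof -
    have "L n \<omega> \<le> (\<Prod>s\<in>{k..<n}. 1 / \<eta>)"
      unfolding L_def using V_bounds[OF that] less_imp_le by (intro prod_mono) blast
    then show ?thesis by simp
  qed
  have L_int: "integrable ?P (\<lambda>\<omega>. L n \<omega> * indicator B \<omega>)" if "B \<in> sets ?P" for n B
    using that L_le[of _ n] L_pos[of _ n] spP \<eta>_pos
    by (intro integrable_bounded[where C="(1 / \<eta>) ^ (n - k)"])
       (auto split: split_indicator simp: less_imp_le)
  \<comment> \<open>After the change the stopped inverse likelihood ratio is a martingale: the
    branch probabilities cancel the denominators of the new factor. Its mass on \<open>A\<close>
    therefore never changes.\<close>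
  have L_const: "(\<integral>\<omega>. L (k + j) \<omega> * indicator A \<omega> \<partial>?P) = P.prob A" for j
  proof (induction j)
    case 0
    show ?case by (simp add: L_def)
  next
    case (Suc j)
    let ?n = "k + j"
    have rewr: "L (Suc ?n) \<omega> = L ?n \<omega> * V ?n \<omega>" for \<omega> by (simp add: L_def)
    let ?f = "\<lambda>\<omega>. L ?n \<omega> * indicator A \<omega> * (if \<omega> \<in> alive T ?n then q0 ?n \<omega> / q1 ?n \<omega> else 1)"
    let ?g = "\<lambda>\<omega>. L ?n \<omega> * indicator A \<omega> * (if \<omega> \<in> alive T ?n then (1 - q0 ?n \<omega>) / (1 - q1 ?n \<omega>) else 1)"
    have [measurable]: "A \<in> sets (H ?n)" "alive T ?n \<in> sets (H ?n)" "L ?n \<in> borel_measurable (H ?n)"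
      by (auto intro: A_H alive_sets[OF T] L_meas)
    have bnd: "\<bar>L ?n \<omega> * indicator A \<omega> * (if b then x / y else 1)\<bar> \<le> (1 / \<eta>) ^ j * (1 / \<eta>)"
      if "\<omega> \<in> space (H ?n)" "\<eta> \<le> y" "0 \<le> x" "x \<le> 1" for b x y \<omega>
    proof -
      have "\<omega> \<in> ?\<Omega>" using that space_H by metis
      from L_le[OF this, of ?n] L_pos[OF this, of ?n]
      have "\<bar>L ?n \<omega> * indicator A \<omega>\<bar> \<le> (1 / \<eta>) ^ j" using \<eta>_pos by (auto split: split_indicator)
      moreover have "\<bar>if b then x / y else 1\<bar> \<le> 1 / \<eta>"
        using that \<eta>_pos \<eta>_le frac_le[of 1 x \<eta> y] by (auto simp: field_simps)
      ultimately show ?thesis using \<eta>_pos by (simp only: abs_mult) (intro mult_mono, auto)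
    qed
    have qb: "\<eta> \<le> q1 ?n \<omega> \<and> \<eta> \<le> 1 - q1 ?n \<omega> \<and> 0 \<le> q0 ?n \<omega> \<and> q0 ?n \<omega> \<le> 1" if "\<omega> \<in> space (H ?n)" for \<omega>
      using q0_bounds[OF that] q1_bounds[OF that] \<eta>_pos by auto
    have "(\<integral>\<omega>. L (k + Suc j) \<omega> * indicator A \<omega> \<partial>?P) = (\<integral>\<omega>. (if \<omega> \<in> E ?n then ?f \<omega> else ?g \<omega>) \<partial>?P)"
      by (intro Bochner_Integration.integral_cong) (auto simp: rewr V_def inv_lr_def)
    also have "\<dots> = (\<integral>\<omega>. bit_prob (enat k) ?n \<omega> * ?f \<omega> + (1 - bit_prob (enat k) ?n \<omega>) * ?g \<omega> \<partial>?P)"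
      using qb by (intro integral_step[where C="(1 / \<eta>) ^ j * (1 / \<eta>)"] bnd) auto
    also have "\<dots> = (\<integral>\<omega>. L ?n \<omega> * indicator A \<omega> \<partial>?P)"
    proof (rule Bochner_Integration.integral_cong[OF refl])
      fix \<omega> assume "\<omega> \<in> space ?P"
      then have "0 < q1 ?n \<omega>" "q1 ?n \<omega> < 1" using qb[of \<omega>] \<eta>_pos space_law[of "enat k" ?n] by auto
      moreover have "bit_prob (enat k) ?n \<omega> = q1 ?n \<omega>" by (simp add: bit_prob_def)
      ultimately show "bit_prob (enat k) ?n \<omega> * ?f \<omega> + (1 - bit_prob (enat k) ?n \<omega>) * ?g \<omega> = L ?n \<omega> * indicator A \<omega>"
        by (auto simp: field_simps)
    qed
    finally show ?case using Suc.IH by simp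
  qed
  define llr where "llr \<omega> = - ln (L (k + m) \<omega>)" for \<omega>
  have L_exp: "L (k + m) \<omega> = exp (- llr \<omega>)" if "\<omega> \<in> ?\<Omega>" for \<omega>
    using L_pos[OF that] by (simp add: llr_def)
  define z where "z s \<omega> = - ln (V s \<omega>)" for s \<omega>
  have llr_sum: "llr \<omega> = (\<Sum>s\<in>{k..<k+m}. z s \<omega>)" if "\<omega> \<in> ?\<Omega>" for \<omega>
  proof -
    have "ln (L (k + m) \<omega>) = (\<Sum>s\<in>{k..<k+m}. ln (V s \<omega>))"
      unfolding L_def using V_bounds(3)[OF that] by (intro ln_prod) (auto simp: less_imp_neq[symmetric])
    then show ?thesis by (simp add: llr_def z_def sum_negf)
  qed
  have z_meas: "z s \<in> borel_measurable ?P" for s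
    unfolding z_def[abs_def] using measurable_H_law[OF V_meas[of s "Suc s"]] by measurable
  have z_bound: "\<bar>z s \<omega>\<bar> \<le> - ln \<eta>" if "\<omega> \<in> ?\<Omega>" for s \<omega>
  proof -
    have "ln \<eta> \<le> ln (V s \<omega>)" "ln (V s \<omega>) \<le> ln (1 / \<eta>)"
      using V_bounds[OF that, of s] \<eta>_pos by (auto simp: ln_le_cancel_iff)
    then show ?thesis using \<eta>_pos by (simp add: z_def ln_div)
  qed
  have z_int: "integrable ?P (\<lambda>\<omega>. z s \<omega> * indicator A \<omega>)" for s
    using z_bound[of _ s] z_meas spP \<eta>_pos \<eta>_le
    by (intro integrable_bounded[where C="- ln \<eta>"]) (auto split: split_indicator)
  \<comment> \<open>Given the past, a step taken before the alarm has mean \<open>bit_kl\<close> of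
    the two bit probabilities, hence at most \<open>I\<close>; a step after the alarm is
    zero.\<close>
  have z_mean: "(\<integral>\<omega>. z s \<omega> * indicator A \<omega> \<partial>?P) \<le> I * P.prob (A \<inter> alive T s)" if s: "k \<le> s" for s
  proof -
    have [measurable]: "A \<in> sets (H s)" "alive T s \<in> sets (H s)"
      by (auto intro: A_H alive_sets[OF T] s)
    let ?i = "\<lambda>\<omega>. indicator (A \<inter> alive T s) \<omega> :: real"
    let ?f = "\<lambda>\<omega>. ?i \<omega> * ln (q1 s \<omega> / q0 s \<omega>)" and ?g = "\<lambda>\<omega>. ?i \<omega> * ln ((1 - q1 s \<omega>) / (1 - q0 s \<omega>))"
    have lnb: "\<bar>?i \<omega> * ln (x / y)\<bar> \<le> - ln \<eta>" if "\<eta> \<le> x" "x \<le> 1" "\<eta> \<le> y" "y \<le> 1" for x y \<omega>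
      using abs_ln_ratio_le[OF \<eta>_pos, of x y] that by (auto split: split_indicator)
    have qb: "\<eta> \<le> q1 s \<omega> \<and> \<eta> \<le> 1 - q1 s \<omega> \<and> \<eta> \<le> q0 s \<omega> \<and> \<eta> \<le> 1 - q0 s \<omega>" if "\<omega> \<in> space (H s)" for \<omega>
      using q0_bounds[OF that] q1_bounds[OF that] by auto
    have b: "\<bar>?f \<omega>\<bar> \<le> - ln \<eta>" "\<bar>?g \<omega>\<bar> \<le> - ln \<eta>" if "\<omega> \<in> space (H s)" for \<omega>
      using qb[OF that] \<eta>_pos by (auto intro!: lnb)
    have "(\<integral>\<omega>. z s \<omega> * indicator A \<omega> \<partial>?P) = (\<integral>\<omega>. (if \<omega> \<in> E s then ?f \<omega> else ?g \<omega>) \<partial>?P)"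
    proof (rule Bochner_Integration.integral_cong[OF refl])
      fix \<omega> assume "\<omega> \<in> space ?P"
      then have "\<omega> \<in> space (H s)" using space_law[of "enat k" s] by simp
      from qb[OF this] show "z s \<omega> * indicator A \<omega> = (if \<omega> \<in> E s then ?f \<omega> else ?g \<omega>)"
        using \<eta>_pos by (auto simp: z_def V_def inv_lr_def ln_div split: split_indicator)
    qed
    also have "\<dots> = (\<integral>\<omega>. bit_prob (enat k) s \<omega> * ?f \<omega> + (1 - bit_prob (enat k) s \<omega>) * ?g \<omega> \<partial>?P)"
      using b by (intro integral_step[where C="- ln \<eta>"]) auto
    also have "\<dots> = (\<integral>\<omega>. ?i \<omega> * bit_kl (q1 s \<omega>) (q0 s \<omega>) \<partial>?P)"
      using s by (intro Bochner_Integration.integral_cong) (auto simp: bit_prob_def bit_kl_def split: split_indicator)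
    also have "\<dots> \<le> (\<integral>\<omega>. I * ?i \<omega> \<partial>?P)"
    proof (rule integral_mono)
      have [measurable]: "q0 s \<in> borel_measurable ?P" "q1 s \<in> borel_measurable ?P"
        by (rule measurable_H_law[OF q0_measurable] measurable_H_law[OF q1_measurable])+
      have "\<bar>?i \<omega> * bit_kl (q1 s \<omega>) (q0 s \<omega>)\<bar> \<le> (- ln \<eta>) + (- ln \<eta>)" if "\<omega> \<in> space ?P" for \<omega>
      proof -
        have w: "\<omega> \<in> space (H s)" using that space_law[of "enat k" s] by simp
        have "?i \<omega> * bit_kl (q1 s \<omega>) (q0 s \<omega>) = q1 s \<omega> * ?f \<omega> + (1 - q1 s \<omega>) * ?g \<omega>"
          by (simp add: bit_kl_def algebra_simps)
        also have "\<bar>\<dots>\<bar> \<le> \<bar>q1 s \<omega>\<bar> * \<bar>?f \<omega>\<bar> + \<bar>1 - q1 s \<omega>\<bar> * \<bar>?g \<omega>\<bar>"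
          by (rule order_trans[OF abs_triangle_ineq]) (simp add: abs_mult)
        also have "\<dots> \<le> 1 * (- ln \<eta>) + 1 * (- ln \<eta>)"
          using qb[OF w] b[OF w] \<eta>_pos by (intro add_mono mult_mono) auto
        finally show ?thesis by simp
      qed
      then show "integrable ?P (\<lambda>\<omega>. ?i \<omega> * bit_kl (q1 s \<omega>) (q0 s \<omega>))"
        unfolding bit_kl_def by (intro integrable_bounded[where C="(- ln \<eta>) + (- ln \<eta>)"]) (auto simp: bit_kl_def)
      show "integrable ?P (\<lambda>\<omega>. I * ?i \<omega>)" by (intro integrable_mult_right integrable_bounded[where C=1]) (auto split: split_indicator)
      show "?i \<omega> * bit_kl (q1 s \<omega>) (q0 s \<omega>) \<le> I * ?i \<omega>" if "\<omega> \<in> space ?P" for \<omega>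
        using I(1)[of \<omega> s] that spP by (auto split: split_indicator)
    qed
    also have "\<dots> = I * P.prob (A \<inter> alive T s)" by simp
    finally show ?thesis .
  qed
  have llr_mean: "(\<integral>\<omega>. llr \<omega> * indicator A \<omega> \<partial>?P) \<le> I * (d * P.prob A)"
  proof -
    have "(\<integral>\<omega>. llr \<omega> * indicator A \<omega> \<partial>?P) = (\<integral>\<omega>. (\<Sum>s\<in>{k..<k+m}. z s \<omega> * indicator A \<omega>) \<partial>?P)"
      by (intro Bochner_Integration.integral_cong) (auto simp: llr_sum spP sum_distrib_right)
    also have "\<dots> = (\<Sum>s\<in>{k..<k+m}. (\<integral>\<omega>. z s \<omega> * indicator A \<omega> \<partial>?P))"
      using z_int by (intro Bochner_Integration.integral_sum) auto
    also have "\<dots> \<le> (\<Sum>s\<in>{k..<k+m}. I * P.prob (A \<inter> alive T s))"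
      by (intro sum_mono z_mean) auto
    also have "\<dots> \<le> I * (d * P.prob A)"
      using sum_alive_le_delay[OF T A_law d delay, of m] I(2) by (simp add: sum_distrib_left[symmetric] mult_left_mono)
    finally show ?thesis .
  qed
  define F where "F = alive T (k + m)"
  have F[measurable]: "F \<in> sets ?P" by (simp add: F_def)
  have AF_H: "A \<inter> F \<in> sets (H (k + m))"
    unfolding F_def by (intro sets.Int A_H alive_sets[OF T]) auto
  \<comment> \<open>On \<open>F\<close> no factor has been frozen up to the horizon, so
    \<open>L\<close> is the genuine inverse likelihood ratio there.\<close>
  have Q_AF: "(\<integral>\<omega>. L (k + m) \<omega> * indicator (A \<inter> F) \<omega> \<partial>?P) = Q.prob (A \<inter> F)"
  proof -
    have eqL: "L (k + m) \<omega> = inv_lr_prod k (k + m) \<omega>" if "\<omega> \<in> F" for \<omega>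
      unfolding L_def inv_lr_prod_def
    proof (rule prod.cong[OF refl])
      fix s assume "s \<in> {k..<k+m}"
      then have "\<omega> \<in> alive T s" using that alive_antimono[of s "k + m" T] by (auto simp: F_def)
      then show "V s \<omega> = inv_lr s \<omega>" by (simp add: V_def)
    qed
    have "ennreal (Q.prob (A \<inter> F)) = (\<integral>\<^sup>+\<omega>. ennreal (inv_lr_prod k (k + m) \<omega>) * indicator (A \<inter> F) \<omega> \<partial>?P)"
      using change_of_measure[OF AF_H, of k] by (simp add: Q.emeasure_eq_measure)
    also have "\<dots> = (\<integral>\<^sup>+\<omega>. ennreal (L (k + m) \<omega> * indicator (A \<inter> F) \<omega>) \<partial>?P)"
      by (intro nn_integral_cong) (auto simp: eqL split: split_indicator)
    also have "\<dots> = ennreal (\<integral>\<omega>. L (k + m) \<omega> * indicator (A \<inter> F) \<omega> \<partial>?P)"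
      using L_pos[of _ "k + m"] spP
      by (intro nn_integral_eq_integral L_int AE_I2) (auto split: split_indicator simp: less_imp_le)
    finally show ?thesis
      using L_pos[of _ "k + m"] spP by (subst (asm) ennreal_inj) (auto intro!: integral_nonneg_AE AE_I2 split: split_indicator simp: less_imp_le)
  qed
  have QA: "Q.prob A = P.prob A" using law_eq_on_past[OF A] by (simp add: measure_def)
  have Q_diff: "Q.prob (A - F) = Q.prob A - Q.prob (A \<inter> F)"
    using A F sets_H_law[OF A, of \<infinity>] alive_law[OF T, of "k + m" \<infinity>]
    by (subst Q.finite_measure_Diff'[symmetric]) (auto simp: F_def)
  \<comment> \<open>Markov's inequality in terms of survival: \<open>A \<inter> F\<close> is
    contained in each of the \<open>m\<close> survival events whose probabilities are summed in the
    mean delay.\<close>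
  have "measure ?P (A \<inter> F) \<le> d / m * P.prob A"
  proof -
    have "real m * P.prob (A \<inter> F) = (\<Sum>s\<in>{k..<k+m}. P.prob (A \<inter> F))" by simp
    also have "\<dots> \<le> (\<Sum>s\<in>{k..<k + m}. P.prob (A \<inter> alive T s))"
      using alive_antimono[of _ "k + m" T, THEN subsetD]
      by (intro sum_mono P.finite_measure_mono) (auto simp: F_def)
    also have "\<dots> \<le> d * P.prob A" by (rule sum_alive_le_delay[OF T A_law d delay])
    finally show ?thesis using m by (simp add: field_simps)
  qed
  then have F_small: "(1 + c) * P.prob (A \<inter> F) \<le> (1 + c) * (d / m * P.prob A)"
    using c(2) by (intro mult_left_mono) auto
  \<comment> \<open>Off \<open>F\<close> this is the tangent inequality. On \<open>F\<close> the
    right side vanishes and the left side is a multiple of \<open>- llr - L\<close>, which is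
    nonpositive since \<open>- llr\<close> is below its own exponential \<open>L\<close>. The last
    subtracted term thus handles paths that survive with a negative \<open>llr\<close>.\<close>
  have pt: "exp (- c) * ((1 + c) * indicator A \<omega> - llr \<omega> * indicator A \<omega> - (1 + c) * indicator (A \<inter> F) \<omega>
        - L (k + m) \<omega> * indicator (A \<inter> F) \<omega>)
      \<le> L (k + m) \<omega> * indicator A \<omega> - L (k + m) \<omega> * indicator (A \<inter> F) \<omega>" if "\<omega> \<in> ?\<Omega>" for \<omega>
  proof (cases "\<omega> \<in> A")
    case True
    show ?thesis
    proof (cases "\<omega> \<in> F")
      case True
      have "- llr \<omega> \<le> L (k + m) \<omega>"
        using exp_ge_add_one_self[of "- llr \<omega>"] L_exp[OF that] by linarith
      then show ?thesis using True \<open>\<omega> \<in> A\<close> by (simp add: mult_le_0_iff)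
    next
      case False
      have "exp (- c) * (1 + c - llr \<omega>) \<le> exp (- c) * exp (c - llr \<omega>)"
        using exp_ge_add_one_self[of "c - llr \<omega>"] by (intro mult_left_mono) (linarith, simp)
      also have "\<dots> = L (k + m) \<omega>" using L_exp[OF that] by (simp add: exp_add[symmetric])
      finally show ?thesis using False \<open>\<omega> \<in> A\<close> by simp
    qed
  qed simp
  have llr_int: "integrable ?P (\<lambda>\<omega>. llr \<omega> * indicator A \<omega>)"
  proof -
    have "integrable ?P (\<lambda>\<omega>. \<Sum>s\<in>{k..<k+m}. z s \<omega> * indicator A \<omega>)"
      using z_int by (intro Bochner_Integration.integrable_sum) auto
    then show ?thesis
      by (rule Bochner_Integration.integrable_cong[THEN iffD1, rotated -1]) (auto simp: llr_sum spP sum_distrib_right)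
  qed
  have AF_P: "A \<inter> F \<in> sets ?P" by simp
  have "exp (- c) * ((1 + c) * P.prob A - I * (d * P.prob A) - (1 + c) * (d / m * P.prob A) - P.prob A)
      \<le> exp (- c) * ((1 + c) * P.prob A - (\<integral>\<omega>. llr \<omega> * indicator A \<omega> \<partial>?P) - (1 + c) * P.prob (A \<inter> F) - Q.prob (A \<inter> F))"
  proof -
    have "Q.prob (A \<inter> F) \<le> P.prob A"
      unfolding QA[symmetric] using sets_H_law[OF A, of \<infinity>] by (intro Q.finite_measure_mono) auto
    then show ?thesis using llr_mean F_small by (intro mult_left_mono) auto
  qed
  also have "\<dots> = (\<integral>\<omega>. exp (- c) * ((1 + c) * indicator A \<omega> - llr \<omega> * indicator A \<omega>
        - (1 + c) * indicator (A \<inter> F) \<omega> - L (k + m) \<omega> * indicator (A \<inter> F) \<omega>) \<partial>?P)"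
    using llr_int L_int[OF AF_P, of "k + m"] integrable_indicator[OF A_law] integrable_indicator[OF AF_P]
    by (simp add: Q_AF)
  also have "\<dots> \<le> (\<integral>\<omega>. L (k + m) \<omega> * indicator A \<omega> - L (k + m) \<omega> * indicator (A \<inter> F) \<omega> \<partial>?P)"
    using llr_int L_int integrable_indicator A_law AF_P pt spP
    by (intro integral_mono integrable_mult_right Bochner_Integration.integrable_diff) auto
  also have "\<dots> = P.prob A - Q.prob (A \<inter> F)"
    using L_int[of A "k + m"] L_int[of "A \<inter> F" "k + m"] L_const[of m] by (simp add: Q_AF)
  also have "\<dots> = Q.prob (A - F)" using Q_diff QA by simp
  finally have "exp (- c) * (((1 + c) * (1 - d / m) - I * d - 1) * P.prob A) \<le> Q.prob (A - F)"
    by (simp add: algebra_simps)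
  \<comment> \<open>The 2 in the hypothesis on \<open>c\<close> pays twice for the mass of
    \<open>A\<close>: once for the subtracted integral of \<open>L\<close> over
    \<open>A \<inter> F\<close>, once for the conclusion.\<close>
  moreover have "1 * P.prob A \<le> ((1 + c) * (1 - d / m) - I * d - 1) * P.prob A"
    using c by (intro mult_right_mono) auto
  then have "exp (- c) * P.prob A \<le> exp (- c) * (((1 + c) * (1 - d / m) - I * d - 1) * P.prob A)"
    by simp
  ultimately show ?thesis unfolding F_def QA by linarith
qed

end

section \<open>CUSUM statistics\<close>

context bit_model
begin

text \<open>A supermartingale bound: each new factor has conditional mean at most
  \<open>\<rho>\<close>, whatever threshold the past has chosen. It is applied to square roots of
  likelihood ratios.\<close>

lemma nn_integral_prod_le:
  fixes f g :: "nat \<Rightarrow> 'a \<Rightarrow> real"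
  assumes f: "\<And>n. n0 \<le> n \<Longrightarrow> f n \<in> borel_measurable (H n)"
    and g: "\<And>n. n0 \<le> n \<Longrightarrow> g n \<in> borel_measurable (H n)"
    and nn: "\<And>n \<omega>. n0 \<le> n \<Longrightarrow> \<omega> \<in> space (H 0) \<Longrightarrow> 0 \<le> f n \<omega>"
      "\<And>n \<omega>. n0 \<le> n \<Longrightarrow> \<omega> \<in> space (H 0) \<Longrightarrow> 0 \<le> g n \<omega>"
    and \<rho>: "\<And>n \<omega>. n0 \<le> n \<Longrightarrow> \<omega> \<in> space (H 0) \<Longrightarrow>
      bit_prob k n \<omega> * f n \<omega> + (1 - bit_prob k n \<omega>) * g n \<omega> \<le> \<rho>" "0 \<le> \<rho>"
    and A: "A \<in> sets (H n0)"
  shows "(\<integral>\<^sup>+\<omega>. ennreal (\<Prod>s\<in>{n0..<n0 + j}. if \<omega> \<in> E s then f s \<omega> else g s \<omega>) * indicator A \<omega> \<partial>M k)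
    \<le> ennreal (\<rho> ^ j) * emeasure (M k) A"
proof (induction j)
  case 0
  then show ?case using A sets_H_law by simp
next
  case (Suc j)
  let ?n = "n0 + j"
  define R where "R \<omega> = (\<Prod>s\<in>{n0..<?n}. if \<omega> \<in> E s then f s \<omega> else g s \<omega>)" for \<omega>
  have [measurable]: "f ?n \<in> borel_measurable (H ?n)" "g ?n \<in> borel_measurable (H ?n)"
    "bit_prob k ?n \<in> borel_measurable (H ?n)"
    using f g bit_prob_measurable by auto
  have [measurable]: "R \<in> borel_measurable (H ?n)"
  proof -
    have "(\<lambda>\<omega>. if \<omega> \<in> E s then f s \<omega> else g s \<omega>) \<in> borel_measurable (H ?n)" if "s \<in> {n0..<?n}" for s
    proof -
      have [measurable]: "f s \<in> borel_measurable (H ?n)" "g s \<in> borel_measurable (H ?n)" "E s \<in> sets (H ?n)"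
        using measurable_H_mono[OF f, of s ?n] measurable_H_mono[OF g, of s ?n] E_sets_H[of s ?n] that by auto
      show ?thesis by measurable
    qed
    then show ?thesis unfolding R_def[abs_def] by (intro borel_measurable_prod) auto
  qed
  have [measurable]: "A \<in> sets (H ?n)" using A sets_H_mono[of n0 ?n] by auto
  have [measurable]: "R \<in> borel_measurable (M k)" "A \<in> sets (M k)"
    by (rule measurable_H_law[OF \<open>R \<in> borel_measurable (H ?n)\<close>] sets_H_law[OF A])+
  have R0: "0 \<le> R \<omega>" if "\<omega> \<in> space (H 0)" for \<omega>
    unfolding R_def using nn that by (intro prod_nonneg) auto
  have "(\<integral>\<^sup>+\<omega>. ennreal (\<Prod>s\<in>{n0..<n0 + Suc j}. if \<omega> \<in> E s then f s \<omega> else g s \<omega>) * indicator A \<omega> \<partial>M k)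
     = (\<integral>\<^sup>+\<omega>. (if \<omega> \<in> E ?n then ennreal (R \<omega> * f ?n \<omega>) * indicator A \<omega> else ennreal (R \<omega> * g ?n \<omega>) * indicator A \<omega>) \<partial>M k)"
    by (intro nn_integral_cong) (auto simp: R_def)
  also have "\<dots> = (\<integral>\<^sup>+\<omega>. ennreal (bit_prob k ?n \<omega>) * (ennreal (R \<omega> * f ?n \<omega>) * indicator A \<omega>)
      + ennreal (1 - bit_prob k ?n \<omega>) * (ennreal (R \<omega> * g ?n \<omega>) * indicator A \<omega>) \<partial>M k)"
    by (rule nn_integral_step) auto
  also have "\<dots> \<le> (\<integral>\<^sup>+\<omega>. ennreal \<rho> * (ennreal (R \<omega>) * indicator A \<omega>) \<partial>M k)"
  proof (rule nn_integral_mono)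
    fix \<omega> assume "\<omega> \<in> space (M k)"
    then have w: "\<omega> \<in> space (H 0)" "\<omega> \<in> space (H ?n)" using space_law[of k] by auto
    have b: "0 < bit_prob k ?n \<omega>" "bit_prob k ?n \<omega> < 1" using bit_prob_01[OF w(2)] by auto
    have "ennreal (bit_prob k ?n \<omega>) * ennreal (R \<omega> * f ?n \<omega>) + ennreal (1 - bit_prob k ?n \<omega>) * ennreal (R \<omega> * g ?n \<omega>)
        = ennreal (R \<omega> * (bit_prob k ?n \<omega> * f ?n \<omega> + (1 - bit_prob k ?n \<omega>) * g ?n \<omega>))"
      using b R0[OF w(1)] nn[OF _ w(1), of ?n]
      by (subst ennreal_convex_combination) (auto simp: algebra_simps)
    also have "\<dots> \<le> ennreal (R \<omega> * \<rho>)"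
      using \<rho>(1)[OF _ w(1), of ?n] R0[OF w(1)] by (intro ennreal_leI mult_left_mono) auto
    finally show "ennreal (bit_prob k ?n \<omega>) * (ennreal (R \<omega> * f ?n \<omega>) * indicator A \<omega>)
      + ennreal (1 - bit_prob k ?n \<omega>) * (ennreal (R \<omega> * g ?n \<omega>) * indicator A \<omega>)
      \<le> ennreal \<rho> * (ennreal (R \<omega>) * indicator A \<omega>)"
      using R0[OF w(1)] \<rho>(2) by (auto simp: ennreal_mult mult.commute split: split_indicator)
  qed
  also have "\<dots> = ennreal \<rho> * (\<integral>\<^sup>+\<omega>. ennreal (R \<omega>) * indicator A \<omega> \<partial>M k)"
    by (rule nn_integral_cmult) auto
  also have "\<dots> \<le> ennreal \<rho> * (ennreal (\<rho> ^ j) * emeasure (M k) A)"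
    using Suc.IH by (intro mult_left_mono) (auto simp: R_def)
  also have "\<dots> = ennreal (\<rho> ^ Suc j) * emeasure (M k) A"
    using \<rho>(2) by (simp add: ennreal_mult mult.assoc)
  finally show ?case .
qed

text \<open>Every block of length \<open>m\<close> removes at least the fraction
  \<open>\<beta>\<close> of the mass still alive. The removed masses telescope to at most 1, so the
  survival probabilities at the block starts sum to at most \<open>1 / \<beta>\<close>, and each of
  them dominates the \<open>m\<close> terms of its block.\<close>

lemma ARL_le_of_early_alarm:
  assumes T: "adapted_time T" and m: "0 < m" and \<beta>: "0 < \<beta>"
    and early: "\<And>j. \<beta> * measure (M \<infinity>) (alive T (m * j)) \<le> measure (M \<infinity>) (alive T (m * j) - alive T (m * j + m))"
  shows "(\<integral>\<^sup>+\<omega>. ennreal_of_enat (T \<omega>) \<partial>M \<infinity>) \<le> ennreal (real m / \<beta>)"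
proof -
  interpret prob_space "M \<infinity>" by (rule prob_space_law)
  have aP: "alive T n \<in> events" for n by (rule alive_law[OF T])
  let ?p = "\<lambda>n. prob (alive T n)"
  have step: "\<beta> * ?p (m * j) \<le> ?p (m * j) - ?p (m * Suc j)" for j
  proof -
    have "prob (alive T (m * j) - alive T (m * j + m)) = ?p (m * j) - ?p (m * j + m)"
      by (intro finite_measure_Diff aP alive_antimono) auto
    then show ?thesis using early[of j] by (simp add: add.commute)
  qed
  have tele: "\<beta> * (\<Sum>j<N. ?p (m * j)) \<le> 1 - ?p (m * N)" for N
  proof (induction N)
    case 0
    show ?case by simp
  next
    case (Suc N)
    then show ?case using step[of N] by (simp add: distrib_left)
  qed
  have block: "(\<Sum>i<m * N. ?p i) \<le> real m * (\<Sum>j<N. ?p (m * j))" for N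
  proof (induction N)
    case 0
    show ?case by simp
  next
    case (Suc N)
    have "(\<Sum>i<m * Suc N. ?p i) = (\<Sum>i<m * N. ?p i) + (\<Sum>i\<in>{m * N..<m * N + m}. ?p i)"
      using sum.atLeastLessThan_concat[of 0 "m * N" "m * N + m" ?p]
      by (simp add: atLeast0LessThan add.commute)
    also have "(\<Sum>i\<in>{m * N..<m * N + m}. ?p i) \<le> (\<Sum>i\<in>{m * N..<m * N + m}. ?p (m * N))"
      by (intro sum_mono finite_measure_mono aP alive_antimono) auto
    finally show ?case using Suc.IH by (simp add: distrib_left)
  qed
  have part: "(\<Sum>i<n. ?p i) \<le> real m / \<beta>" for n
  proof -
    have "n \<le> m * n" using m by (cases m) auto
    then have "(\<Sum>i<n. ?p i) \<le> (\<Sum>i<m * n. ?p i)" by (intro sum_mono2) auto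
    also have "\<dots> \<le> real m * (\<Sum>j<n. ?p (m * j))" by (rule block)
    also have "\<dots> \<le> real m / \<beta>"
    proof -
      have "\<beta> * (\<Sum>j<n. ?p (m * j)) \<le> 1" using tele[of n] measure_nonneg[of "M \<infinity>"] by (smt (verit))
      then have "(\<Sum>j<n. ?p (m * j)) \<le> 1 / \<beta>" using \<beta> by (simp add: field_simps)
      then have "real m * (\<Sum>j<n. ?p (m * j)) \<le> real m * (1 / \<beta>)" by (intro mult_left_mono) auto
      then show ?thesis by simp
    qed
    finally show ?thesis .
  qed
  have "(\<integral>\<^sup>+\<omega>. ennreal_of_enat (T \<omega>) \<partial>M \<infinity>) = (\<Sum>n. emeasure (M \<infinity>) (alive T n))"
    using nn_integral_enat_function[OF adapted_time_measurable[OF T], of \<infinity>]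
    by (simp add: alive_def space_law_0)
  also have "\<dots> \<le> ennreal (real m / \<beta>)"
    using part by (intro suminf_le_const) (auto simp: emeasure_eq_measure sum_ennreal intro!: ennreal_leI)
  finally show ?thesis .
qed

end

text \<open>\<open>a n\<close> and \<open>b n\<close> are the increments for the two values of the
  next bit, fixed before it is seen. They are not tied to the bit probabilities here; the
  false-alarm bounds add \<open>unit_mean\<close>, the delay bound adds a drift condition.\<close>

locale bit_cusum = bit_model +
  fixes a b S :: "nat \<Rightarrow> 'a \<Rightarrow> real" and T :: "'a \<Rightarrow> enat" and w :: nat and \<nu> C :: real
  assumes a_measurable: "w \<le> n \<Longrightarrow> a n \<in> borel_measurable (H n)"
    and b_measurable: "w \<le> n \<Longrightarrow> b n \<in> borel_measurable (H n)"
    and a_bound: "w \<le> n \<Longrightarrow> \<omega> \<in> space (H 0) \<Longrightarrow> \<bar>a n \<omega>\<bar> \<le> C"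
    and b_bound: "w \<le> n \<Longrightarrow> \<omega> \<in> space (H 0) \<Longrightarrow> \<bar>b n \<omega>\<bar> \<le> C"
    and \<nu>_pos: "0 < \<nu>"
    and S_w: "\<omega> \<in> space (H 0) \<Longrightarrow> S w \<omega> = 0"
    and S_Suc: "w \<le> n \<Longrightarrow> \<omega> \<in> space (H 0) \<Longrightarrow>
      S (Suc n) \<omega> = max (S n \<omega>) 0 + (if \<omega> \<in> E n then a n \<omega> else b n \<omega>)"
    and T_eq: "\<omega> \<in> space (H 0) \<Longrightarrow> T \<omega> = Inf {enat t | t. w < t \<and> \<nu> \<le> S t \<omega>}"
begin

definition incr :: "nat \<Rightarrow> 'a \<Rightarrow> real" where
  "incr n \<omega> = (if \<omega> \<in> E n then a n \<omega> else b n \<omega>)"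

lemma less_T_iff:
  assumes "\<omega> \<in> space (H 0)"
  shows "enat n < T \<omega> \<longleftrightarrow> (\<forall>t\<in>{w<..n}. S t \<omega> < \<nu>)"
proof -
  let ?X = "{enat t | t. w < t \<and> \<nu> \<le> S t \<omega>}"
  have "enat n < Inf ?X \<longleftrightarrow> (\<forall>t. w < t \<longrightarrow> \<nu> \<le> S t \<omega> \<longrightarrow> n < t)"
  proof
    assume *: "enat n < Inf ?X"
    show "\<forall>t. w < t \<longrightarrow> \<nu> \<le> S t \<omega> \<longrightarrow> n < t"
    proof (intro allI impI)
      fix t assume "w < t" "\<nu> \<le> S t \<omega>"
      then have "Inf ?X \<le> enat t" by (intro Inf_lower) auto
      with * have "enat n < enat t" by (rule less_le_trans)
      then show "n < t" by simp
    qed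
  next
    assume *: "\<forall>t. w < t \<longrightarrow> \<nu> \<le> S t \<omega> \<longrightarrow> n < t"
    have "enat (Suc n) \<le> Inf ?X"
      using * by (intro Inf_greatest) auto
    then show "enat n < Inf ?X" by (meson enat_ord_simps(2) lessI less_le_trans)
  qed
  then show ?thesis by (auto simp: T_eq[OF assms] not_le[symmetric])
qed

lemma alive_eq: "alive T n = {\<omega> \<in> space (H 0). \<forall>t\<in>{w<..n}. S t \<omega> < \<nu>}"
  by (auto simp: alive_def less_T_iff)

lemma S_measurable: "S (w + j) \<in> borel_measurable (H (w + j))"
proof (induction j)
  case 0
  have "(\<lambda>_. 0 :: real) \<in> borel_measurable (H w)" by simp
  moreover have "S w \<in> borel_measurable (H w) \<longleftrightarrow> (\<lambda>_. 0 :: real) \<in> borel_measurable (H w)"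
    using S_w space_H[of w] by (intro measurable_cong) auto
  ultimately show ?case by simp
next
  case (Suc j)
  let ?n = "w + j"
  have [measurable]: "a ?n \<in> borel_measurable (H (Suc ?n))" "b ?n \<in> borel_measurable (H (Suc ?n))"
    "S ?n \<in> borel_measurable (H (Suc ?n))" "E ?n \<in> sets (H (Suc ?n))"
    using measurable_H_mono[OF a_measurable, of ?n "Suc ?n"] measurable_H_mono[OF b_measurable, of ?n "Suc ?n"]
      measurable_H_mono[OF Suc.IH, of "Suc ?n"] E_sets[of ?n] by auto
  have "(\<lambda>\<omega>. max (S ?n \<omega>) 0 + (if \<omega> \<in> E ?n then a ?n \<omega> else b ?n \<omega>)) \<in> borel_measurable (H (Suc ?n))"
    by measurable
  moreover have "S (Suc ?n) \<in> borel_measurable (H (Suc ?n)) \<longleftrightarrow>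
      (\<lambda>\<omega>. max (S ?n \<omega>) 0 + (if \<omega> \<in> E ?n then a ?n \<omega> else b ?n \<omega>)) \<in> borel_measurable (H (Suc ?n))"
    using S_Suc[of ?n] space_H[of "Suc ?n"] by (intro measurable_cong) auto
  ultimately show ?case by simp
qed

lemma T_adapted: "adapted_time T"
  unfolding adapted_time_def
proof
  fix n
  have *: "{\<omega> \<in> space (H n). S t \<omega> < \<nu>} \<in> sets (H n)" if "t \<in> {w<..n}" for t
  proof -
    have [measurable]: "S t \<in> borel_measurable (H n)"
      using measurable_H_mono[OF S_measurable[of "t - w"], of n] that by auto
    show ?thesis by measurable
  qed
  have "alive T n = {\<omega> \<in> space (H n). \<forall>t\<in>{w<..n}. S t \<omega> < \<nu>}"
    using space_H[of n] by (simp add: alive_eq)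
  also have "\<dots> \<in> sets (H n)" using * by (intro sets.sets_Collect_finite_All) auto
  finally show "alive T n \<in> sets (H n)" .
qed

lemma alive_w: "n \<le> w \<Longrightarrow> alive T n = space (H 0)"
  by (auto simp: alive_eq)

lemma incr_measurable: "w \<le> n \<Longrightarrow> incr n \<in> borel_measurable (H (Suc n))"
proof -
  assume n: "w \<le> n"
  have [measurable]: "a n \<in> borel_measurable (H (Suc n))" "b n \<in> borel_measurable (H (Suc n))" "E n \<in> sets (H (Suc n))"
    using measurable_H_mono[OF a_measurable[OF n], of "Suc n"] measurable_H_mono[OF b_measurable[OF n], of "Suc n"]
      E_sets[of n] by auto
  show ?thesis unfolding incr_def[abs_def] by measurable
qed

lemma incr_bound: "w \<le> n \<Longrightarrow> \<omega> \<in> space (H 0) \<Longrightarrow> \<bar>incr n \<omega>\<bar> \<le> C"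
  using a_bound b_bound by (auto simp: incr_def)

lemma C_nonneg: "0 \<le> C"
proof -
  interpret prob_space "M 0" by (rule prob_space_law)
  obtain \<omega> where "\<omega> \<in> space (H 0)" using not_empty space_law by fastforce
  from a_bound[OF order_refl this] show ?thesis by auto
qed

text \<open>The Shiryaev--Roberts statistic, started at time \<open>w\<close>.\<close>

primrec sr :: "nat \<Rightarrow> 'a \<Rightarrow> real" where
  "sr 0 \<omega> = 0"
| "sr (Suc j) \<omega> = (1 + sr j \<omega>) * exp (incr (w + j) \<omega>)"

lemma sr_nonneg: "0 \<le> sr j \<omega>"
  by (induction j) auto

text \<open>The two recursions differ only in that the CUSUM factor is the maximum of 1 and the
  exponential of the old value, where the Shiryaev--Roberts factor is a sum; the maximum of
  nonnegative numbers is at most their sum.\<close>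

lemma exp_S_le_sr:
  assumes "\<omega> \<in> space (H 0)" shows "exp (max (S (w + j) \<omega>) 0) \<le> 1 + sr j \<omega>"
    and "exp (S (w + Suc j) \<omega>) \<le> sr (Suc j) \<omega>"
proof -
  have exp_step: "exp (S (w + Suc j) \<omega>) \<le> sr (Suc j) \<omega>" if "exp (max (S (w + j) \<omega>) 0) \<le> 1 + sr j \<omega>" for j
    using S_Suc[of "w + j" \<omega>] assms that by (simp add: exp_add incr_def[symmetric] mult_right_mono)
  have *: "exp (max (S (w + j) \<omega>) 0) \<le> 1 + sr j \<omega>" for j
  proof (induction j)
    case 0
    then show ?case using S_w assms by simp
  next
    case (Suc j)
    then show ?case using exp_step[OF Suc.IH] sr_nonneg[of "Suc j" \<omega>] by (auto simp: max_def)
  qed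
  show "exp (max (S (w + j) \<omega>) 0) \<le> 1 + sr j \<omega>" by (rule *)
  show "exp (S (w + Suc j) \<omega>) \<le> sr (Suc j) \<omega>" by (rule exp_step[OF *])
qed

lemma sr_measurable: "sr j \<in> borel_measurable (H (w + j))"
proof (induction j)
  case (Suc j)
  have [measurable]: "sr j \<in> borel_measurable (H (w + Suc j))" "incr (w + j) \<in> borel_measurable (H (w + Suc j))"
    using measurable_H_mono[OF Suc.IH, of "w + Suc j"] incr_measurable[of "w + j"] by auto
  show ?case unfolding sr.simps[abs_def] by measurable
qed (simp add: sr.simps[abs_def])

text \<open>The exponential increments are likelihood ratios with mean one under no change. Plugging
  in an estimate preserves this however poor the estimate is, since the plugged-in bit probabilities
  still sum to one.\<close>

definition unit_mean :: bool where
  "unit_mean \<longleftrightarrow> (\<forall>n\<ge>w. \<forall>\<omega>\<in>space (H 0). q0 n \<omega> * exp (a n \<omega>) + (1 - q0 n \<omega>) * exp (b n \<omega>) = 1)"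

text \<open>Under no change \<open>sr\<close> minus the elapsed time is a martingale. Stopped at the
  alarm, where \<open>sr\<close> is at least \<open>exp \<nu>\<close>, it bounds the alarm mass by
  the mean time run since \<open>w\<close>.\<close>

lemma false_alarm_balance:
  assumes unit: unit_mean
  shows "ennreal (exp \<nu>) * emeasure (M \<infinity>) (alive T w - alive T (w + j)) \<le> (\<Sum>i<j. emeasure (M \<infinity>) (alive T (w + i)))"
proof -
  let ?P = "M \<infinity>"
  interpret prob_space ?P by (rule prob_space_law)
  let ?G = "\<lambda>j. (\<integral>\<^sup>+\<omega>. ennreal (sr j \<omega>) * indicator (alive T (w + j)) \<omega> \<partial>?P)"
  have aP[measurable]: "alive T n \<in> sets ?P" for n by (rule alive_law[OF T_adapted])
  have sP[measurable]: "sr j \<in> borel_measurable ?P" for j by (rule measurable_H_law[OF sr_measurable])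
  \<comment> \<open>The induction carries the integral of \<open>sr\<close> over the survivors, from
    which the alarms of the next step are paid.\<close>
  have "ennreal (exp \<nu>) * emeasure ?P (alive T w - alive T (w + j)) + ?G j \<le> (\<Sum>i<j. emeasure ?P (alive T (w + i)))"
  proof (induction j)
    case 0
    then show ?case by simp
  next
    case (Suc j)
    let ?n = "w + j"
    let ?d = "alive T ?n - alive T (Suc ?n)"
    have [measurable]: "sr j \<in> borel_measurable (H ?n)" "a ?n \<in> borel_measurable (H ?n)" "b ?n \<in> borel_measurable (H ?n)"
      "alive T ?n \<in> sets (H ?n)"
      using sr_measurable a_measurable b_measurable alive_sets[OF T_adapted] by auto
    note [measurable] = measurable_H_law[OF incr_measurable[of ?n], of \<infinity>]
    have X: "(\<integral>\<^sup>+\<omega>. ennreal (sr (Suc j) \<omega>) * indicator (alive T ?n) \<omega> \<partial>?P) = emeasure ?P (alive T ?n) + ?G j"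
    proof -
      have "(\<integral>\<^sup>+\<omega>. ennreal (sr (Suc j) \<omega>) * indicator (alive T ?n) \<omega> \<partial>?P)
        = (\<integral>\<^sup>+\<omega>. (if \<omega> \<in> E ?n then ennreal ((1 + sr j \<omega>) * exp (a ?n \<omega>)) * indicator (alive T ?n) \<omega>
            else ennreal ((1 + sr j \<omega>) * exp (b ?n \<omega>)) * indicator (alive T ?n) \<omega>) \<partial>?P)"
        by (intro nn_integral_cong) (auto simp: incr_def)
      also have "\<dots> = (\<integral>\<^sup>+\<omega>. ennreal (bit_prob \<infinity> ?n \<omega>) * (ennreal ((1 + sr j \<omega>) * exp (a ?n \<omega>)) * indicator (alive T ?n) \<omega>)
            + ennreal (1 - bit_prob \<infinity> ?n \<omega>) * (ennreal ((1 + sr j \<omega>) * exp (b ?n \<omega>)) * indicator (alive T ?n) \<omega>) \<partial>?P)"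
        by (rule nn_integral_step) auto
      also have "\<dots> = (\<integral>\<^sup>+\<omega>. indicator (alive T ?n) \<omega> + ennreal (sr j \<omega>) * indicator (alive T ?n) \<omega> \<partial>?P)"
      proof (rule nn_integral_cong)
        fix \<omega> assume "\<omega> \<in> space ?P"
        then have wo: "\<omega> \<in> space (H 0)" "\<omega> \<in> space (H ?n)" using space_law by auto
        have q: "0 < q0 ?n \<omega>" "q0 ?n \<omega> < 1" using q0_bounds[OF wo(2)] \<eta>_pos by auto
        have "ennreal (q0 ?n \<omega>) * ennreal ((1 + sr j \<omega>) * exp (a ?n \<omega>)) + ennreal (1 - q0 ?n \<omega>) * ennreal ((1 + sr j \<omega>) * exp (b ?n \<omega>))
          = ennreal ((1 + sr j \<omega>) * (q0 ?n \<omega> * exp (a ?n \<omega>) + (1 - q0 ?n \<omega>) * exp (b ?n \<omega>)))"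
          using q sr_nonneg[of j \<omega>] by (subst ennreal_convex_combination) (auto simp: algebra_simps)
        also have "\<dots> = 1 + ennreal (sr j \<omega>)"
          using unit wo(1) sr_nonneg[of j \<omega>] unfolding unit_mean_def by simp
        finally show "ennreal (bit_prob \<infinity> ?n \<omega>) * (ennreal ((1 + sr j \<omega>) * exp (a ?n \<omega>)) * indicator (alive T ?n) \<omega>)
            + ennreal (1 - bit_prob \<infinity> ?n \<omega>) * (ennreal ((1 + sr j \<omega>) * exp (b ?n \<omega>)) * indicator (alive T ?n) \<omega>)
            = indicator (alive T ?n) \<omega> + ennreal (sr j \<omega>) * indicator (alive T ?n) \<omega>"
          by (auto simp: bit_prob_def split: split_indicator)
      qed
      also have "\<dots> = emeasure ?P (alive T ?n) + ?G j"
        by (subst nn_integral_add) auto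
      finally show ?thesis .
    qed
    have disj: "indicator (alive T ?n) \<omega> = (indicator ?d \<omega> + indicator (alive T (Suc ?n)) \<omega> :: ennreal)" for \<omega>
      using alive_antimono[of ?n "Suc ?n" T] by (auto split: split_indicator)
    have "ennreal (exp \<nu>) * emeasure ?P ?d + ?G (Suc j)
        = (\<integral>\<^sup>+\<omega>. ennreal (exp \<nu>) * indicator ?d \<omega> \<partial>?P) + ?G (Suc j)"
      by (subst nn_integral_cmult_indicator) auto
    also have "\<dots> \<le> (\<integral>\<^sup>+\<omega>. ennreal (sr (Suc j) \<omega>) * indicator ?d \<omega> \<partial>?P) + ?G (Suc j)"
    \<comment> \<open>A path in the difference of the two survival events has its first alarm
      exactly at \<open>Suc ?n\<close>, so the threshold is reached at that time.\<close>
    proof (intro add_right_mono nn_integral_mono)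
      fix \<omega> assume "\<omega> \<in> space ?P"
      then have wo: "\<omega> \<in> space (H 0)" using space_law by auto
      show "ennreal (exp \<nu>) * indicator ?d \<omega> \<le> ennreal (sr (Suc j) \<omega>) * indicator ?d \<omega>"
      proof (cases "\<omega> \<in> ?d")
        case True
        then obtain t where "t \<in> {w<..Suc ?n}" "t \<notin> {w<..?n}" "\<nu> \<le> S t \<omega>"
          by (auto simp: alive_eq not_less) (metis greaterThanAtMost_iff not_less)
        then have "t = Suc ?n" by auto
        with \<open>\<nu> \<le> S t \<omega>\<close> have "exp \<nu> \<le> exp (S (w + Suc j) \<omega>)" by simp
        also have "\<dots> \<le> sr (Suc j) \<omega>" by (rule exp_S_le_sr(2)[OF wo])
        finally show ?thesis by (intro mult_right_mono ennreal_leI) auto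
      qed simp
    qed
    also have "\<dots> = (\<integral>\<^sup>+\<omega>. ennreal (sr (Suc j) \<omega>) * indicator ?d \<omega> + ennreal (sr (Suc j) \<omega>) * indicator (alive T (w + Suc j)) \<omega> \<partial>?P)"
      by (intro nn_integral_add[symmetric]) auto
    also have "\<dots> = (\<integral>\<^sup>+\<omega>. ennreal (sr (Suc j) \<omega>) * indicator (alive T ?n) \<omega> \<partial>?P)"
      by (intro nn_integral_cong) (simp only: disj distrib_left add_Suc_right)
    finally have le: "ennreal (exp \<nu>) * emeasure ?P ?d + ?G (Suc j) \<le> emeasure ?P (alive T ?n) + ?G j"
      unfolding X .
    have "alive T w - alive T (w + Suc j) = (alive T w - alive T ?n) \<union> ?d"
      using alive_antimono[of ?n "Suc ?n" T] alive_antimono[of w ?n T] by auto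
    then have split: "emeasure ?P (alive T w - alive T (w + Suc j)) = emeasure ?P (alive T w - alive T ?n) + emeasure ?P ?d"
      by (simp only:) (intro plus_emeasure[symmetric], auto)
    have "ennreal (exp \<nu>) * emeasure ?P (alive T w - alive T (w + Suc j)) + ?G (Suc j)
        = ennreal (exp \<nu>) * emeasure ?P (alive T w - alive T ?n) + (ennreal (exp \<nu>) * emeasure ?P ?d + ?G (Suc j))"
      unfolding split by (simp only: distrib_left add.assoc)
    also have "\<dots> \<le> ennreal (exp \<nu>) * emeasure ?P (alive T w - alive T ?n) + (emeasure ?P (alive T ?n) + ?G j)"
      by (intro add_left_mono le)
    also have "\<dots> = (ennreal (exp \<nu>) * emeasure ?P (alive T w - alive T ?n) + ?G j) + emeasure ?P (alive T ?n)"
      by (simp only: ac_simps)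
    also have "\<dots> \<le> (\<Sum>i<Suc j. emeasure ?P (alive T (w + i)))"
      using add_right_mono[OF Suc.IH, of "emeasure ?P (alive T ?n)"] by simp
    finally show ?case .
  qed
  then show ?thesis by (rule order_trans[rotated]) simp
qed

text \<open>The balance starts at time \<open>w\<close>, before which no alarm is possible. Its
  \<open>m\<close> survival terms are at most 1 each, and an alarm up to \<open>m\<close> is in
  particular one up to \<open>w + m\<close>.\<close>

lemma early_false_alarm:
  assumes unit_mean
  shows "measure (M \<infinity>) (space (H 0) - alive T m) \<le> real m / exp \<nu>"
proof -
  interpret prob_space "M \<infinity>" by (rule prob_space_law)
  have aP: "alive T n \<in> events" for n by (rule alive_law[OF T_adapted])
  have "ennreal (exp \<nu> * prob (space (H 0) - alive T (w + m))) \<le> (\<Sum>i<m. emeasure (M \<infinity>) (alive T (w + i)))"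
    using false_alarm_balance[OF assms, of m] alive_w[of w] by (simp add: emeasure_eq_measure ennreal_mult)
  also have "\<dots> \<le> (\<Sum>i<m. 1)" by (intro sum_mono) (auto simp: emeasure_eq_measure)
  also have "\<dots> = ennreal (real m)" by (simp add: ennreal_of_nat_eq_real_of_nat)
  finally have "exp \<nu> * prob (space (H 0) - alive T (w + m)) \<le> real m" by (simp add: ennreal_le_iff)
  moreover have "prob (space (H 0) - alive T m) \<le> prob (space (H 0) - alive T (w + m))"
    using aP alive_antimono[of m "w + m" T] sets.top[of "M \<infinity>"]
    by (intro finite_measure_mono sets.Diff) (auto simp: space_law_0)
  ultimately have "exp \<nu> * prob (space (H 0) - alive T m) \<le> real m"
    by (meson exp_ge_zero mult_left_mono order_trans)
  then show ?thesis by (simp add: field_simps)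
qed

text \<open>If the mean is finite, the survival probabilities are summable and tend to zero, so the
  alarm mass in the balance tends to 1.\<close>

lemma ARL_ge:
  assumes unit: unit_mean
  shows "ennreal (exp \<nu>) \<le> (\<integral>\<^sup>+\<omega>. ennreal_of_enat (T \<omega>) \<partial>M \<infinity>)"
proof -
  let ?P = "M \<infinity>"
  interpret prob_space ?P by (rule prob_space_law)
  have aP: "alive T n \<in> events" for n by (rule alive_law[OF T_adapted])
  let ?e = "\<lambda>n. emeasure ?P (alive T n)"
  have eq: "(\<integral>\<^sup>+\<omega>. ennreal_of_enat (T \<omega>) \<partial>?P) = (\<Sum>n. ?e n)"
    using nn_integral_enat_function[OF adapted_time_measurable[OF T_adapted], of \<infinity>]
    by (simp add: alive_def space_law_0)
  show ?thesis
  proof (cases "(\<Sum>n. ?e n) = \<infinity>")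
    case True
    then show ?thesis by (simp add: eq)
  next
    case False
    define x where "x = enn2real (\<Sum>n. ?e n)"
    have x: "(\<Sum>n. ?e n) = ennreal x" using False by (simp add: x_def less_top)
    have part: "(\<Sum>i<j. prob (alive T (n + i))) \<le> x" for n j
    proof -
      have "ennreal (\<Sum>i<j. prob (alive T (n + i))) = (\<Sum>i<j. ?e (n + i))"
        by (simp add: emeasure_eq_measure sum_ennreal)
      also have "\<dots> \<le> (\<Sum>i<j. ?e i)"
        by (intro sum_mono emeasure_mono alive_antimono aP) auto
      also have "\<dots> \<le> (\<Sum>n. ?e n)" by (rule sum_le_suminf) auto
      finally show ?thesis unfolding x
        by (subst (asm) ennreal_le_iff) (auto simp: x_def)
    qed
    have "summable (\<lambda>n. prob (alive T n))"
      using part[of 0] by (intro summableI_nonneg_bounded[where x=x]) auto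
    then have "(\<lambda>n. prob (alive T n)) \<longlonglongrightarrow> 0" by (rule summable_LIMSEQ_zero)
    then have "(\<lambda>j. prob (alive T (j + w))) \<longlonglongrightarrow> 0" by (rule LIMSEQ_ignore_initial_segment)
    then have lim: "(\<lambda>j. exp \<nu> * (1 - prob (alive T (j + w)))) \<longlonglongrightarrow> exp \<nu> * (1 - 0)"
      by (intro tendsto_intros)
    have "exp \<nu> * (1 - prob (alive T (j + w))) \<le> x" for j
    proof -
      have "prob (alive T w - alive T (w + j)) = prob (alive T w) - prob (alive T (w + j))"
        by (intro finite_measure_Diff aP alive_antimono) auto
      moreover have "prob (alive T w) = 1" using alive_w[of w] space_law_0[of \<infinity>] prob_space by simp
      ultimately have "ennreal (exp \<nu> * (1 - prob (alive T (j + w)))) = ennreal (exp \<nu>) * emeasure ?P (alive T w - alive T (w + j))"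
        by (simp add: emeasure_eq_measure ennreal_mult add.commute)
      also have "\<dots> \<le> (\<Sum>i<j. ?e (w + i))" by (rule false_alarm_balance[OF unit])
      also have "\<dots> = ennreal (\<Sum>i<j. prob (alive T (w + i)))" by (simp add: emeasure_eq_measure sum_ennreal)
      also have "\<dots> \<le> ennreal x" by (intro ennreal_leI part)
      finally show ?thesis by (subst (asm) ennreal_le_iff) (auto simp: x_def)
    qed
    then have "exp \<nu> \<le> x" using LIMSEQ_le_const2[OF lim] by auto
    then show ?thesis by (simp add: eq x ennreal_leI)
  qed
qed

text \<open>The accumulated increments never exceed \<open>\<nu> + C\<close>, the threshold plus one
  overshoot, while each survival step adds at least \<open>J\<close> on average, except that a bad
  step may replace \<open>J\<close> by \<open>- C\<close>. Solving the resulting inequality for the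
  sum of survival probabilities gives the quotient; the leading \<open>w\<close> covers the steps
  right after the change, whose window may reach back before it.\<close>

lemma delay_le:
  assumes A: "A \<in> sets (H k)"
    and bad: "\<And>n. k + w \<le> n \<Longrightarrow> bad n \<in> sets (H n)"
    and drift: "\<And>n \<omega>. k + w \<le> n \<Longrightarrow> \<omega> \<in> space (H 0) - bad n \<Longrightarrow>
      J \<le> q1 n \<omega> * a n \<omega> + (1 - q1 n \<omega>) * b n \<omega>"
    and bad_prob: "\<And>n A'. k + w \<le> n \<Longrightarrow> A' \<in> sets (H (n - w)) \<Longrightarrow>
      measure (M (enat k)) (A' \<inter> bad n) \<le> \<alpha> * measure (M (enat k)) A'"
    and J: "0 \<le> J" "0 \<le> \<alpha>" "(J + C) * \<alpha> < J"
  shows "(\<integral>\<^sup>+\<omega>. ennreal_of_enat (T \<omega> - enat k) * indicator A \<omega> \<partial>M (enat k))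
    \<le> ennreal (w + (\<nu> + C + (J + C) * \<alpha> * w) / (J - (J + C) * \<alpha>)) * emeasure (M (enat k)) A"
proof -
  let ?P = "M (enat k)"
  interpret prob_space ?P by (rule prob_space_law)
  let ?n0 = "k + w"
  have spP: "space ?P = space (H 0)" by (rule space_law_0)
  have A_P[measurable]: "A \<in> events" using A by (rule sets_H_law)
  have A_H: "A \<in> sets (H n)" if "k \<le> n" for n using A sets_H_mono[OF that] by auto
  have aP[measurable]: "alive T n \<in> events" for n by (rule alive_law[OF T_adapted])
  define G where "G j \<omega> = (\<Sum>n\<in>{?n0..<?n0 + j}. incr n \<omega> * indicator (alive T n) \<omega>)" for j \<omega>
  \<comment> \<open>Restarting the statistic at zero only raises it, so before the alarm the partial
    sums from \<open>k + w\<close> lie below it; at the alarm they exceed \<open>\<nu>\<close> by at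
    most one increment, and afterwards they are constant.\<close>
  have G_le: "G j \<omega> \<le> \<nu> + C \<and> (\<omega> \<in> alive T (?n0 + j) \<longrightarrow> G j \<omega> \<le> max (S (?n0 + j) \<omega>) 0)"
    if wo: "\<omega> \<in> space (H 0)" for j \<omega>
  proof (induction j)
    case 0
    then show ?case using \<nu>_pos C_nonneg by (simp add: G_def)
  next
    case (Suc j)
    let ?n = "?n0 + j"
    have G_Suc: "G (Suc j) \<omega> = G j \<omega> + incr ?n \<omega> * indicator (alive T ?n) \<omega>" by (simp add: G_def)
    show ?case
    proof (cases "\<omega> \<in> alive T ?n")
      case True
      have "S (Suc ?n) \<omega> = max (S ?n \<omega>) 0 + incr ?n \<omega>"
        using S_Suc[of ?n \<omega>] wo by (simp add: incr_def)
      then have *: "G (Suc j) \<omega> \<le> S (Suc ?n) \<omega>" using Suc.IH True by (simp add: G_Suc)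
      have "S ?n \<omega> < \<nu>"
      proof (cases "w < ?n")
        case True
        then show ?thesis using \<open>\<omega> \<in> alive T ?n\<close> by (auto simp: alive_eq)
      next
        case False
        then have "?n = w" by simp
        then show ?thesis using S_w[OF wo] \<nu>_pos by simp
      qed
      then have "max (S ?n \<omega>) 0 \<le> \<nu>" using \<nu>_pos by simp
      then have "S (Suc ?n) \<omega> \<le> \<nu> + C" using incr_bound[of ?n \<omega>] wo \<open>S (Suc ?n) \<omega> = _\<close> by auto
      then show ?thesis using * by auto
    next
      case False
      then have "\<omega> \<notin> alive T (Suc ?n)" using alive_antimono[of ?n "Suc ?n" T] by auto
      then show ?thesis using Suc.IH False by (simp add: G_Suc)
    qed
  qed
  let ?p = "\<lambda>n. prob (A \<inter> alive T n)"
  \<comment> \<open>The deficit is \<open>J + C\<close> because the conditional drift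
    \<open>D\<close> is always at least \<open>- C\<close>. The bad mass is charged to survival at
    \<open>n - w\<close>, the time at which the window is still in the future.\<close>
  have mean: "J * ?p n - (J + C) * (\<alpha> * ?p (n - w)) \<le> (\<integral>\<omega>. incr n \<omega> * indicator (A \<inter> alive T n) \<omega> \<partial>?P)"
    if n: "?n0 \<le> n" for n
  proof -
    have wn: "w \<le> n" "k \<le> n" "k \<le> n - w" using n by auto
    let ?B = "A \<inter> alive T n"
    let ?i = "\<lambda>\<omega>. indicator ?B \<omega> :: real"
    have BH: "?B \<in> sets (H n)" using A_H[OF wn(2)] alive_sets[OF T_adapted, of n n] by auto
    have BP: "?B \<in> events" by simp
    have badP: "bad n \<in> events" using bad[OF n] by (rule sets_H_law)
    have [measurable]: "?B \<in> sets (H n)" "a n \<in> borel_measurable (H n)" "b n \<in> borel_measurable (H n)" "q1 n \<in> borel_measurable (H n)"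
      using a_measurable b_measurable q1_measurable wn BH by auto
    have [measurable]: "a n \<in> borel_measurable ?P" "b n \<in> borel_measurable ?P" "q1 n \<in> borel_measurable ?P"
      using measurable_H_law[OF a_measurable[OF wn(1)]] measurable_H_law[OF b_measurable[OF wn(1)]]
        measurable_H_law[OF q1_measurable] by auto
    have bnd: "\<bar>a n \<omega>\<bar> \<le> C" "\<bar>b n \<omega>\<bar> \<le> C" if "\<omega> \<in> space (H n)" for \<omega>
      using a_bound[OF wn(1)] b_bound[OF wn(1)] that space_H[of n] by auto
    define D where "D \<omega> = q1 n \<omega> * a n \<omega> + (1 - q1 n \<omega>) * b n \<omega>" for \<omega>
    have D_bnd: "\<bar>D \<omega>\<bar> \<le> C" if "\<omega> \<in> space (H 0)" for \<omega>
    proof -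
      have w: "\<omega> \<in> space (H n)" using that space_H[of n] by simp
      have q: "0 \<le> q1 n \<omega>" "0 \<le> 1 - q1 n \<omega>" using q1_bounds[OF w] \<eta>_pos by auto
      have "\<bar>D \<omega>\<bar> \<le> q1 n \<omega> * \<bar>a n \<omega>\<bar> + (1 - q1 n \<omega>) * \<bar>b n \<omega>\<bar>"
        unfolding D_def using q by (intro order_trans[OF abs_triangle_ineq]) (simp add: abs_mult)
      also have "\<dots> \<le> q1 n \<omega> * C + (1 - q1 n \<omega>) * C"
        using q bnd[OF w] by (intro add_mono mult_left_mono) auto
      finally show ?thesis by (simp add: algebra_simps)
    qed
    have Dm[measurable]: "D \<in> borel_measurable ?P" unfolding D_def[abs_def] by measurable
    have "(\<integral>\<omega>. incr n \<omega> * ?i \<omega> \<partial>?P) = (\<integral>\<omega>. (if \<omega> \<in> E n then a n \<omega> * ?i \<omega> else b n \<omega> * ?i \<omega>) \<partial>?P)"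
      by (intro Bochner_Integration.integral_cong) (auto simp: incr_def)
    also have "\<dots> = (\<integral>\<omega>. bit_prob (enat k) n \<omega> * (a n \<omega> * ?i \<omega>) + (1 - bit_prob (enat k) n \<omega>) * (b n \<omega> * ?i \<omega>) \<partial>?P)"
      using bnd C_nonneg by (intro integral_step[where C=C]) (auto split: split_indicator)
    also have "\<dots> = (\<integral>\<omega>. D \<omega> * ?i \<omega> \<partial>?P)"
      using wn(2) by (intro Bochner_Integration.integral_cong) (auto simp: bit_prob_def D_def algebra_simps)
    finally have eq: "(\<integral>\<omega>. incr n \<omega> * ?i \<omega> \<partial>?P) = (\<integral>\<omega>. D \<omega> * ?i \<omega> \<partial>?P)" .
    have "(\<integral>\<omega>. J * ?i \<omega> - (J + C) * indicator (?B \<inter> bad n) \<omega> \<partial>?P) \<le> (\<integral>\<omega>. D \<omega> * ?i \<omega> \<partial>?P)"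
    proof (rule integral_mono)
      show "integrable ?P (\<lambda>\<omega>. J * ?i \<omega> - (J + C) * indicator (?B \<inter> bad n) \<omega>)"
        using integrable_indicator[OF BP] integrable_indicator[OF sets.Int[OF BP badP]] by simp
      show "integrable ?P (\<lambda>\<omega>. D \<omega> * ?i \<omega>)"
        using D_bnd spP C_nonneg by (intro integrable_bounded[where C=C]) (auto split: split_indicator)
      show "J * ?i \<omega> - (J + C) * indicator (?B \<inter> bad n) \<omega> \<le> D \<omega> * ?i \<omega>" if "\<omega> \<in> space ?P" for \<omega>
        using drift[OF n, of \<omega>] D_bnd[of \<omega>] that spP unfolding D_def[symmetric]
        by (auto split: split_indicator)
    qed
    also have "(\<integral>\<omega>. J * ?i \<omega> - (J + C) * indicator (?B \<inter> bad n) \<omega> \<partial>?P) = J * ?p n - (J + C) * prob (?B \<inter> bad n)"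
      using integrable_indicator[OF BP] integrable_indicator[OF sets.Int[OF BP badP]] sets.sets_into_space[OF BP]
      by (simp add: Int_absorb2 inf.coboundedI1)
    finally have 1: "J * ?p n - (J + C) * prob (?B \<inter> bad n) \<le> (\<integral>\<omega>. incr n \<omega> * ?i \<omega> \<partial>?P)"
      by (simp add: eq)
    \<comment> \<open>Survival at \<open>n\<close> may depend on the very bits that spoil the
      estimate. Enlarging it to survival at \<open>n - w\<close> gives an event to which
      \<open>bad_prob\<close> applies.\<close>
    have "prob (?B \<inter> bad n) \<le> prob ((A \<inter> alive T (n - w)) \<inter> bad n)"
      using alive_antimono[of "n - w" n T] badP by (intro finite_measure_mono) auto
    also have "\<dots> \<le> \<alpha> * ?p (n - w)"
      using A_H[OF wn(3)] alive_sets[OF T_adapted, of "n - w" "n - w"] by (intro bad_prob[OF n]) auto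
    finally have "(J + C) * prob (?B \<inter> bad n) \<le> (J + C) * (\<alpha> * ?p (n - w))"
      using J(1) C_nonneg by (intro mult_left_mono) auto
    then show ?thesis using 1 by linarith
  qed
  have sum_le: "(J - (J + C) * \<alpha>) * (\<Sum>n\<in>{?n0..<?n0 + j}. ?p n) \<le> (\<nu> + C + (J + C) * \<alpha> * w) * prob A" for j
  proof -
    \<comment> \<open>Moving the survival times back by \<open>w\<close> adds at most
      \<open>w\<close> terms, each bounded by the mass of \<open>A\<close>. This is where the term
      proportional to \<open>\<alpha> * w\<close> comes from.\<close>
    have shift: "(\<Sum>n\<in>{?n0..<?n0 + j}. ?p (n - w)) \<le> w * prob A + (\<Sum>n\<in>{?n0..<?n0 + j}. ?p n)"
    proof -
      have "(\<Sum>n\<in>{?n0..<?n0 + j}. ?p (n - w)) = (\<Sum>n\<in>{k..<k + j}. ?p n)"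
        using sum.shift_bounds_nat_ivl[of "\<lambda>n. ?p (n - w)" k w "k + j"] by (simp add: ac_simps)
      also have "\<dots> \<le> (\<Sum>n\<in>{k..<?n0 + j}. ?p n)"
        by (intro sum_mono2) auto
      also have "\<dots> = (\<Sum>n\<in>{k..<?n0}. ?p n) + (\<Sum>n\<in>{?n0..<?n0 + j}. ?p n)"
        by (intro sum.atLeastLessThan_concat[symmetric]) auto
      also have "(\<Sum>n\<in>{k..<?n0}. ?p n) \<le> (\<Sum>n\<in>{k..<?n0}. prob A)"
        by (intro sum_mono finite_measure_mono) auto
      finally show ?thesis by simp
    qed
    have incr_int: "integrable ?P (\<lambda>\<omega>. incr n \<omega> * indicator (A \<inter> alive T n) \<omega>)" if "?n0 \<le> n" for n
    proof -
      have "w \<le> n" using that by simp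
      note [measurable] = measurable_H_law[OF incr_measurable[OF \<open>w \<le> n\<close>], of "enat k"]
      show ?thesis
        using incr_bound[OF \<open>w \<le> n\<close>] spP C_nonneg by (intro integrable_bounded[where C=C]) (auto split: split_indicator)
    qed
    have "J * (\<Sum>n\<in>{?n0..<?n0 + j}. ?p n) - (J + C) * \<alpha> * (\<Sum>n\<in>{?n0..<?n0 + j}. ?p (n - w))
        = (\<Sum>n\<in>{?n0..<?n0 + j}. J * ?p n - (J + C) * (\<alpha> * ?p (n - w)))"
      by (simp add: sum_subtractf sum_distrib_left mult.assoc)
    also have "\<dots> \<le> (\<Sum>n\<in>{?n0..<?n0 + j}. (\<integral>\<omega>. incr n \<omega> * indicator (A \<inter> alive T n) \<omega> \<partial>?P))"
      by (intro sum_mono mean) auto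
    also have "\<dots> = (\<integral>\<omega>. (\<Sum>n\<in>{?n0..<?n0 + j}. incr n \<omega> * indicator (A \<inter> alive T n) \<omega>) \<partial>?P)"
      using incr_int by (intro Bochner_Integration.integral_sum[symmetric]) auto
    also have "\<dots> \<le> (\<integral>\<omega>. (\<nu> + C) * indicator A \<omega> \<partial>?P)"
    proof (rule integral_mono)
      show "integrable ?P (\<lambda>\<omega>. \<Sum>n\<in>{?n0..<?n0 + j}. incr n \<omega> * indicator (A \<inter> alive T n) \<omega>)"
        using incr_int by (intro Bochner_Integration.integrable_sum) auto
      show "integrable ?P (\<lambda>\<omega>. (\<nu> + C) * indicator A \<omega>)"
        using \<nu>_pos C_nonneg by (intro integrable_bounded[where C="\<nu> + C"]) (auto split: split_indicator)
      show "(\<Sum>n\<in>{?n0..<?n0 + j}. incr n \<omega> * indicator (A \<inter> alive T n) \<omega>) \<le> (\<nu> + C) * indicator A \<omega>" if "\<omega> \<in> space ?P" for \<omega>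
        using G_le[of \<omega> j] that spP unfolding G_def by (auto simp: indicator_inter_arith split: split_indicator)
    qed
    also have "\<dots> = (\<nu> + C) * prob A" by simp
    finally have "J * (\<Sum>n\<in>{?n0..<?n0 + j}. ?p n) \<le> (\<nu> + C) * prob A + (J + C) * \<alpha> * (\<Sum>n\<in>{?n0..<?n0 + j}. ?p (n - w))"
      by simp
    also have "\<dots> \<le> (\<nu> + C) * prob A + (J + C) * \<alpha> * (w * prob A + (\<Sum>n\<in>{?n0..<?n0 + j}. ?p n))"
      using shift J C_nonneg by (intro add_left_mono mult_left_mono) auto
    finally show ?thesis by (simp add: algebra_simps)
  qed
  let ?K = "w + (\<nu> + C + (J + C) * \<alpha> * w) / (J - (J + C) * \<alpha>)"
  have K0: "0 \<le> ?K" using \<nu>_pos C_nonneg J by (intro add_nonneg_nonneg divide_nonneg_nonneg mult_nonneg_nonneg) auto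
  have part: "(\<Sum>i<j. ?p (k + i)) \<le> ?K * prob A" for j
  proof -
    have "(\<Sum>i<j. ?p (k + i)) = (\<Sum>n\<in>{k..<k + j}. ?p n)"
      using sum.shift_bounds_nat_ivl[of ?p 0 k j] by (simp add: atLeast0LessThan add.commute)
    also have "\<dots> \<le> (\<Sum>n\<in>{k..<?n0 + j}. ?p n)" by (intro sum_mono2) auto
    also have "\<dots> = (\<Sum>n\<in>{k..<?n0}. ?p n) + (\<Sum>n\<in>{?n0..<?n0 + j}. ?p n)"
      by (intro sum.atLeastLessThan_concat[symmetric]) auto
    also have "(\<Sum>n\<in>{k..<?n0}. ?p n) \<le> (\<Sum>n\<in>{k..<?n0}. prob A)"
      by (intro sum_mono finite_measure_mono) auto
    also have "(\<Sum>n\<in>{?n0..<?n0 + j}. ?p n) \<le> (\<nu> + C + (J + C) * \<alpha> * w) * prob A / (J - (J + C) * \<alpha>)"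
      using sum_le[of j] J(3) by (simp add: pos_le_divide_eq mult.commute)
    finally show ?thesis by (simp add: algebra_simps)
  qed
  have "(\<integral>\<^sup>+\<omega>. ennreal_of_enat (T \<omega> - enat k) * indicator A \<omega> \<partial>?P) = (\<Sum>i. emeasure ?P (A \<inter> alive T (k + i)))"
    by (rule nn_integral_delay[OF T_adapted A_P])
  also have "\<dots> \<le> ennreal (?K * prob A)"
    using part by (intro suminf_le_const) (auto simp: emeasure_eq_measure sum_ennreal intro!: ennreal_leI)
  also have "\<dots> = ennreal ?K * emeasure ?P A"
    using K0 by (simp add: emeasure_eq_measure ennreal_mult)
  finally show ?thesis .
qed

end

section \<open>Policies driven by a seed and the bits\<close>

text \<open>Revealing the whole seed makes this contain both \<open>bit_filtration\<close> and
  \<open>aqute_info\<close>, so joint procedures and AQuTe-CUSUM become instances of the same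
  model.\<close>

definition policy_info ::
    "'u measure \<Rightarrow> (nat \<Rightarrow> 'u \<times> (nat \<Rightarrow> real) \<Rightarrow> real) \<Rightarrow> nat \<Rightarrow> ('u \<times> (nat \<Rightarrow> real)) measure" where
  "policy_info U \<tau> n = sigma (sample_space U)
     ({fst -` A \<inter> sample_space U | A. A \<in> sets U} \<union>
      {obs_bit \<tau> s -` A \<inter> sample_space U | s A. s \<in> {1..n}})"

definition randomized_policy ::
    "'u measure \<Rightarrow> real \<Rightarrow> real \<Rightarrow> (nat \<Rightarrow> 'u \<times> (nat \<Rightarrow> real) \<Rightarrow> real) \<Rightarrow> bool" where
  "randomized_policy U \<tau>min \<tau>max \<tau> \<longleftrightarrow>
     (\<forall>n. \<tau> (Suc n) \<in> borel_measurable (policy_info U \<tau> n) \<and>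
          (\<forall>\<omega>\<in>sample_space U. \<tau> (Suc n) \<omega> \<in> {\<tau>min..\<tau>max}))"

lemma sample_space_eq: "sample_space U = space U \<times> (\<Pi>\<^sub>E t\<in>{1..}. UNIV)"
  by (simp add: sample_space_def space_pair_measure space_PiM)

lemma space_policy_info: "space (policy_info U \<tau> n) = sample_space U"
  unfolding policy_info_def by (rule space_measure_of) auto

lemma sets_policy_info: "sets (policy_info U \<tau> n) = sigma_sets (sample_space U)
     ({fst -` A \<inter> sample_space U | A. A \<in> sets U} \<union>
      {obs_bit \<tau> s -` A \<inter> sample_space U | s A. s \<in> {1..n}})"
  unfolding policy_info_def by (rule sets_measure_of) auto

lemma sets_policy_info_mono: "m \<le> n \<Longrightarrow> sets (policy_info U \<tau> m) \<subseteq> sets (policy_info U \<tau> n)"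
  unfolding sets_policy_info by (rule sigma_sets_mono', rule Un_mono[OF order_refl]) (force intro: order_trans)

lemma fst_policy_info: "A \<in> sets U \<Longrightarrow> fst -` A \<inter> sample_space U \<in> sets (policy_info U \<tau> n)"
  unfolding sets_policy_info by (rule sigma_sets.Basic) auto

lemma bit_policy_info: "1 \<le> s \<Longrightarrow> s \<le> n \<Longrightarrow> obs_bit \<tau> s -` A \<inter> sample_space U \<in> sets (policy_info U \<tau> n)"
  unfolding sets_policy_info by (rule sigma_sets.Basic) auto

text \<open>Events known at time \<open>n\<close> cannot distinguish samples with the same seed and
  the same first \<open>n\<close> observations. By strong induction each threshold agrees on the two
  samples, because its level sets are earlier events; hence so do the bits and all the
  generators.\<close>

lemma policy_info_cong:
  assumes pol: "randomized_policy U \<tau>min \<tau>max \<tau>" and A: "A \<in> sets (policy_info U \<tau> n)"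
    and \<omega>: "\<omega> \<in> sample_space U" "\<omega>' \<in> sample_space U"
    and eq: "fst \<omega> = fst \<omega>'" "\<And>s. s \<in> {1..n} \<Longrightarrow> snd \<omega> s = snd \<omega>' s"
  shows "\<omega> \<in> A \<longleftrightarrow> \<omega>' \<in> A"
  using A eq
proof (induction n arbitrary: A rule: less_induct)
  case (less n)
  have bit: "obs_bit \<tau> s \<omega> = obs_bit \<tau> s \<omega>'" if s: "s \<in> {1..n}" for s
  proof -
    obtain k where k: "s = Suc k" using s by (cases s) auto
    have "\<tau> s \<in> borel_measurable (policy_info U \<tau> k)" using pol by (simp add: randomized_policy_def k)
    then have "\<tau> s -` {\<tau> s \<omega>} \<inter> sample_space U \<in> sets (policy_info U \<tau> k)"
      using measurable_sets[of "\<tau> s" "policy_info U \<tau> k" borel "{\<tau> s \<omega>}"] by (simp add: space_policy_info)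
    then have "\<omega> \<in> \<tau> s -` {\<tau> s \<omega>} \<inter> sample_space U \<longleftrightarrow> \<omega>' \<in> \<tau> s -` {\<tau> s \<omega>} \<inter> sample_space U"
      using less.prems s k by (intro less.IH[of k]) auto
    then have "\<tau> s \<omega>' = \<tau> s \<omega>" using \<omega> by auto
    then show ?thesis using less.prems(3)[OF s] by (simp add: obs_bit_def)
  qed
  from less.prems(1)[unfolded sets_policy_info] show ?case
  proof (induction rule: sigma_sets.induct)
    case (Basic a)
    then show ?case using bit \<omega> less.prems(2) by auto
  next
    case (Compl a)
    then show ?case using \<omega> by auto
  next
    case (Union a)
    then show ?case by auto
  qed simp
qed

text \<open>Glued events are closed under complements and countable unions, and the generators have
  this form: old ones trivially, and an event of the newest bit because that bit takes only the
  values 1 and -1.\<close>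

lemma policy_info_split:
  assumes "A \<in> sets (policy_info U \<tau> (Suc n))"
  defines "E \<equiv> obs_bit \<tau> (Suc n) -` {1} \<inter> sample_space U"
  shows "\<exists>A1\<in>sets (policy_info U \<tau> n). \<exists>A2\<in>sets (policy_info U \<tau> n). A = (A1 \<inter> E) \<union> (A2 - E)"
  using assms(1)[unfolded sets_policy_info]
proof (induction rule: sigma_sets.induct)
  case (Basic a)
  consider (old) "a \<in> sets (policy_info U \<tau> n)"
    | (new) B where "a = obs_bit \<tau> (Suc n) -` B \<inter> sample_space U"
  proof -
    from Basic consider A where "A \<in> sets U" "a = fst -` A \<inter> sample_space U"
      | s B where "s \<in> {1..Suc n}" "a = obs_bit \<tau> s -` B \<inter> sample_space U" by auto
    then show thesis
    proof cases
      case 1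
      then show thesis using fst_policy_info old by blast
    next
      case 2
      then show thesis using bit_policy_info[of s n \<tau> B U] old new by (cases "s = Suc n") auto
    qed
  qed
  then show ?case
  proof cases
    case old
    then show ?thesis by (intro bexI[of _ a]) auto
  next
    case new
    have top: "sample_space U \<in> sets (policy_info U \<tau> n)"
      using sets.top[of "policy_info U \<tau> n"] by (simp add: space_policy_info)
    have eq: "a = ((if 1 \<in> B then sample_space U else {}) \<inter> E) \<union> ((if -1 \<in> B then sample_space U else {}) - E)"
    proof (rule set_eqI)
      fix \<omega>
      show "\<omega> \<in> a \<longleftrightarrow> \<omega> \<in> ((if 1 \<in> B then sample_space U else {}) \<inter> E) \<union> ((if -1 \<in> B then sample_space U else {}) - E)"
        by (cases "snd \<omega> (Suc n) \<le> \<tau> (Suc n) \<omega>") (simp_all add: new E_def obs_bit_def)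
    qed
    have mem: "(if c \<in> B then sample_space U else {}) \<in> sets (policy_info U \<tau> n)" for c
      using top by auto
    show ?thesis
      by (intro bexI[of _ "if 1 \<in> B then sample_space U else {}"]
          bexI[of _ "if -1 \<in> B then sample_space U else {}"]) (rule eq mem)+
  qed
next
  case Empty
  show ?case by (intro bexI[of _ "{}"]) auto
next
  case (Compl a)
  then obtain A1 A2 where "A1 \<in> sets (policy_info U \<tau> n)" "A2 \<in> sets (policy_info U \<tau> n)" and a: "a = (A1 \<inter> E) \<union> (A2 - E)"
    by blast
  moreover have "sample_space U \<in> sets (policy_info U \<tau> n)"
    using sets.top[of "policy_info U \<tau> n"] by (simp add: space_policy_info)
  moreover have "sample_space U - a = ((sample_space U - A1) \<inter> E) \<union> ((sample_space U - A2) - E)"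
    unfolding a E_def by auto
  ultimately show ?case by blast
next
  case (Union a)
  have "\<exists>A1 A2. A1 \<in> sets (policy_info U \<tau> n) \<and> A2 \<in> sets (policy_info U \<tau> n) \<and> a i = (A1 \<inter> E) \<union> (A2 - E)" for i
    using Union.IH[of i] by (elim bexE) (intro exI conjI)
  then obtain A1 A2 where *: "\<And>i. A1 i \<in> sets (policy_info U \<tau> n)" "\<And>i. A2 i \<in> sets (policy_info U \<tau> n)"
    "\<And>i::nat. a i = (A1 i \<inter> E) \<union> (A2 i - E)" by metis
  have "(\<Union>i. a i) = ((\<Union>i. A1 i) \<inter> E) \<union> ((\<Union>i. A2 i) - E)" using *(3) by auto
  then show ?case using *(1,2) by (intro bexI[of _ "\<Union>i. A1 i"] bexI[of _ "\<Union>i. A2 i"]) auto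
qed

lemma policy_info_0:
  assumes "A \<in> sets (policy_info U \<tau> 0)"
  shows "\<exists>B\<in>sets U. A = fst -` B \<inter> sample_space U"
  using assms[unfolded sets_policy_info]
proof (induction rule: sigma_sets.induct)
  case (Compl a)
  then obtain B where "B \<in> sets U" "a = fst -` B \<inter> sample_space U" by blast
  then show ?case by (intro bexI[of _ "space U - B"]) (auto simp: sample_space_eq)
next
  case (Union a)
  then obtain B where B: "\<And>i. B i \<in> sets U" "\<And>i. a i = fst -` B i \<inter> sample_space U" by metis
  then show ?case by (intro bexI[of _ "\<Union>i::nat. B i"]) auto
qed auto

section \<open>The law of the observations and of the next bit\<close>

locale one_bit_law =
  fixes U :: "'u measure" and \<X> \<Theta> :: "real set" and p :: "real \<Rightarrow> real \<Rightarrow> real" and \<theta>0 \<theta>1 :: real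
  assumes prob_U: "prob_space U" and dens: "density_family \<X> \<Theta> p"
    and \<theta>0_in: "\<theta>0 \<in> \<Theta>" and \<theta>1_in: "\<theta>1 \<in> \<Theta>"
begin

abbreviation q :: "real \<Rightarrow> real \<Rightarrow> real" where "q \<equiv> one_bit_prob \<X> p 1"

abbreviation law :: "enat \<Rightarrow> ('u \<times> (nat \<Rightarrow> real)) measure" where "law \<equiv> sample_law U \<X> p \<theta>0 \<theta>1"

lemma dens_integrable: "\<theta> \<in> \<Theta> \<Longrightarrow> integrable lborel (\<lambda>x. indicator \<X> x * p x \<theta>)"
  using dens by (auto simp: density_family_def set_integrable_def)

lemma dens_nonneg: "\<theta> \<in> \<Theta> \<Longrightarrow> 0 \<le> indicator \<X> x * p x \<theta>"
  using dens by (auto simp: density_family_def split: split_indicator)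

lemma p_nonneg: "\<theta> \<in> \<Theta> \<Longrightarrow> x \<in> \<X> \<Longrightarrow> 0 \<le> p x \<theta>"
  using dens by (simp add: density_family_def)

lemma sets_obs_law[measurable_cong]: "sets (obs_law \<X> p \<theta>) = sets borel"
  by (simp add: obs_law_def)

lemma space_obs_law: "space (obs_law \<X> p \<theta>) = UNIV"
  by (simp add: obs_law_def)

lemma emeasure_obs_law:
  assumes "\<theta> \<in> \<Theta>" "B \<in> sets borel"
  shows "emeasure (obs_law \<X> p \<theta>) B = ennreal (LINT x:\<X> \<inter> B|lborel. p x \<theta>)"
proof -
  note [measurable] = borel_measurable_integrable[OF dens_integrable[OF assms(1)]]
  have "emeasure (obs_law \<X> p \<theta>) B = (\<integral>\<^sup>+x. ennreal (indicator \<X> x * p x \<theta>) * indicator B x \<partial>lborel)"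
    unfolding obs_law_def using assms(2) by (intro emeasure_density) auto
  also have "\<dots> = (\<integral>\<^sup>+x. ennreal (indicator B x * (indicator \<X> x * p x \<theta>)) \<partial>lborel)"
    by (intro nn_integral_cong) (auto split: split_indicator)
  also have "\<dots> = ennreal (\<integral>x. indicator B x * (indicator \<X> x * p x \<theta>) \<partial>lborel)"
    using integrable_mult_indicator[OF _ dens_integrable[OF assms(1)], of B] assms(2) dens_nonneg[OF assms(1)]
    by (intro nn_integral_eq_integral AE_I2) auto
  also have "(\<integral>x. indicator B x * (indicator \<X> x * p x \<theta>) \<partial>lborel) = (LINT x:\<X> \<inter> B|lborel. p x \<theta>)"
    unfolding set_lebesgue_integral_def by (intro Bochner_Integration.integral_cong) (auto split: split_indicator)
  finally show ?thesis .
qed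

lemma prob_obs_law: "\<theta> \<in> \<Theta> \<Longrightarrow> prob_space (obs_law \<X> p \<theta>)"
  using emeasure_obs_law[of \<theta> UNIV] dens
  by (intro prob_spaceI) (simp add: space_obs_law density_family_def)

lemma obs_law_bit: "\<theta> \<in> \<Theta> \<Longrightarrow> emeasure (obs_law \<X> p \<theta>) {..\<tau>} = ennreal (q \<theta> \<tau>)"
  using emeasure_obs_law[of \<theta> "{..\<tau>}"] by (simp add: one_bit_prob_def Int_def)

lemma q_nonneg: "\<theta> \<in> \<Theta> \<Longrightarrow> 0 \<le> q \<theta> \<tau>"
  unfolding one_bit_prob_def set_lebesgue_integral_def
  by (auto intro!: integral_nonneg_AE AE_I2 p_nonneg split: split_indicator)

lemma q_eq_measure: "\<theta> \<in> \<Theta> \<Longrightarrow> q \<theta> \<tau> = measure (obs_law \<X> p \<theta>) {..\<tau>}"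
  using obs_law_bit[of \<theta> \<tau>] q_nonneg[of \<theta> \<tau>] by (simp add: measure_def)

text \<open>Monotonicity in the threshold takes the place of smoothness at \<open>\<theta>0\<close>,
  which lies outside the domain of assumption A2: it yields measurability and places the extreme
  values at the ends of the threshold interval.\<close>

lemma q_mono: "\<theta> \<in> \<Theta> \<Longrightarrow> mono (q \<theta>)"
proof
  fix x y :: real assume "\<theta> \<in> \<Theta>" "x \<le> y"
  interpret prob_space "obs_law \<X> p \<theta>" by (rule prob_obs_law) fact
  show "q \<theta> x \<le> q \<theta> y"
    using \<open>\<theta> \<in> \<Theta>\<close> \<open>x \<le> y\<close> by (auto simp: q_eq_measure sets_obs_law intro!: finite_measure_mono)
qed

lemma one_bit_prob_neq_1:
  assumes "\<theta> \<in> \<Theta>" "b \<noteq> 1"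
  shows "one_bit_prob \<X> p b \<theta> \<tau> = 1 - q \<theta> \<tau>"
proof -
  interpret prob_space "obs_law \<X> p \<theta>" by (rule prob_obs_law) fact
  have "one_bit_prob \<X> p b \<theta> \<tau> = (LINT x:\<X> \<inter> {\<tau><..}|lborel. p x \<theta>)"
    using assms by (simp add: one_bit_prob_def Int_def)
  moreover have "0 \<le> (LINT x:\<X> \<inter> {\<tau><..}|lborel. p x \<theta>)"
    unfolding set_lebesgue_integral_def
    using assms by (auto intro!: integral_nonneg_AE AE_I2 p_nonneg split: split_indicator)
  ultimately have "one_bit_prob \<X> p b \<theta> \<tau> = prob {\<tau><..}"
    using emeasure_obs_law[OF assms(1), of "{\<tau><..}"] by (simp add: measure_def)
  also have "{\<tau><..} = space (obs_law \<X> p \<theta>) - {..\<tau>}" by (auto simp: space_obs_law)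
  also have "prob \<dots> = 1 - prob {..\<tau>}" by (intro prob_compl) (simp add: sets_obs_law)
  finally show ?thesis by (simp add: q_eq_measure[OF assms(1)])
qed

definition theta_at :: "enat \<Rightarrow> nat \<Rightarrow> real" where
  "theta_at k t = (if enat t \<le> k then \<theta>0 else \<theta>1)"

lemma theta_at_in: "theta_at k t \<in> \<Theta>"
  using \<theta>0_in \<theta>1_in by (simp add: theta_at_def)

lemma path_law_eq: "path_law \<X> p \<theta>0 \<theta>1 k = (\<Pi>\<^sub>M t\<in>{1..}. obs_law \<X> p (theta_at k t))"
  by (simp add: path_law_def theta_at_def)

lemma sets_path_law: "sets (path_law \<X> p \<theta>0 \<theta>1 k) = sets (\<Pi>\<^sub>M t\<in>{1::nat..}. (borel :: real measure))"
  unfolding path_law_def by (intro sets_PiM_cong) (auto simp: sets_obs_law)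

lemma prob_path_law: "prob_space (path_law \<X> p \<theta>0 \<theta>1 k)"
  unfolding path_law_eq by (intro prob_space_PiM prob_obs_law theta_at_in)

lemma sets_law: "sets (law k) = sets (U \<Otimes>\<^sub>M (\<Pi>\<^sub>M t\<in>{1::nat..}. (borel :: real measure)))"
  unfolding sample_law_def by (intro sets_pair_measure_cong sets_path_law refl)

lemma space_sample_law: "space (law k) = sample_space U"
  unfolding sample_space_def by (rule sets_eq_imp_space_eq[OF sets_law])

lemma prob_law: "prob_space (law k)"
proof -
  interpret U: prob_space U by (rule prob_U)
  interpret V: prob_space "path_law \<X> p \<theta>0 \<theta>1 k" by (rule prob_path_law)
  interpret UV: pair_prob_space U "path_law \<X> p \<theta>0 \<theta>1 k" ..
  show ?thesis unfolding sample_law_def by (rule UV.prob_space_axioms)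
qed

lemma coord_measurable: "1 \<le> t \<Longrightarrow> (\<lambda>\<omega>. snd \<omega> t) \<in> borel_measurable (law k)"
proof -
  assume t: "1 \<le> t"
  have "(\<lambda>\<omega>. snd \<omega> t) \<in> borel_measurable (U \<Otimes>\<^sub>M (\<Pi>\<^sub>M t\<in>{1::nat..}. (borel :: real measure)))"
    using t by (intro measurable_compose[OF measurable_snd measurable_component_singleton]) auto
  then show ?thesis unfolding measurable_cong_sets[OF sets_law refl] .
qed

lemma policy_info_law:
  assumes pol: "randomized_policy U \<tau>min \<tau>max \<tau>"
  shows "sets (policy_info U \<tau> n) \<subseteq> sets (law k)"
proof (induction n rule: less_induct)
  case (less n)
  have "{fst -` A \<inter> sample_space U | A. A \<in> sets U} \<union> {obs_bit \<tau> s -` A \<inter> sample_space U | s A. s \<in> {1..n}} \<subseteq> sets (law k)"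
  proof (intro Un_least subsetI)
    fix a assume "a \<in> {fst -` A \<inter> sample_space U | A. A \<in> sets U}"
    then obtain A where A: "A \<in> sets U" "a = fst -` A \<inter> space (law k)" by (auto simp: space_sample_law)
    have "fst \<in> measurable (law k) U" unfolding sample_law_def by measurable
    from measurable_sets[OF this A(1)] show "a \<in> sets (law k)" using A by simp
  next
    fix a assume "a \<in> {obs_bit \<tau> s -` A \<inter> sample_space U | s A. s \<in> {1..n}}"
    then obtain s A where s: "s \<in> {1..n}" and a: "a = obs_bit \<tau> s -` A \<inter> space (law k)" by (auto simp: space_sample_law)
    obtain m where m: "s = Suc m" using s by (cases s) auto
    have "\<tau> s \<in> borel_measurable (policy_info U \<tau> m)" using pol by (simp add: randomized_policy_def m)
    then have [measurable]: "\<tau> s \<in> borel_measurable (law k)"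
      using less.IH[of m] m s by (intro measurable_from_subalg[of "law k" "policy_info U \<tau> m"]) 
        (auto simp: subalgebra_def space_sample_law space_policy_info)
    have [measurable]: "(\<lambda>\<omega>. snd \<omega> s) \<in> borel_measurable (law k)" using s by (intro coord_measurable) auto
    have "obs_bit \<tau> s \<in> measurable (law k) (count_space UNIV)" unfolding obs_bit_def[abs_def] by measurable
    then show "a \<in> sets (law k)" unfolding a by (rule measurable_sets) simp
  qed
  then have "sigma_sets (sample_space U) ({fst -` A \<inter> sample_space U | A. A \<in> sets U} \<union> {obs_bit \<tau> s -` A \<inter> sample_space U | s A. s \<in> {1..n}}) \<subseteq> sets (law k)"
    unfolding space_sample_law[symmetric, of k] by (rule sets.sigma_sets_subset)
  then show ?case by (simp add: sets_policy_info)
qed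

text \<open>Fubini with observation \<open>t\<close> integrated first. Together with
  \<open>policy_info_cong\<close> this is how independence of the next observation from the past is
  used.\<close>

lemma nn_integral_law_coord:
  assumes f: "f \<in> borel_measurable (law k)" and t: "1 \<le> t"
  defines "J \<equiv> {1..} - {t}"
  shows "(\<integral>\<^sup>+\<omega>. f \<omega> \<partial>law k) =
    (\<integral>\<^sup>+u. (\<integral>\<^sup>+Y. (\<integral>\<^sup>+x. f (u, Y(t := x)) \<partial>obs_law \<X> p (theta_at k t))
       \<partial>(\<Pi>\<^sub>M s\<in>J. obs_law \<X> p (theta_at k s))) \<partial>U)"
proof -
  let ?L = "\<lambda>s. obs_law \<X> p (theta_at k s)"
  have pr: "prob_space (?L s)" for s by (intro prob_obs_law theta_at_in)
  interpret Lt: prob_space "?L t" by (rule pr)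
  interpret PJ: prob_space "\<Pi>\<^sub>M s\<in>J. ?L s" by (intro prob_space_PiM pr)
  interpret pair_sigma_finite "?L t" "\<Pi>\<^sub>M s\<in>J. ?L s" ..
  interpret P: prob_space "path_law \<X> p \<theta>0 \<theta>1 k" by (rule prob_path_law)
  have ins: "insert t J = {1..}" using t by (auto simp: J_def)
  have eq: "path_law \<X> p \<theta>0 \<theta>1 k = distr (?L t \<Otimes>\<^sub>M (\<Pi>\<^sub>M s\<in>J. ?L s)) (\<Pi>\<^sub>M s\<in>{1..}. ?L s) (\<lambda>(x, Y). Y(t := x))"
    using distr_pair_PiM_eq_PiM[of J ?L t] pr by (simp add: ins path_law_eq)
  have upd[measurable]: "(\<lambda>(x, Y). Y(t := x)) \<in> measurable (?L t \<Otimes>\<^sub>M (\<Pi>\<^sub>M s\<in>J. ?L s)) (\<Pi>\<^sub>M s\<in>{1..}. ?L s)"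
    using measurable_add_dim[of t J ?L] measurable_compose[OF measurable_pair_swap' measurable_add_dim[of t J ?L]]
    by (simp add: ins split_beta)
  have f'[measurable]: "f \<in> borel_measurable (U \<Otimes>\<^sub>M path_law \<X> p \<theta>0 \<theta>1 k)" using f by (simp add: sample_law_def)
  have "(\<integral>\<^sup>+\<omega>. f \<omega> \<partial>law k) = (\<integral>\<^sup>+u. (\<integral>\<^sup>+Y. f (u, Y) \<partial>path_law \<X> p \<theta>0 \<theta>1 k) \<partial>U)"
    unfolding sample_law_def by (rule P.nn_integral_fst[symmetric]) simp
  also have "\<dots> = (\<integral>\<^sup>+u. (\<integral>\<^sup>+Y. (\<integral>\<^sup>+x. f (u, Y(t := x)) \<partial>?L t) \<partial>(\<Pi>\<^sub>M s\<in>J. ?L s)) \<partial>U)"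
  proof (rule nn_integral_cong)
    fix u assume u: "u \<in> space U"
    have [measurable]: "(\<lambda>Y. f (u, Y)) \<in> borel_measurable (\<Pi>\<^sub>M s\<in>{1..}. ?L s)"
      using f' u unfolding path_law_eq by measurable
    have "(\<integral>\<^sup>+Y. f (u, Y) \<partial>path_law \<X> p \<theta>0 \<theta>1 k) = (\<integral>\<^sup>+z. f (u, (\<lambda>(x, Y). Y(t := x)) z) \<partial>(?L t \<Otimes>\<^sub>M (\<Pi>\<^sub>M s\<in>J. ?L s)))"
      unfolding eq by (rule nn_integral_distr) measurable
    also have "\<dots> = (\<integral>\<^sup>+z. (\<lambda>(x, Y). f (u, Y(t := x))) z \<partial>(?L t \<Otimes>\<^sub>M (\<Pi>\<^sub>M s\<in>J. ?L s)))"
      by (simp add: split_beta)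
    also have "\<dots> = (\<integral>\<^sup>+Y. (\<integral>\<^sup>+x. f (u, Y(t := x)) \<partial>?L t) \<partial>(\<Pi>\<^sub>M s\<in>J. ?L s))"
    proof -
      have "(\<lambda>z. f (u, (\<lambda>(x, Y). Y(t := x)) z)) \<in> borel_measurable (?L t \<Otimes>\<^sub>M (\<Pi>\<^sub>M s\<in>J. ?L s))"
        by (rule measurable_compose[OF upd]) measurable
      then have "(\<lambda>z. (\<lambda>(x, Y). f (u, Y(t := x))) z) \<in> borel_measurable (?L t \<Otimes>\<^sub>M (\<Pi>\<^sub>M s\<in>J. ?L s))"
        by (simp add: split_beta)
      from nn_integral_snd[OF this] show ?thesis by simp
    qed
    finally show "(\<integral>\<^sup>+Y. f (u, Y) \<partial>path_law \<X> p \<theta>0 \<theta>1 k) = \<dots>" .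
  qed
  finally show ?thesis .
qed

text \<open>Once the seed and the other observations are fixed, membership in \<open>A\<close> and
  the threshold do not vary with observation \<open>Suc n\<close>, so the inner integral is the
  probability of falling below a constant.\<close>

lemma law_one_step:
  assumes pol: "randomized_policy U \<tau>min \<tau>max \<tau>" and A: "A \<in> sets (policy_info U \<tau> n)"
  shows "emeasure (law k) (A \<inter> (obs_bit \<tau> (Suc n) -` {1} \<inter> sample_space U)) =
    (\<integral>\<^sup>+\<omega>. ennreal (q (theta_at k (Suc n)) (\<tau> (Suc n) \<omega>)) * indicator A \<omega> \<partial>law k)"
proof -
  let ?t = "Suc n" and ?\<theta> = "theta_at k (Suc n)"
  let ?E = "obs_bit \<tau> ?t -` {1} \<inter> sample_space U"
  interpret Lt: prob_space "obs_law \<X> p ?\<theta>" by (intro prob_obs_law theta_at_in)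
  have AL[measurable]: "A \<in> sets (law k)" using A policy_info_law[OF pol] by blast
  have EL[measurable]: "?E \<in> sets (law k)"
    using bit_policy_info[of ?t ?t \<tau> "{1}" U] policy_info_law[OF pol, of ?t k] by auto
  have \<tau>H: "\<tau> ?t \<in> borel_measurable (policy_info U \<tau> n)" using pol by (simp add: randomized_policy_def)
  have \<tau>L[measurable]: "\<tau> ?t \<in> borel_measurable (law k)"
    using policy_info_law[OF pol, of n k] by (intro measurable_from_subalg[OF _ \<tau>H])
      (auto simp: subalgebra_def space_sample_law space_policy_info)
  have q_meas[measurable]: "q ?\<theta> \<in> borel_measurable borel" by (intro borel_measurable_mono q_mono theta_at_in)
  have "emeasure (law k) (A \<inter> ?E) = (\<integral>\<^sup>+\<omega>. indicator (A \<inter> ?E) \<omega> \<partial>law k)" by simp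
  also have "\<dots> = (\<integral>\<^sup>+u. (\<integral>\<^sup>+Y. (\<integral>\<^sup>+x. indicator (A \<inter> ?E) (u, Y(?t := x)) \<partial>obs_law \<X> p ?\<theta>)
       \<partial>(\<Pi>\<^sub>M s\<in>{1..} - {?t}. obs_law \<X> p (theta_at k s))) \<partial>U)"
    by (rule nn_integral_law_coord) auto
  also have "\<dots> = (\<integral>\<^sup>+u. (\<integral>\<^sup>+Y. (\<integral>\<^sup>+x. ennreal (q ?\<theta> (\<tau> ?t (u, Y(?t := x)))) * indicator A (u, Y(?t := x)) \<partial>obs_law \<X> p ?\<theta>)
       \<partial>(\<Pi>\<^sub>M s\<in>{1..} - {?t}. obs_law \<X> p (theta_at k s))) \<partial>U)"
  proof (rule nn_integral_cong, rule nn_integral_cong)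
    fix u Y assume u: "u \<in> space U" and Y: "Y \<in> space (\<Pi>\<^sub>M s\<in>{1..} - {?t}. obs_law \<X> p (theta_at k s))"
    have sp: "(u, Y(?t := x)) \<in> sample_space U" for x
      using u Y by (auto simp: sample_space_eq space_PiM PiE_def extensional_def)
    \<comment> \<open>The value 0 is arbitrary: \<open>w\<close> only represents the common past of
      all these sample points.\<close>
    obtain w where w: "w = (u, Y(?t := 0))" by simp
    have sw: "w \<in> sample_space U" using sp by (simp add: w)
    have Ac: "(u, Y(?t := x)) \<in> A \<longleftrightarrow> w \<in> A" for x
      by (rule policy_info_cong[OF pol A sp sw]) (auto simp: w)
    have \<tau>c: "\<tau> ?t (u, Y(?t := x)) = \<tau> ?t w" for x
    proof -
      have "\<tau> ?t -` {\<tau> ?t w} \<inter> sample_space U \<in> sets (policy_info U \<tau> n)"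
        using measurable_sets[OF \<tau>H, of "{\<tau> ?t w}"] by (simp add: space_policy_info)
      then have "(u, Y(?t := x)) \<in> \<tau> ?t -` {\<tau> ?t w} \<inter> sample_space U \<longleftrightarrow> w \<in> \<tau> ?t -` {\<tau> ?t w} \<inter> sample_space U"
        by (rule policy_info_cong[OF pol _ sp sw]) (auto simp: w)
      then show ?thesis using sp sw by auto
    qed
    have "(\<integral>\<^sup>+x. indicator (A \<inter> ?E) (u, Y(?t := x)) \<partial>obs_law \<X> p ?\<theta>)
        = (\<integral>\<^sup>+x. indicator A w * indicator {..\<tau> ?t w} x \<partial>obs_law \<X> p ?\<theta>)"
      using sp by (intro nn_integral_cong) (auto simp: Ac obs_bit_def \<tau>c split: split_indicator)
    also have "\<dots> = indicator A w * ennreal (q ?\<theta> (\<tau> ?t w))"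
      by (subst nn_integral_cmult_indicator) (auto simp: sets_obs_law obs_law_bit theta_at_in)
    also have "\<dots> = (\<integral>\<^sup>+x. ennreal (q ?\<theta> (\<tau> ?t w)) * indicator A w \<partial>obs_law \<X> p ?\<theta>)"
      by (simp add: Lt.emeasure_space_1 mult.commute)
    also have "\<dots> = (\<integral>\<^sup>+x. ennreal (q ?\<theta> (\<tau> ?t (u, Y(?t := x)))) * indicator A (u, Y(?t := x)) \<partial>obs_law \<X> p ?\<theta>)"
      by (intro nn_integral_cong) (auto simp: Ac \<tau>c split: split_indicator)
    finally show "(\<integral>\<^sup>+x. indicator (A \<inter> ?E) (u, Y(?t := x)) \<partial>obs_law \<X> p ?\<theta>) = \<dots>" .
  qed
  also have "\<dots> = (\<integral>\<^sup>+\<omega>. ennreal (q ?\<theta> (\<tau> ?t \<omega>)) * indicator A \<omega> \<partial>law k)"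
    by (rule nn_integral_law_coord[symmetric]) auto
  finally show ?thesis .
qed

lemma bit_model_policy:
  assumes pol: "randomized_policy U \<tau>min \<tau>max \<tau>" and \<eta>: "0 < \<eta>"
    and q: "\<And>x. x \<in> {\<tau>min..\<tau>max} \<Longrightarrow> q \<theta>0 x \<in> {\<eta>..1 - \<eta>} \<and> q \<theta>1 x \<in> {\<eta>..1 - \<eta>}"
  shows "bit_model law (policy_info U \<tau>) (\<lambda>n. obs_bit \<tau> (Suc n) -` {1} \<inter> sample_space U)
    (\<lambda>n \<omega>. q \<theta>0 (\<tau> (Suc n) \<omega>)) (\<lambda>n \<omega>. q \<theta>1 (\<tau> (Suc n) \<omega>)) \<eta>"
proof (rule bit_model.intro)
  show "prob_space (law k)" for k by (rule prob_law)
  show "subalgebra (law k) (policy_info U \<tau> n)" for k n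
    using policy_info_law[OF pol] by (auto simp: subalgebra_def space_sample_law space_policy_info)
  show "sets (policy_info U \<tau> n) \<subseteq> sets (policy_info U \<tau> (Suc n))" for n
    by (rule sets_policy_info_mono) simp
  show "obs_bit \<tau> (Suc n) -` {1} \<inter> sample_space U \<in> sets (policy_info U \<tau> (Suc n))" for n
    by (rule bit_policy_info) auto
  have \<tau>: "\<tau> (Suc n) \<in> borel_measurable (policy_info U \<tau> n)" for n using pol by (simp add: randomized_policy_def)
  show "(\<lambda>\<omega>. q \<theta>0 (\<tau> (Suc n) \<omega>)) \<in> borel_measurable (policy_info U \<tau> n)" for n
    by (rule measurable_compose[OF \<tau> borel_measurable_mono[OF q_mono[OF \<theta>0_in]]])
  show "(\<lambda>\<omega>. q \<theta>1 (\<tau> (Suc n) \<omega>)) \<in> borel_measurable (policy_info U \<tau> n)" for n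
    by (rule measurable_compose[OF \<tau> borel_measurable_mono[OF q_mono[OF \<theta>1_in]]])
  show "0 < \<eta>" by fact
  show "q \<theta>0 (\<tau> (Suc n) \<omega>) \<in> {\<eta>..1 - \<eta>}" "q \<theta>1 (\<tau> (Suc n) \<omega>) \<in> {\<eta>..1 - \<eta>}" if "\<omega> \<in> space (policy_info U \<tau> n)" for \<omega> n
    using q[of "\<tau> (Suc n) \<omega>"] pol that by (auto simp: randomized_policy_def space_policy_info)
  show "\<exists>A1\<in>sets (policy_info U \<tau> n). \<exists>A2\<in>sets (policy_info U \<tau> n).
      A = A1 \<inter> (obs_bit \<tau> (Suc n) -` {1} \<inter> sample_space U) \<union> (A2 - obs_bit \<tau> (Suc n) -` {1} \<inter> sample_space U)"
    if "A \<in> sets (policy_info U \<tau> (Suc n))" for A n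
    using policy_info_split[OF that] .
  show "emeasure (law k) A = emeasure (law \<infinity>) A" if A: "A \<in> sets (policy_info U \<tau> 0)" for A k
  proof -
    obtain B where B: "B \<in> sets U" and AB: "A = fst -` B \<inter> sample_space U" using policy_info_0[OF A] by blast
    have "emeasure (law k) A = emeasure U B" for k
    proof -
      interpret P: prob_space "path_law \<X> p \<theta>0 \<theta>1 k" by (rule prob_path_law)
      have "A = B \<times> space (path_law \<X> p \<theta>0 \<theta>1 k)"
        using sets.sets_into_space[OF B] sets_eq_imp_space_eq[OF sets_path_law[of k]]
        by (auto simp: AB sample_space_eq space_PiM)
      then show ?thesis using B P.emeasure_space_1 by (simp add: sample_law_def P.emeasure_pair_measure_Times)
    qed
    then show ?thesis by simp
  qed
  show "emeasure (law k) (A \<inter> (obs_bit \<tau> (Suc n) -` {1} \<inter> sample_space U)) =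
      (\<integral>\<^sup>+\<omega>. ennreal (if enat (Suc n) \<le> k then q \<theta>0 (\<tau> (Suc n) \<omega>) else q \<theta>1 (\<tau> (Suc n) \<omega>)) * indicator A \<omega> \<partial>law k)"
    if "A \<in> sets (policy_info U \<tau> n)" for A n k
    using law_one_step[OF pol that, of k] by (simp add: theta_at_def if_distrib if_distribR)
qed

end

section \<open>Divergences and the windowed estimate\<close>

text \<open>The mean log-likelihood ratio of bit probability \<open>z\<close> against
  \<open>y\<close> when the true one is \<open>x\<close>: the drift of a CUSUM that plugs in
  \<open>z\<close>.\<close>

definition cross_entropy_gain :: "real \<Rightarrow> real \<Rightarrow> real \<Rightarrow> real" where
  "cross_entropy_gain x z y = x * ln (z / y) + (1 - x) * ln ((1 - z) / (1 - y))"

lemma bit_kl_eq_gain: "bit_kl x y = cross_entropy_gain x x y"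
  by (simp add: bit_kl_def cross_entropy_gain_def)

lemma bit_kl_nonneg:
  assumes "0 < x" "x < 1" "0 < y" "y < 1"
  shows "0 \<le> bit_kl x y"
proof -
  have *: "a - b \<le> a * ln (a / b)" if "0 < a" "0 < b" for a b :: real
  proof -
    have "ln (b / a) \<le> b / a - 1" using that by (intro ln_le_minus_one) auto
    then have "a * (1 - b / a) \<le> a * ln (a / b)"
      using that by (intro mult_left_mono) (auto simp: ln_div)
    then show ?thesis using that by (simp add: right_diff_distrib)
  qed
  from *[of x y] *[of "1 - x" "1 - y"] assms show ?thesis by (simp add: bit_kl_def)
qed

text \<open>The loss from plugging in \<open>z\<close> instead of the truth \<open>x\<close> is
  \<open>bit_kl x z\<close>, which is nonnegative.\<close>

lemma gain_le_bit_kl: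
  assumes "0 < x" "x < 1" "0 < z" "z < 1" "0 < y" "y < 1"
  shows "cross_entropy_gain x z y \<le> bit_kl x y"
  using bit_kl_nonneg[of x z] assms
  by (simp add: bit_kl_def cross_entropy_gain_def ln_div algebra_simps)

text \<open>The gain is affine in the true probability, with a slope that is a difference of two
  bounded log ratios.\<close>

lemma gain_diff_le:
  assumes \<eta>: "0 < \<eta>" and "z \<in> {\<eta>..1 - \<eta>}" "y \<in> {\<eta>..1 - \<eta>}"
  shows "cross_entropy_gain x z y \<le> cross_entropy_gain x' z y + 2 * (- ln \<eta>) * \<bar>x - x'\<bar>"
proof -
  have "cross_entropy_gain x z y - cross_entropy_gain x' z y
      = (x - x') * (ln (z / y) - ln ((1 - z) / (1 - y)))"
    by (simp add: cross_entropy_gain_def algebra_simps)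
  also have "\<dots> \<le> \<bar>x - x'\<bar> * \<bar>ln (z / y) - ln ((1 - z) / (1 - y))\<bar>"
    by (metis abs_ge_self abs_mult)
  also have "\<dots> \<le> \<bar>x - x'\<bar> * (2 * (- ln \<eta>))"
    using abs_ln_ratio_le[OF \<eta>, of z y] abs_ln_ratio_le[OF \<eta>, of "1 - z" "1 - y"] assms by (intro mult_left_mono) auto
  finally show ?thesis by (simp add: mult.commute)
qed

text \<open>Twice the affinity falls short of 2 by the squared Hellinger-type distance, the sum of
  the squared differences of the square roots.\<close>

lemma affinity_less_1:
  assumes "0 < x" "x < 1" "0 < y" "y < 1" "x \<noteq> y"
  shows "sqrt (x * y) + sqrt ((1 - x) * (1 - y)) < (1::real)"
proof -
  have *: "2 * sqrt (a * b) = a + b - (sqrt a - sqrt b)\<^sup>2" if "0 < a" "0 < b" for a b :: real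
    using that by (simp add: power2_diff real_sqrt_mult)
  have "0 < (sqrt x - sqrt y)\<^sup>2" "0 \<le> (sqrt (1 - x) - sqrt (1 - y))\<^sup>2" using assms by auto
  moreover have "2 * sqrt (x * y) = x + y - (sqrt x - sqrt y)\<^sup>2"
    "2 * sqrt ((1 - x) * (1 - y)) = (1 - x) + (1 - y) - (sqrt (1 - x) - sqrt (1 - y))\<^sup>2"
    using assms *[of x y] *[of "1 - x" "1 - y"] by simp_all
  ultimately show ?thesis by linarith
qed

section \<open>Consequences of the assumptions\<close>

locale change_detection = one_bit_law +
  fixes \<Theta>1 :: "real set" and \<tau>min \<tau>max :: real
  assumes \<Theta>1_sub: "\<Theta>1 \<subseteq> \<Theta>" and \<tau>_le: "\<tau>min \<le> \<tau>max"
    and A1: "assm_A1 \<Theta>1 \<theta>1" and A2: "assm_A2 \<X> p \<Theta>1 \<tau>min \<tau>max"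
    and A3: "assm_A3 \<X> p \<Theta>1 \<tau>min \<tau>max" and A4: "assm_A4 \<X> p \<Theta>1 \<tau>min \<tau>max"
    and A6: "assm_A6 \<X> p \<theta>0 \<theta>1 \<tau>min \<tau>max"
begin

abbreviation thresholds :: "real set" where "thresholds \<equiv> {\<tau>min..\<tau>max}"

abbreviation KL :: "real \<Rightarrow> real \<Rightarrow> real" where "KL \<theta> x \<equiv> bit_kl (q \<theta> x) (q \<theta>0 x)"

lemma \<theta>1_in_\<Theta>1: "\<theta>1 \<in> \<Theta>1"
  using A1 interior_subset by (auto simp: assm_A1_def)

lemma compact_\<Theta>1: "compact \<Theta>1"
  using A1 by (simp add: assm_A1_def)

lemma in_\<Theta>: "\<theta> \<in> \<Theta>1 \<Longrightarrow> \<theta> \<in> \<Theta>"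
  using \<Theta>1_sub by auto

lemma q_continuous: "continuous_on (\<Theta>1 \<times> thresholds) (\<lambda>(\<theta>, x). q \<theta> x)"
proof -
  from A2 obtain D :: "nat \<Rightarrow> nat \<Rightarrow> real \<Rightarrow> real \<Rightarrow> real" where
    D: "\<forall>\<theta>\<in>\<Theta>1. \<forall>\<tau>\<in>thresholds. D 0 0 \<theta> \<tau> = q \<theta> \<tau>"
    and c: "\<forall>i j. i + j \<le> 3 \<longrightarrow> continuous_on (\<Theta>1 \<times> thresholds) (\<lambda>(\<theta>, \<tau>). D i j \<theta> \<tau>)"
    unfolding assm_A2_def by blast
  have "continuous_on (\<Theta>1 \<times> thresholds) (\<lambda>(\<theta>, \<tau>). D 0 0 \<theta> \<tau>)" using c by auto
  then show ?thesis
    by (rule continuous_on_cong[THEN iffD1, rotated -1]) (use D in auto)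
qed

lemma q_uniform:
  assumes "0 < e"
  obtains d where "0 < d" "\<And>\<theta> \<theta>' x. \<theta> \<in> \<Theta>1 \<Longrightarrow> \<theta>' \<in> \<Theta>1 \<Longrightarrow> x \<in> thresholds \<Longrightarrow> \<bar>\<theta> - \<theta>'\<bar> < d \<Longrightarrow> \<bar>q \<theta> x - q \<theta>' x\<bar> < e"
proof -
  have "uniformly_continuous_on (\<Theta>1 \<times> thresholds) (\<lambda>(\<theta>, x). q \<theta> x)"
    by (intro compact_uniformly_continuous q_continuous compact_Times compact_\<Theta>1 compact_Icc)
  then obtain d where d: "0 < d" and *: "\<And>a b. a \<in> \<Theta>1 \<times> thresholds \<Longrightarrow> b \<in> \<Theta>1 \<times> thresholds \<Longrightarrow> dist b a < d \<Longrightarrow>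
      dist (case b of (\<theta>, x) \<Rightarrow> q \<theta> x) (case a of (\<theta>, x) \<Rightarrow> q \<theta> x) < e"
    using assms unfolding uniformly_continuous_on_def by metis
  show thesis
  proof (rule that[OF d])
    fix \<theta> \<theta>' x assume "\<theta> \<in> \<Theta>1" "\<theta>' \<in> \<Theta>1" "x \<in> thresholds" "\<bar>\<theta> - \<theta>'\<bar> < d"
    then show "\<bar>q \<theta> x - q \<theta>' x\<bar> < e"
      using *[of "(\<theta>', x)" "(\<theta>, x)"] by (simp add: dist_Pair_Pair dist_real_def)
  qed
qed

lemma q_measurable_comp:
  assumes "f \<in> borel_measurable N" "g \<in> borel_measurable N"
    and "\<And>\<omega>. \<omega> \<in> space N \<Longrightarrow> f \<omega> \<in> \<Theta>1" "\<And>\<omega>. \<omega> \<in> space N \<Longrightarrow> g \<omega> \<in> thresholds"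
  shows "(\<lambda>\<omega>. q (f \<omega>) (g \<omega>)) \<in> borel_measurable N"
proof -
  let ?h = "\<lambda>z. indicator (\<Theta>1 \<times> thresholds) z *\<^sub>R (\<lambda>(\<theta>, x). q \<theta> x) z"
  have "?h \<in> borel_measurable borel"
    by (intro borel_measurable_continuous_on_indicator q_continuous borel_closed closed_Times
        compact_imp_closed[OF compact_\<Theta>1] closed_atLeastAtMost)
  then have "(\<lambda>\<omega>. ?h (f \<omega>, g \<omega>)) \<in> borel_measurable N"
    by (rule measurable_compose[rotated]) (use assms(1,2) in measurable)
  then show ?thesis
    by (rule measurable_cong[THEN iffD1, rotated]) (use assms(3,4) in auto)
qed

lemma q_\<Theta>1_01:
  assumes "\<theta> \<in> \<Theta>1" "x \<in> thresholds" shows "0 < q \<theta> x" "q \<theta> x < 1"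
proof -
  from A3 assms obtain \<delta> where "\<delta> \<in> {0<..<1/2}" "q \<theta> x \<in> {\<delta>..1 - \<delta>}"
    unfolding assm_A3_def by blast
  then show "0 < q \<theta> x" "q \<theta> x < 1" by auto
qed

lemma one_bit_div_eq:
  assumes "\<theta> \<in> \<Theta>" "u \<in> \<Theta>"
  shows "one_bit_div \<X> p \<theta> u x = kl_term (1 - q \<theta> x) (1 - q u x) + kl_term (q \<theta> x) (q u x)"
  using assms by (simp add: one_bit_div_def one_bit_prob_neq_1)

lemma KL_finite_at_maximizer:
  obtains x y where "is_arg_max (one_bit_KL \<X> p \<theta>0 \<theta>1) (\<lambda>x. x \<in> thresholds) x"
    "one_bit_KL \<X> p \<theta>0 \<theta>1 x = ereal y"
proof -
  from A6 obtain \<tau>s g g' where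
    *: "is_arg_max (one_bit_KL \<X> p \<theta>0 \<theta>1) (\<lambda>x. x \<in> thresholds) \<tau>s"
    "\<forall>\<^sub>F \<tau> in nhds \<tau>s. one_bit_KL \<X> p \<theta>0 \<theta>1 \<tau> = ereal (g \<tau>) \<and> (g has_real_derivative g' \<tau>) (at \<tau>)"
    unfolding assm_A6_def by blast
  from that[OF *(1), of "g \<tau>s"] eventually_nhds_x_imp_x[OF *(2)] show thesis by simp
qed

text \<open>Both bits have positive probability under \<open>\<theta>1\<close>. A vanishing bit
  probability under \<open>\<theta>0\<close> would make the divergence infinite, above the finite
  maximum that A6 provides.\<close>

lemma q_\<theta>0_01:
  assumes x: "x \<in> thresholds" shows "0 < q \<theta>0 x" "q \<theta>0 x < 1"
proof -
  obtain y z where "is_arg_max (one_bit_KL \<X> p \<theta>0 \<theta>1) (\<lambda>x. x \<in> thresholds) y"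
    "one_bit_KL \<X> p \<theta>0 \<theta>1 y = ereal z" by (rule KL_finite_at_maximizer)
  then have "one_bit_KL \<X> p \<theta>0 \<theta>1 x \<le> ereal z"
    using x by (metis is_arg_max_def not_le_imp_less)
  then have fin: "kl_term (1 - q \<theta>1 x) (1 - q \<theta>0 x) + kl_term (q \<theta>1 x) (q \<theta>0 x) \<noteq> \<infinity>"
    by (auto simp: one_bit_KL_def one_bit_div_eq \<theta>0_in \<theta>1_in)
  have q1: "0 < q \<theta>1 x" "q \<theta>1 x < 1" using q_\<Theta>1_01[OF \<theta>1_in_\<Theta>1 x] by auto
  have "q \<theta>0 x \<noteq> 0" "q \<theta>0 x \<noteq> 1" using fin q1 by (auto simp: kl_term_def split: if_splits)
  moreover have "q \<theta>0 x \<le> 1"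
  proof -
    interpret prob_space "obs_law \<X> p \<theta>0" by (rule prob_obs_law[OF \<theta>0_in])
    show ?thesis by (simp add: q_eq_measure[OF \<theta>0_in])
  qed
  ultimately show "0 < q \<theta>0 x" "q \<theta>0 x < 1" using q_nonneg[OF \<theta>0_in, of x] by auto
qed

definition \<eta> :: real where
  "\<eta> = (SOME e. 0 < e \<and> (\<forall>\<theta>\<in>insert \<theta>0 \<Theta>1. \<forall>x\<in>thresholds. q \<theta> x \<in> {e..1 - e}))"

lemma \<eta>_props: "0 < \<eta> \<and> (\<forall>\<theta>\<in>insert \<theta>0 \<Theta>1. \<forall>x\<in>thresholds. q \<theta> x \<in> {\<eta>..1 - \<eta>})"
  unfolding \<eta>_def
proof (rule someI_ex)
  from A3 obtain \<delta> where \<delta>: "\<delta> \<in> {0<..<1/2}" "\<forall>\<theta>\<in>\<Theta>1. \<forall>x\<in>thresholds. q \<theta> x \<in> {\<delta>..1 - \<delta>}"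
    unfolding assm_A3_def by blast
  \<comment> \<open>A3 gives the margin on \<open>\<Theta>1\<close>; for \<open>\<theta>0\<close>
    the ends of the interval give the extremes, by monotonicity.\<close>
  let ?e = "min \<delta> (min (q \<theta>0 \<tau>min) (1 - q \<theta>0 \<tau>max))"
  have "0 < ?e" using \<delta> q_\<theta>0_01[of \<tau>min] q_\<theta>0_01[of \<tau>max] \<tau>_le by auto
  moreover have "q \<theta> x \<in> {?e..1 - ?e}" if "\<theta> \<in> insert \<theta>0 \<Theta>1" "x \<in> thresholds" for \<theta> x
  proof (cases "\<theta> \<in> \<Theta>1")
    case True
    then show ?thesis using \<delta>(2) that by (fastforce simp: min_le_iff_disj)
  next
    case False
    then have "\<theta> = \<theta>0" using that by auto
    moreover have "q \<theta>0 \<tau>min \<le> q \<theta>0 x" "q \<theta>0 x \<le> q \<theta>0 \<tau>max"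
      using that(2) by (auto intro!: monoD[OF q_mono[OF \<theta>0_in]])
    ultimately show ?thesis by (auto simp: min_le_iff_disj)
  qed
  ultimately show "\<exists>e>0. \<forall>\<theta>\<in>insert \<theta>0 \<Theta>1. \<forall>x\<in>thresholds. q \<theta> x \<in> {e..1 - e}" by blast
qed

lemma \<eta>_gt_0: "0 < \<eta>" using \<eta>_props by blast

lemma q_bounds: "\<theta> \<in> \<Theta>1 \<Longrightarrow> x \<in> thresholds \<Longrightarrow> q \<theta> x \<in> {\<eta>..1 - \<eta>}"
  and q\<theta>0_bounds: "x \<in> thresholds \<Longrightarrow> q \<theta>0 x \<in> {\<eta>..1 - \<eta>}"
  using \<eta>_props by auto

lemma \<eta>_less_1: "\<eta> < 1"
  using q\<theta>0_bounds[of \<tau>min] \<eta>_gt_0 \<tau>_le by auto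

lemma one_bit_KL_eq:
  assumes "\<theta> \<in> \<Theta>1" "x \<in> thresholds"
  shows "one_bit_KL \<X> p \<theta>0 \<theta> x = ereal (KL \<theta> x)"
  using q_\<Theta>1_01[OF assms] q_\<theta>0_01[OF assms(2)] in_\<Theta>[OF assms(1)]
  by (simp add: one_bit_KL_def one_bit_div_eq \<theta>0_in kl_term_def bit_kl_def)

lemma KL_nonneg: "\<theta> \<in> \<Theta>1 \<Longrightarrow> x \<in> thresholds \<Longrightarrow> 0 \<le> KL \<theta> x"
  using q_\<Theta>1_01 q_\<theta>0_01 by (intro bit_kl_nonneg) auto

lemma arg_max_KL_iff:
  assumes "\<theta> \<in> \<Theta>1"
  shows "is_arg_max (one_bit_KL \<X> p \<theta>0 \<theta>) (\<lambda>x. x \<in> thresholds) x \<longleftrightarrow>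
    x \<in> thresholds \<and> (\<forall>y\<in>thresholds. KL \<theta> y \<le> KL \<theta> x)"
  using assms by (auto simp: is_arg_max_def one_bit_KL_eq not_less)

definition KLM :: real where
  "KLM = real_of_ereal (KL_max \<X> p \<theta>0 \<theta>1 \<tau>min \<tau>max)"

definition best :: real where
  "best = (SOME x. x \<in> thresholds \<and> (\<forall>y\<in>thresholds. KL \<theta>1 y \<le> KL \<theta>1 x))"

lemma best: "best \<in> thresholds" "y \<in> thresholds \<Longrightarrow> KL \<theta>1 y \<le> KL \<theta>1 best"
proof -
  have "\<exists>x. x \<in> thresholds \<and> (\<forall>y\<in>thresholds. KL \<theta>1 y \<le> KL \<theta>1 x)"
    using KL_finite_at_maximizer arg_max_KL_iff[OF \<theta>1_in_\<Theta>1] by metis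
  from someI_ex[OF this] show "best \<in> thresholds" "y \<in> thresholds \<Longrightarrow> KL \<theta>1 y \<le> KL \<theta>1 best"
    unfolding best_def by blast+
qed

lemma KLM_eq: "KLM = KL \<theta>1 best"
proof -
  have "(SUP x\<in>thresholds. one_bit_KL \<X> p \<theta>0 \<theta>1 x) = ereal (KL \<theta>1 best)"
  proof (rule SUP_eqI)
    show "one_bit_KL \<X> p \<theta>0 \<theta>1 i \<le> ereal (KL \<theta>1 best)" if "i \<in> thresholds" for i
      using best(2)[OF that] that by (simp add: one_bit_KL_eq \<theta>1_in_\<Theta>1)
    show "ereal (KL \<theta>1 best) \<le> y" if "\<And>i. i \<in> thresholds \<Longrightarrow> one_bit_KL \<X> p \<theta>0 \<theta>1 i \<le> y" for y
      using that[OF best(1)] best(1) by (simp add: one_bit_KL_eq \<theta>1_in_\<Theta>1)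
  qed
  then show ?thesis by (simp add: KLM_def KL_max_def)
qed

lemma KL_le_KLM: "x \<in> thresholds \<Longrightarrow> KL \<theta>1 x \<le> KLM"
  using best(2) by (simp add: KLM_eq)

text \<open>If the maximum were zero, every threshold would be a maximizer, including the endpoint
  \<open>\<tau>min\<close>, contrary to the unique interior maximizer at
  \<open>\<theta>1\<close>.\<close>

lemma KLM_pos: "0 < KLM"
proof (rule ccontr)
  assume "\<not> 0 < KLM"
  then have zero: "KL \<theta>1 x = 0" if "x \<in> thresholds" for x
    using KL_nonneg[OF \<theta>1_in_\<Theta>1 that] KL_le_KLM[OF that] by simp
  from A6 have "\<forall>\<^sub>F \<theta> in nhds \<theta>1. \<exists>\<tau>s\<in>{\<tau>min<..<\<tau>max}.
        \<forall>\<tau>. is_arg_max (one_bit_KL \<X> p \<theta>0 \<theta>) (\<lambda>x. x \<in> thresholds) \<tau> \<longleftrightarrow> \<tau> = \<tau>s"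
    unfolding assm_A6_def by blast
  from eventually_nhds_x_imp_x[OF this] obtain \<tau>s where s: "\<tau>s \<in> {\<tau>min<..<\<tau>max}"
    and u: "\<And>\<tau>. is_arg_max (one_bit_KL \<X> p \<theta>0 \<theta>1) (\<lambda>x. x \<in> thresholds) \<tau> \<longleftrightarrow> \<tau> = \<tau>s" by blast
  have "is_arg_max (one_bit_KL \<X> p \<theta>0 \<theta>1) (\<lambda>x. x \<in> thresholds) \<tau>min"
    unfolding arg_max_KL_iff[OF \<theta>1_in_\<Theta>1] using zero \<tau>_le by auto
  with u s show False by auto
qed

text \<open>The comparison runs through divergence values at \<open>best\<close>, not through
  convergence of the chosen threshold to \<open>best\<close>. The true bit law is exchanged for the
  estimated one at \<open>best\<close>, optimality of \<open>x\<close> for the estimate is used, and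
  the true law is restored at \<open>x\<close>. Misspecification only lowers the gain.\<close>

lemma plug_in_drift:
  assumes "0 < e"
  obtains d where "0 < d" "\<And>\<theta> x. \<theta> \<in> \<Theta>1 \<Longrightarrow> \<bar>\<theta> - \<theta>1\<bar> < d \<Longrightarrow>
      is_arg_max (one_bit_KL \<X> p \<theta>0 \<theta>) (\<lambda>x. x \<in> thresholds) x \<Longrightarrow>
      KLM - e \<le> cross_entropy_gain (q \<theta>1 x) (q \<theta> x) (q \<theta>0 x)"
proof -
  define L where "L = 2 * (- ln \<eta>)"
  have L: "0 < L" using \<eta>_gt_0 \<eta>_less_1 by (simp add: L_def)
  \<comment> \<open>The true and the estimated law are exchanged twice, and each exchange costs at
    most \<open>L * e' = e / 2\<close>.\<close>
  define e' where "e' = e / (2 * L)"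
  have e': "0 < e'" using assms L by (simp add: e'_def)
  obtain d where d: "0 < d" and close: "\<And>\<theta> \<theta>' x. \<theta> \<in> \<Theta>1 \<Longrightarrow> \<theta>' \<in> \<Theta>1 \<Longrightarrow> x \<in> thresholds \<Longrightarrow> \<bar>\<theta> - \<theta>'\<bar> < d \<Longrightarrow>
      \<bar>q \<theta> x - q \<theta>' x\<bar> < e'" using q_uniform[OF e'] by blast
  show thesis
  proof (rule that[OF d])
    fix \<theta> x assume \<theta>: "\<theta> \<in> \<Theta>1" "\<bar>\<theta> - \<theta>1\<bar> < d"
      and am: "is_arg_max (one_bit_KL \<X> p \<theta>0 \<theta>) (\<lambda>x. x \<in> thresholds) x"
    have x: "x \<in> thresholds" and mx: "KL \<theta> best \<le> KL \<theta> x"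
      using am[unfolded arg_max_KL_iff[OF \<theta>(1)]] best(1) by auto
    have c: "L * \<bar>q \<theta>1 y - q \<theta> y\<bar> \<le> e / 2" if "y \<in> thresholds" for y
    proof -
      have "L * \<bar>q \<theta>1 y - q \<theta> y\<bar> \<le> L * e'"
        using close[OF \<theta>(1) \<theta>1_in_\<Theta>1 that \<theta>(2)] L by (intro mult_left_mono) auto
      then show ?thesis using L by (simp add: e'_def)
    qed
    have "KLM \<le> cross_entropy_gain (q \<theta> best) (q \<theta>1 best) (q \<theta>0 best) + L * \<bar>q \<theta>1 best - q \<theta> best\<bar>"
      unfolding KLM_eq bit_kl_eq_gain L_def
      by (intro gain_diff_le \<eta>_gt_0 q_bounds q\<theta>0_bounds best \<theta>1_in_\<Theta>1)
    also have "cross_entropy_gain (q \<theta> best) (q \<theta>1 best) (q \<theta>0 best) \<le> KL \<theta> best"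
      using best(1) \<theta>(1) \<theta>1_in_\<Theta>1 by (intro gain_le_bit_kl q_\<Theta>1_01 q_\<theta>0_01)
    also note mx
    also have "KL \<theta> x \<le> cross_entropy_gain (q \<theta>1 x) (q \<theta> x) (q \<theta>0 x) + L * \<bar>q \<theta> x - q \<theta>1 x\<bar>"
      unfolding bit_kl_eq_gain L_def using \<theta>(1) x by (intro gain_diff_le \<eta>_gt_0 q_bounds q\<theta>0_bounds)
    finally show "KLM - e \<le> cross_entropy_gain (q \<theta>1 x) (q \<theta> x) (q \<theta>0 x)"
      using c[OF x] c[OF best(1)] by (simp add: abs_minus_commute)
  qed
qed

text \<open>Identifiability is A4 with the distance of \<open>u\<close> from
  \<open>\<theta>1\<close> as \<open>\<epsilon>\<close>: equal bit probabilities would make the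
  divergence zero.\<close>

lemma q_neq:
  assumes "u \<in> \<Theta>1" "u \<noteq> \<theta>1" "x \<in> thresholds"
  shows "q \<theta>1 x \<noteq> q u x"
proof
  assume eq: "q \<theta>1 x = q u x"
  have "0 < \<bar>u - \<theta>1\<bar>" using assms by simp
  then obtain c where "c > 0"
    and c: "ereal c \<le> (INF (\<theta>, v)\<in>{(\<theta>, v). \<theta> \<in> \<Theta>1 \<and> v \<in> \<Theta>1 \<and> \<bar>u - \<theta>1\<bar> \<le> \<bar>v - \<theta>\<bar>}. one_bit_div \<X> p \<theta> v x)"
    using A4 assms(3) unfolding assm_A4_def by blast
  have "(INF (\<theta>, v)\<in>{(\<theta>, v). \<theta> \<in> \<Theta>1 \<and> v \<in> \<Theta>1 \<and> \<bar>u - \<theta>1\<bar> \<le> \<bar>v - \<theta>\<bar>}. one_bit_div \<X> p \<theta> v x) \<le> one_bit_div \<X> p \<theta>1 u x"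
    by (rule INF_lower2[of "(\<theta>1, u)"]) (use assms \<theta>1_in_\<Theta>1 in auto)
  also have "one_bit_div \<X> p \<theta>1 u x = 0"
    using eq assms by (simp add: one_bit_div_eq in_\<Theta> \<theta>1_in kl_term_def)
  finally have "ereal c \<le> 0" using c by (rule order_trans[rotated])
  with \<open>c > 0\<close> show False by simp
qed

text \<open>The Bhattacharyya coefficient of the bit under \<open>\<theta>1\<close> and
  \<open>u\<close>, which is the \<open>\<theta>1\<close>-mean of the square root of the likelihood
  ratio.\<close>

definition affinity :: "real \<Rightarrow> real \<Rightarrow> real" where
  "affinity u x = sqrt (q \<theta>1 x * q u x) + sqrt ((1 - q \<theta>1 x) * (1 - q u x))"

text \<open>The constants of A4 may vary with the threshold, while the policy may pick any
  threshold. A continuous affinity that is pointwise below 1 attains its maximum on the compact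
  product, which makes the bound uniform.\<close>

lemma affinity_bound:
  assumes "0 < e"
  obtains \<rho> where "0 < \<rho>" "\<rho> < 1"
    "\<And>u x. u \<in> \<Theta>1 \<Longrightarrow> e \<le> \<bar>u - \<theta>1\<bar> \<Longrightarrow> x \<in> thresholds \<Longrightarrow> affinity u x \<le> \<rho>"
proof (cases "{u \<in> \<Theta>1. e \<le> \<bar>u - \<theta>1\<bar>} = {}")
  case True
  then show thesis using that[of "1/2"] by auto
next
  case False
  let ?K = "{u \<in> \<Theta>1. e \<le> \<bar>u - \<theta>1\<bar>}"
  have "closed {u. e \<le> \<bar>u - \<theta>1\<bar>}" by (intro closed_Collect_le continuous_intros)
  then have "compact (\<Theta>1 \<inter> {u. e \<le> \<bar>u - \<theta>1\<bar>})" using compact_\<Theta>1 by (intro compact_Int_closed)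
  moreover have "\<Theta>1 \<inter> {u. e \<le> \<bar>u - \<theta>1\<bar>} = ?K" by auto
  ultimately have cK: "compact (?K \<times> thresholds)" by (intro compact_Times) auto
  have qK: "continuous_on (?K \<times> thresholds) (\<lambda>z. q (fst z) (snd z))"
    using continuous_on_subset[OF q_continuous, of "?K \<times> thresholds"] by (auto simp: split_beta)
  have q1K: "continuous_on (?K \<times> thresholds) (\<lambda>z. q \<theta>1 (snd z))"
  proof -
    have "continuous_on (?K \<times> thresholds) ((\<lambda>z. q (fst z) (snd z)) \<circ> (\<lambda>z. (\<theta>1, snd z)))"
      using q_continuous \<theta>1_in_\<Theta>1
      by (intro continuous_on_compose continuous_intros)
         (auto elim!: continuous_on_subset simp: split_beta)
    then show ?thesis by (simp add: o_def)
  qed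
  have cont: "continuous_on (?K \<times> thresholds) (\<lambda>z. affinity (fst z) (snd z))"
    unfolding affinity_def by (intro continuous_intros qK q1K)
  have "?K \<times> thresholds \<noteq> {}" using False \<tau>_le by simp
  from continuous_attains_sup[OF cK this cont] obtain z where z: "z \<in> ?K \<times> thresholds"
    and mx: "\<And>y. y \<in> ?K \<times> thresholds \<Longrightarrow> affinity (fst y) (snd y) \<le> affinity (fst z) (snd z)"
    by blast
  have zz: "fst z \<in> \<Theta>1" "fst z \<noteq> \<theta>1" "snd z \<in> thresholds" using z assms by auto
  show thesis
  proof (rule that[of "affinity (fst z) (snd z)"])
    note b = q_\<Theta>1_01[OF \<theta>1_in_\<Theta>1 zz(3)] q_\<Theta>1_01[OF zz(1,3)]
    show "affinity (fst z) (snd z) < 1"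
      unfolding affinity_def using q_neq[OF zz] b by (intro affinity_less_1)
    show "0 < affinity (fst z) (snd z)"
      unfolding affinity_def using b by (intro add_pos_pos) auto
    show "affinity u x \<le> affinity (fst z) (snd z)" if "u \<in> \<Theta>1" "e \<le> \<bar>u - \<theta>1\<bar>" "x \<in> thresholds" for u x
      using mx[of "(u, x)"] that by simp
  qed
qed

text \<open>The estimate ranges over a continuum, so a union bound requires a finite net. Log
  probabilities vary by at most \<open>e\<close> once probabilities vary by
  \<open>e * \<eta>\<close>, since these are at least \<open>\<eta>\<close>.\<close>

lemma log_prob_net:
  assumes "0 < e" and K: "K \<subseteq> \<Theta>1" "compact K"
  obtains N where "finite N" "N \<subseteq> K"
    "\<And>u. u \<in> K \<Longrightarrow> \<exists>v\<in>N. \<forall>x\<in>thresholds. \<forall>b. ln (one_bit_prob \<X> p b u x) \<le> ln (one_bit_prob \<X> p b v x) + e"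
proof -
  have "0 < e * \<eta>" using assms \<eta>_gt_0 by simp
  then obtain d where d: "0 < d" and close: "\<And>\<theta> \<theta>' x. \<theta> \<in> \<Theta>1 \<Longrightarrow> \<theta>' \<in> \<Theta>1 \<Longrightarrow> x \<in> thresholds \<Longrightarrow> \<bar>\<theta> - \<theta>'\<bar> < d \<Longrightarrow>
      \<bar>q \<theta> x - q \<theta>' x\<bar> < e * \<eta>" using q_uniform by blast
  obtain N where N: "N \<subseteq> K" "finite N" "K \<subseteq> (\<Union>x\<in>N. ball x d)"
    using compactE_image[OF K(2), of K "\<lambda>x. ball x d"] d by (metis UN_I centre_in_ball open_ball subsetI)
  have lnd: "ln a \<le> ln b + e" if "0 < a" "\<eta> \<le> b" "\<bar>a - b\<bar> < e * \<eta>" for a b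
  proof -
    have b: "0 < b" using that \<eta>_gt_0 by simp
    have "ln (a / b) \<le> a / b - 1" using that b by (intro ln_le_minus_one) auto
    also have "a / b - 1 \<le> e"
    proof -
      have "a - b \<le> e * \<eta>" using that by auto
      also have "\<dots> \<le> e * b" using that assms by (intro mult_left_mono) auto
      finally show ?thesis using b by (simp add: field_simps)
    qed
    finally show ?thesis using that b by (simp add: ln_div)
  qed
  show thesis
  proof (rule that[OF N(2,1)])
    fix u assume u: "u \<in> K"
    then obtain v where v: "v \<in> N" "dist v u < d" using N(3) by auto
    have "ln (one_bit_prob \<X> p b u x) \<le> ln (one_bit_prob \<X> p b v x) + e" if x: "x \<in> thresholds" for x b
    proof -
      have uv: "u \<in> \<Theta>1" "v \<in> \<Theta>1" using u v N(1) K(1) by auto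
      have "\<bar>q u x - q v x\<bar> < e * \<eta>" using close[OF uv x] v(2) by (simp add: dist_real_def abs_minus_commute)
      moreover have "q v x \<in> {\<eta>..1 - \<eta>}" using q_bounds[OF uv(2) x] .
      ultimately show ?thesis
        using lnd[of "q u x" "q v x"] lnd[of "1 - q u x" "1 - q v x"] q_\<Theta>1_01[OF uv(1) x]
        by (cases "b = 1") (auto simp: one_bit_prob_neq_1 in_\<Theta> uv abs_minus_commute)
    qed
    then show "\<exists>v\<in>N. \<forall>x\<in>thresholds. \<forall>b. ln (one_bit_prob \<X> p b u x) \<le> ln (one_bit_prob \<X> p b v x) + e"
      using v(1) by blast
  qed
qed

abbreviation bit_one :: "(nat \<Rightarrow> 'a \<times> (nat \<Rightarrow> real) \<Rightarrow> real) \<Rightarrow> nat \<Rightarrow> ('a \<times> (nat \<Rightarrow> real)) set" where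
  "bit_one \<tau> n \<equiv> obs_bit \<tau> (Suc n) -` {1} \<inter> sample_space U"

lemma bit_model:
  assumes "randomized_policy U \<tau>min \<tau>max \<tau>"
  shows "bit_model law (policy_info U \<tau>) (bit_one \<tau>)
    (\<lambda>n \<omega>. q \<theta>0 (\<tau> (Suc n) \<omega>)) (\<lambda>n \<omega>. q \<theta>1 (\<tau> (Suc n) \<omega>)) \<eta>"
  using assms \<eta>_gt_0 by (rule bit_model_policy) (use q_bounds q\<theta>0_bounds \<theta>1_in_\<Theta>1 in blast)

text \<open>The square root of the likelihood ratio of each point of a finite net against \<open>\<theta>1\<close> has
  conditional mean at most \<open>\<rho> < 1\<close> per bit.\<close>

lemma estimate_consistent:
  assumes "0 < e"
  obtains \<alpha> :: "nat \<Rightarrow> real" where "\<alpha> \<longlonglongrightarrow> 0" "\<And>w. 0 \<le> \<alpha> w"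
    "\<And>\<tau> k n w f A. randomized_policy U \<tau>min \<tau>max \<tau> \<Longrightarrow> k + w \<le> n \<Longrightarrow>
      f \<in> borel_measurable (policy_info U \<tau> n) \<Longrightarrow>
      (\<And>\<omega>. \<omega> \<in> sample_space U \<Longrightarrow>
         is_arg_max (\<lambda>\<theta>. \<Sum>s=Suc n - w..n. ln (one_bit_prob \<X> p (obs_bit \<tau> s \<omega>) \<theta> (\<tau> s \<omega>))) (\<lambda>\<theta>. \<theta> \<in> \<Theta>1) (f \<omega>)) \<Longrightarrow>
      A \<in> sets (policy_info U \<tau> (n - w)) \<Longrightarrow>
      measure (law (enat k)) (A \<inter> {\<omega> \<in> sample_space U. e \<le> \<bar>f \<omega> - \<theta>1\<bar>}) \<le> \<alpha> w * measure (law (enat k)) A"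
proof -
  obtain \<rho> where \<rho>: "0 < \<rho>" "\<rho> < 1"
    and aff: "\<And>u x. u \<in> \<Theta>1 \<Longrightarrow> e \<le> \<bar>u - \<theta>1\<bar> \<Longrightarrow> x \<in> thresholds \<Longrightarrow> affinity u x \<le> \<rho>"
    using affinity_bound[OF assms] by blast
  \<comment> \<open>The per-bit tolerance of the net equals the decay rate of the affinity. The
    square root halves the tolerance, and \<open>exp (r / 2) * \<rho> = exp (- r / 2)\<close> still
    decays.\<close>
  define r where "r = - ln \<rho>"
  have r: "0 < r" "exp (- r) = \<rho>" using \<rho> by (auto simp: r_def)
  define K where "K = {u \<in> \<Theta>1. e \<le> \<bar>u - \<theta>1\<bar>}"
  have "closed {u. e \<le> \<bar>u - \<theta>1\<bar>}" by (intro closed_Collect_le continuous_intros)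
  then have "compact (\<Theta>1 \<inter> {u. e \<le> \<bar>u - \<theta>1\<bar>})" using compact_\<Theta>1 by (intro compact_Int_closed)
  moreover have "\<Theta>1 \<inter> {u. e \<le> \<bar>u - \<theta>1\<bar>} = K" by (auto simp: K_def)
  ultimately have K: "K \<subseteq> \<Theta>1" "compact K" by (auto simp: K_def)
  obtain N where N: "finite N" "N \<subseteq> K" and net: "\<And>u. u \<in> K \<Longrightarrow> \<exists>v\<in>N. \<forall>x\<in>thresholds. \<forall>b.
      ln (one_bit_prob \<X> p b u x) \<le> ln (one_bit_prob \<X> p b v x) + r"
    using log_prob_net[OF r(1) K] by blast
  define \<alpha> where "\<alpha> w = real (card N) * exp (- r / 2) ^ w" for w
  show thesis
  proof (rule that[of \<alpha>])
    have "exp (- r / 2) < 1" using r by simp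
    then have "(\<lambda>w. exp (- r / 2) ^ w) \<longlonglongrightarrow> 0" by (intro LIMSEQ_power_zero) auto
    from tendsto_mult_right_zero[OF this] show "\<alpha> \<longlonglongrightarrow> 0" unfolding \<alpha>_def[abs_def] .
    show "0 \<le> \<alpha> w" for w by (simp add: \<alpha>_def)
    fix \<tau> k n w f A
    assume pol: "randomized_policy U \<tau>min \<tau>max \<tau>" and n: "k + w \<le> n"
      and f: "f \<in> borel_measurable (policy_info U \<tau> n)"
      and mle: "\<And>\<omega>. \<omega> \<in> sample_space U \<Longrightarrow>
         is_arg_max (\<lambda>\<theta>. \<Sum>s=Suc n - w..n. ln (one_bit_prob \<X> p (obs_bit \<tau> s \<omega>) \<theta> (\<tau> s \<omega>))) (\<lambda>\<theta>. \<theta> \<in> \<Theta>1) (f \<omega>)"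
      and A: "A \<in> sets (policy_info U \<tau> (n - w))"
    interpret bit_model law "policy_info U \<tau>" "bit_one \<tau>" "\<lambda>n \<omega>. q \<theta>0 (\<tau> (Suc n) \<omega>)" "\<lambda>n \<omega>. q \<theta>1 (\<tau> (Suc n) \<omega>)" \<eta>
      by (rule bit_model[OF pol])
    let ?P = "law (enat k)"
    interpret P: prob_space ?P by (rule prob_law)
    have sp: "space (policy_info U \<tau> m) = sample_space U" for m by (rule space_policy_info)
    have \<tau>_in: "\<tau> (Suc m) \<omega> \<in> thresholds" if "\<omega> \<in> sample_space U" for m \<omega>
      using pol that by (simp add: randomized_policy_def)
    have \<tau>_meas: "\<tau> (Suc m) \<in> borel_measurable (policy_info U \<tau> m)" for m
      using pol by (simp add: randomized_policy_def)
    define n0 where "n0 = n - w"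
    \<comment> \<open>The window consists of bits \<open>Suc n0\<close> to \<open>n\<close>, all
      later than the change.\<close>
    have n0: "n = n0 + w" "k \<le> n0" using n by (auto simp: n0_def)
    define g where "g v s \<omega> = (if \<omega> \<in> bit_one \<tau> s then sqrt (q v (\<tau> (Suc s) \<omega>) / q \<theta>1 (\<tau> (Suc s) \<omega>))
        else sqrt ((1 - q v (\<tau> (Suc s) \<omega>)) / (1 - q \<theta>1 (\<tau> (Suc s) \<omega>))))" for v s \<omega>
    have g_mean: "(\<integral>\<^sup>+\<omega>. ennreal (\<Prod>s\<in>{n0..<n0 + w}. g v s \<omega>) * indicator A \<omega> \<partial>?P) \<le> ennreal (\<rho> ^ w) * emeasure ?P A"
      if v: "v \<in> N" for v
      unfolding g_def
    proof (rule nn_integral_prod_le)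
      have v': "v \<in> \<Theta>1" "e \<le> \<bar>v - \<theta>1\<bar>" using v N(2) by (auto simp: K_def)
      fix m
      have [measurable]: "\<tau> (Suc m) \<in> borel_measurable (policy_info U \<tau> m)" by (rule \<tau>_meas)
      have [measurable]: "q v \<in> borel_measurable borel" "q \<theta>1 \<in> borel_measurable borel"
        using v' by (auto intro!: borel_measurable_mono q_mono in_\<Theta> \<theta>1_in)
      show "(\<lambda>\<omega>. sqrt (q v (\<tau> (Suc m) \<omega>) / q \<theta>1 (\<tau> (Suc m) \<omega>))) \<in> borel_measurable (policy_info U \<tau> m)"
        "(\<lambda>\<omega>. sqrt ((1 - q v (\<tau> (Suc m) \<omega>)) / (1 - q \<theta>1 (\<tau> (Suc m) \<omega>)))) \<in> borel_measurable (policy_info U \<tau> m)"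
        by measurable
      fix \<omega> assume "\<omega> \<in> space (policy_info U \<tau> 0)"
      then have x: "\<tau> (Suc m) \<omega> \<in> thresholds" using \<tau>_in sp by simp
      note b = q_\<Theta>1_01[OF \<theta>1_in_\<Theta>1 x] q_\<Theta>1_01[OF v'(1) x]
      show "0 \<le> sqrt (q v (\<tau> (Suc m) \<omega>) / q \<theta>1 (\<tau> (Suc m) \<omega>))"
        "0 \<le> sqrt ((1 - q v (\<tau> (Suc m) \<omega>)) / (1 - q \<theta>1 (\<tau> (Suc m) \<omega>)))"
        using b by auto
      assume "n0 \<le> m"
      have sq: "a * sqrt (c / a) = sqrt (a * c)" if "0 < a" "0 < c" for a c :: real
        using that by (simp add: real_sqrt_divide real_sqrt_mult field_simps)
      show "bit_prob (enat k) m \<omega> * sqrt (q v (\<tau> (Suc m) \<omega>) / q \<theta>1 (\<tau> (Suc m) \<omega>)) +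
          (1 - bit_prob (enat k) m \<omega>) * sqrt ((1 - q v (\<tau> (Suc m) \<omega>)) / (1 - q \<theta>1 (\<tau> (Suc m) \<omega>))) \<le> \<rho>"
        using aff[OF v' x] \<open>n0 \<le> m\<close> n0 b sq by (simp add: bit_prob_def affinity_def)
    qed (use \<rho> A n0_def in auto)
    define B where "B = A \<inter> {\<omega> \<in> sample_space U. e \<le> \<bar>f \<omega> - \<theta>1\<bar>}"
    have AP: "A \<in> sets ?P" using A by (rule sets_H_law)
    have [measurable]: "f \<in> borel_measurable ?P" by (rule measurable_H_law[OF f])
    have BP: "B \<in> sets ?P"
    proof -
      have "{\<omega> \<in> space ?P. e \<le> \<bar>f \<omega> - \<theta>1\<bar>} \<in> sets ?P" by measurable
      then show ?thesis using AP unfolding B_def space_sample_law by (rule sets.Int[rotated])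
    qed
    have g_nonneg: "0 \<le> g v s \<omega>" if "v \<in> N" "\<omega> \<in> sample_space U" for v s \<omega>
      using q_\<Theta>1_01[OF \<theta>1_in_\<Theta>1 \<tau>_in[OF that(2), of s]] q_\<Theta>1_01[of v, OF _ \<tau>_in[OF that(2), of s]] that N(2) K(1)
      by (auto simp: g_def)
    have "ennreal (P.prob B) = (\<integral>\<^sup>+\<omega>. indicator B \<omega> \<partial>?P)" using BP by (simp add: P.emeasure_eq_measure)
    also have "\<dots> \<le> (\<integral>\<^sup>+\<omega>. (\<Sum>v\<in>N. ennreal (exp (r / 2) ^ w) * (ennreal (\<Prod>s\<in>{n0..<n0 + w}. g v s \<omega>) * indicator A \<omega>)) \<partial>?P)"
    proof (rule nn_integral_mono)
      fix \<omega> assume "\<omega> \<in> space ?P"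
      then have \<omega>: "\<omega> \<in> sample_space U" by (simp add: space_sample_law)
      show "indicator B \<omega> \<le> (\<Sum>v\<in>N. ennreal (exp (r / 2) ^ w) * (ennreal (\<Prod>s\<in>{n0..<n0 + w}. g v s \<omega>) * indicator A \<omega>))"
      proof (cases "\<omega> \<in> B")
        case True
        note am = mle[OF \<omega>]
        have u: "f \<omega> \<in> K" using am True by (auto simp: is_arg_max_def K_def B_def)
        then obtain v where v: "v \<in> N" and vn: "\<And>x b. x \<in> thresholds \<Longrightarrow>
            ln (one_bit_prob \<X> p b (f \<omega>) x) \<le> ln (one_bit_prob \<X> p b v x) + r" using net by blast
        have v1: "v \<in> \<Theta>1" using v N K by auto
        let ?l = "\<lambda>\<theta> s. ln (one_bit_prob \<X> p (obs_bit \<tau> s \<omega>) \<theta> (\<tau> s \<omega>))"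
        \<comment> \<open>Bits are numbered from 1, whereas \<open>g v s\<close> belongs to bit
          \<open>Suc s\<close>.\<close>
        have idx: "(\<Sum>s=Suc n - w..n. h s) = (\<Sum>s\<in>{n0..<n0 + w}. h (Suc s))" for h :: "nat \<Rightarrow> real"
        proof -
          have "{Suc n - w..n} = {Suc n0..<Suc (n0 + w)}" using n0(1) by auto
          then show ?thesis using sum.shift_bounds_Suc_ivl[of h n0 "n0 + w"] by simp
        qed
        have "(\<Sum>s=Suc n - w..n. ?l \<theta>1 s) \<le> (\<Sum>s=Suc n - w..n. ?l (f \<omega>) s)"
          using am \<theta>1_in_\<Theta>1 by (auto simp: is_arg_max_def not_less)
        then have "(\<Sum>s\<in>{n0..<n0 + w}. ?l \<theta>1 (Suc s)) \<le> (\<Sum>s\<in>{n0..<n0 + w}. ?l (f \<omega>) (Suc s))"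
          by (simp only: idx)
        also have "\<dots> \<le> (\<Sum>s\<in>{n0..<n0 + w}. ?l v (Suc s) + r)"
          by (intro sum_mono vn \<tau>_in \<omega>)
        \<comment> \<open>The estimate fits the window at least as well as \<open>\<theta>1\<close>,
          and its neighbour \<open>v\<close> in the net loses at most \<open>r\<close> per bit.
          Halving the exponents turns likelihood ratios into the factors \<open>g\<close>.\<close>
        finally have "0 \<le> (\<Sum>s\<in>{n0..<n0 + w}. (?l v (Suc s) - ?l \<theta>1 (Suc s) + r) / 2)"
          by (simp add: sum_divide_distrib[symmetric] sum.distrib sum_subtractf)
        then have "1 \<le> exp (\<Sum>s\<in>{n0..<n0 + w}. (?l v (Suc s) - ?l \<theta>1 (Suc s) + r) / 2)" by simp
        also have "\<dots> = (\<Prod>s\<in>{n0..<n0 + w}. exp ((?l v (Suc s) - ?l \<theta>1 (Suc s) + r) / 2))"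
          by (simp add: exp_sum)
        also have "\<dots> = (\<Prod>s\<in>{n0..<n0 + w}. exp (r / 2) * g v s \<omega>)"
        proof (rule prod.cong[OF refl])
          fix s
          have x: "\<tau> (Suc s) \<omega> \<in> thresholds" by (rule \<tau>_in[OF \<omega>])
          note b = q_\<Theta>1_01[OF \<theta>1_in_\<Theta>1 x] q_\<Theta>1_01[OF v1 x]
          have half: "exp ((ln a - ln c + r) / 2) = exp (r / 2) * sqrt (a / c)" if "0 < a" "0 < c" for a c :: real
          proof -
            have "exp ((ln a - ln c) / 2) = sqrt (a / c)"
            proof (rule real_sqrt_unique[symmetric])
              have "(exp ((ln a - ln c) / 2))\<^sup>2 = exp (ln a - ln c)"
                unfolding power2_eq_square exp_add[symmetric] by simp
              then show "(exp ((ln a - ln c) / 2))\<^sup>2 = a / c" using that by (simp add: exp_diff)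
            qed simp
            then show ?thesis by (simp add: add_divide_distrib exp_add mult.commute)
          qed
          show "exp ((?l v (Suc s) - ?l \<theta>1 (Suc s) + r) / 2) = exp (r / 2) * g v s \<omega>"
            using b \<omega> by (cases "obs_bit \<tau> (Suc s) \<omega> = 1") (auto simp: g_def one_bit_prob_neq_1 in_\<Theta>[OF v1] \<theta>1_in half)
        qed
        also have "\<dots> = exp (r / 2) ^ w * (\<Prod>s\<in>{n0..<n0 + w}. g v s \<omega>)"
          by (simp add: prod.distrib)
        finally have one: "1 \<le> exp (r / 2) ^ w * (\<Prod>s\<in>{n0..<n0 + w}. g v s \<omega>)" .
        have "(1 :: ennreal) \<le> ennreal (exp (r / 2) ^ w * (\<Prod>s\<in>{n0..<n0 + w}. g v s \<omega>))"
          using one by (simp add: ennreal_1[symmetric] ennreal_leI del: ennreal_1)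
        also have "\<dots> = ennreal (exp (r / 2) ^ w) * (ennreal (\<Prod>s\<in>{n0..<n0 + w}. g v s \<omega>) * indicator A \<omega>)"
          using True g_nonneg[OF v \<omega>] by (subst ennreal_mult) (auto simp: B_def intro!: prod_nonneg)
        also have "\<dots> \<le> (\<Sum>v\<in>N. ennreal (exp (r / 2) ^ w) * (ennreal (\<Prod>s\<in>{n0..<n0 + w}. g v s \<omega>) * indicator A \<omega>))"
          using v N(1) by (intro member_le_sum) auto
        finally show ?thesis using True by simp
      qed simp
    qed
    also have "\<dots> = (\<Sum>v\<in>N. ennreal (exp (r / 2) ^ w) * (\<integral>\<^sup>+\<omega>. ennreal (\<Prod>s\<in>{n0..<n0 + w}. g v s \<omega>) * indicator A \<omega> \<partial>?P))"
    proof -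
      have gm: "(\<lambda>\<omega>. ennreal (\<Prod>s\<in>{n0..<n0 + w}. g v s \<omega>) * indicator A \<omega>) \<in> borel_measurable ?P" if "v \<in> N" for v
      proof -
        have [measurable]: "q v \<in> borel_measurable borel" "q \<theta>1 \<in> borel_measurable borel"
          using that N(2) K(1) by (auto intro!: borel_measurable_mono q_mono in_\<Theta> \<theta>1_in)
        have [measurable]: "\<tau> (Suc s) \<in> borel_measurable ?P" "bit_one \<tau> s \<in> sets ?P" for s
          using measurable_H_law[OF \<tau>_meas] E_law by auto
        have "(\<lambda>\<omega>. g v s \<omega>) \<in> borel_measurable ?P" for s unfolding g_def by measurable
        then show ?thesis using AP by (intro borel_measurable_times_ennreal measurable_compose[OF _ measurable_ennreal] borel_measurable_prod) auto
      qed
      show ?thesis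
        using gm by (subst nn_integral_sum)
          (auto intro!: sum.cong nn_integral_cmult borel_measurable_times_ennreal[OF borel_measurable_const gm])
    qed
    also have "\<dots> \<le> (\<Sum>v\<in>N. ennreal (exp (r / 2) ^ w) * (ennreal (\<rho> ^ w) * emeasure ?P A))"
      by (intro sum_mono mult_left_mono g_mean) auto
    also have "\<dots> = ennreal (\<alpha> w * P.prob A)"
    proof -
      have "exp (r / 2) ^ w * \<rho> ^ w = exp (- r / 2) ^ w"
        unfolding r(2)[symmetric] by (simp add: power_mult_distrib[symmetric] exp_add[symmetric])
      then have "ennreal (exp (r / 2) ^ w) * (ennreal (\<rho> ^ w) * emeasure ?P A) = ennreal (exp (- r / 2) ^ w * P.prob A)"
        using \<rho> by (simp add: P.emeasure_eq_measure ennreal_mult[symmetric] mult.assoc[symmetric])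
      then show ?thesis
        by (simp add: \<alpha>_def ennreal_of_nat_eq_real_of_nat ennreal_mult[symmetric] mult.assoc)
    qed
    finally have "ennreal (P.prob B) \<le> ennreal (\<alpha> w * P.prob A)" .
    then show "P.prob (A \<inter> {\<omega> \<in> sample_space U. e \<le> \<bar>f \<omega> - \<theta>1\<bar>}) \<le> \<alpha> w * P.prob A"
      by (subst (asm) ennreal_le_iff) (auto simp: B_def \<alpha>_def)
  qed
qed

end

section \<open>Delay bounds\<close>

text \<open>The hypothesis is tested on the set where the conditional expectation exceeds
  \<open>D\<close>. The excess has integral zero there, the common term being finite and hence
  cancellable.\<close>

lemma nn_cond_exp_le_const:
  assumes M: "prob_space M" and F: "subalgebra M F" and f[measurable]: "f \<in> borel_measurable M"
    and le: "\<And>A. A \<in> sets F \<Longrightarrow> (\<integral>\<^sup>+x. f x * indicator A x \<partial>M) \<le> ennreal D * emeasure M A"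
  shows "AE x in M. nn_cond_exp M F f x \<le> ennreal D"
proof -
  interpret prob_space M by fact
  interpret finite_measure_subalgebra M F by unfold_locales fact
  let ?g = "nn_cond_exp M F f"
  define B where "B = {x \<in> space F. ennreal D < ?g x}"
  have BF[measurable]: "B \<in> sets F" unfolding B_def by measurable
  have [measurable]: "B \<in> sets M" using BF F by (auto simp: subalgebra_def)
  have "(\<integral>\<^sup>+x. (?g x - ennreal D) * indicator B x \<partial>M) + ennreal D * emeasure M B
      = (\<integral>\<^sup>+x. (?g x - ennreal D) * indicator B x + ennreal D * indicator B x \<partial>M)"
    by (subst nn_integral_add) (auto simp: nn_integral_cmult_indicator)
  also have "\<dots> = (\<integral>\<^sup>+x. indicator B x * ?g x \<partial>M)"
    by (intro nn_integral_cong) (auto simp: B_def diff_add_cancel_ennreal less_imp_le split: split_indicator)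
  also have "\<dots> = (\<integral>\<^sup>+x. indicator B x * f x \<partial>M)"
    by (rule nn_cond_exp_intg) auto
  also have "\<dots> = (\<integral>\<^sup>+x. f x * indicator B x \<partial>M)" by (simp add: mult.commute)
  also have "\<dots> \<le> ennreal D * emeasure M B" by (rule le[OF BF])
  finally have "ennreal D * emeasure M B + (\<integral>\<^sup>+x. (?g x - ennreal D) * indicator B x \<partial>M) \<le> ennreal D * emeasure M B + 0"
    by (simp add: add.commute)
  then have "(\<integral>\<^sup>+x. (?g x - ennreal D) * indicator B x \<partial>M) = 0"
    unfolding ennreal_add_left_cancel_le by (auto simp: emeasure_eq_measure ennreal_mult_eq_top_iff)
  then have "AE x in M. (?g x - ennreal D) * indicator B x = 0"
    by (subst (asm) nn_integral_0_iff_AE) auto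
  then show ?thesis
  proof (rule AE_mp, intro AE_I2 impI)
    fix x assume x: "x \<in> space M" and 0: "(?g x - ennreal D) * indicator B x = 0"
    show "?g x \<le> ennreal D"
    proof (rule ccontr)
      assume "\<not> ?g x \<le> ennreal D"
      then have "x \<in> B" using x F by (auto simp: B_def subalgebra_def)
      with 0 have "?g x - ennreal D = 0" by simp
      then have "?g x \<le> ennreal D" by (simp add: diff_eq_0_iff_ennreal)
      with \<open>\<not> ?g x \<le> ennreal D\<close> show False by simp
    qed
  qed
qed

lemma space_bit_filtration: "space (bit_filtration U \<tau> n) = sample_space U"
  unfolding bit_filtration_def by (rule space_measure_of) auto

lemma sets_bit_filtration: "sets (bit_filtration U \<tau> n) = sigma_sets (sample_space U)
    {obs_bit \<tau> s -` A \<inter> sample_space U | s A. 1 \<le> s \<and> enat s \<le> n}"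
  unfolding bit_filtration_def by (rule sets_measure_of) auto

lemma bit_filtration_policy_info: "sets (bit_filtration U \<tau> (enat n)) \<subseteq> sets (policy_info U \<tau> n)"
  unfolding sets_bit_filtration sets_policy_info by (rule sigma_sets_mono') auto

lemma bit_filtration_mono: "m \<le> n \<Longrightarrow> sets (bit_filtration U \<tau> m) \<subseteq> sets (bit_filtration U \<tau> n)"
  unfolding sets_bit_filtration by (rule sigma_sets_mono') (force intro: order_trans)

lemma bit_filtration_measurable:
  "f \<in> measurable (bit_filtration U \<tau> (enat n)) N \<Longrightarrow> f \<in> measurable (policy_info U \<tau> n) N"
  using bit_filtration_policy_info[of U \<tau> n]
  by (intro measurable_from_subalg[of "policy_info U \<tau> n"])
     (auto simp: subalgebra_def space_bit_filtration space_policy_info)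

lemma aqute_info_measurable:
  assumes V: "\<And>s. s \<in> {1..w} \<Longrightarrow> V s \<in> borel_measurable U \<and> (\<forall>\<omega>\<in>sample_space U. \<tau> s \<omega> = V s (fst \<omega>))"
    and f: "f \<in> measurable (aqute_info U w \<tau> n) N"
  shows "f \<in> measurable (policy_info U \<tau> n) N"
proof (rule measurable_from_subalg[OF _ f])
  have sp: "space (aqute_info U w \<tau> n) = sample_space U"
    unfolding aqute_info_def by (rule space_measure_of) auto
  have "sets (aqute_info U w \<tau> n) = sigma_sets (sample_space U)
       ({\<tau> s -` A \<inter> sample_space U | s A. s \<in> {1..w} \<and> A \<in> sets borel} \<union>
        {obs_bit \<tau> s -` A \<inter> sample_space U | s A. s \<in> {1..n}})"
    unfolding aqute_info_def by (rule sets_measure_of) auto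
  also have "\<dots> \<subseteq> sets (policy_info U \<tau> n)"
    unfolding space_policy_info[of U \<tau> n, symmetric]
  proof (rule sets.sigma_sets_subset, unfold space_policy_info, intro Un_least subsetI)
    fix a assume "a \<in> {\<tau> s -` A \<inter> sample_space U | s A. s \<in> {1..w} \<and> A \<in> sets borel}"
    then obtain s A where s: "s \<in> {1..w}" "A \<in> sets borel" and a: "a = \<tau> s -` A \<inter> sample_space U" by blast
    have "a = fst -` (V s -` A \<inter> space U) \<inter> sample_space U"
      using V[OF s(1)] by (auto simp: a sample_space_eq)
    moreover have "V s -` A \<inter> space U \<in> sets U" using V[OF s(1)] s(2) by (auto intro: measurable_sets)
    ultimately show "a \<in> sets (policy_info U \<tau> n)" using fst_policy_info by blast
  next
    fix a assume "a \<in> {obs_bit \<tau> s -` A \<inter> sample_space U | s A. s \<in> {1..n}}"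
    then show "a \<in> sets (policy_info U \<tau> n)" by (auto intro: bit_policy_info)
  qed
  finally show "subalgebra (policy_info U \<tau> n) (aqute_info U w \<tau> n)"
    using sp by (simp add: subalgebra_def space_policy_info)
qed

section \<open>Worst-case delay and integrals over events\<close>

context change_detection
begin

lemma delay_measurable:
  assumes "T \<in> measurable (law k) (count_space UNIV)"
  shows "(\<lambda>\<omega>. ennreal_of_enat (T \<omega> - enat k')) \<in> borel_measurable (law k)"
  by (rule measurable_compose[OF assms]) simp

lemma bit_filtration_subalgebra:
  assumes "randomized_policy U \<tau>min \<tau>max \<tau>"
  shows "subalgebra (law l) (bit_filtration U \<tau> (enat k))"
  using bit_filtration_policy_info[of U \<tau> k] policy_info_law[OF assms, of k l]
  by (auto simp: subalgebra_def space_bit_filtration space_sample_law)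

text \<open>The bound is required for events of the larger \<open>policy_info\<close>; those of
  \<open>bit_filtration\<close>, on which the delay is conditioned, are among them.\<close>

lemma WADD_leI:
  assumes pol: "randomized_policy U \<tau>min \<tau>max \<tau>" and T: "\<And>k. T \<in> measurable (law k) (count_space UNIV)"
    and le: "\<And>k A. A \<in> sets (policy_info U \<tau> k) \<Longrightarrow>
      (\<integral>\<^sup>+\<omega>. ennreal_of_enat (T \<omega> - enat k) * indicator A \<omega> \<partial>law (enat k)) \<le> ennreal D * emeasure (law (enat k)) A"
  shows "WADD U \<X> p \<theta>0 \<theta>1 \<tau> T \<le> ennreal D"
  unfolding WADD_def
proof (rule SUP_least, rule esssup_I)
  fix k
  show "nn_cond_exp (law (enat k)) (bit_filtration U \<tau> (enat k)) (\<lambda>\<omega>. ennreal_of_enat (T \<omega> - enat k)) \<in> borel_measurable (law (enat k))"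
    by simp
  show "AE x in law (enat k). nn_cond_exp (law (enat k)) (bit_filtration U \<tau> (enat k))
         (\<lambda>\<omega>. ennreal_of_enat (T \<omega> - enat k)) x \<le> ennreal D"
    using le bit_filtration_policy_info[of U \<tau> k]
    by (intro nn_cond_exp_le_const prob_law bit_filtration_subalgebra pol delay_measurable T) auto
qed

text \<open>The converse direction is available only for events of the bits. Survival qualifies for
  joint procedures, whose time is a stopping time of the bits.\<close>

lemma delay_le_WADD:
  assumes pol: "randomized_policy U \<tau>min \<tau>max \<tau>" and T: "\<And>k. T \<in> measurable (law k) (count_space UNIV)"
    and A: "A \<in> sets (bit_filtration U \<tau> (enat k))"
  shows "(\<integral>\<^sup>+\<omega>. ennreal_of_enat (T \<omega> - enat k) * indicator A \<omega> \<partial>law (enat k))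
    \<le> WADD U \<X> p \<theta>0 \<theta>1 \<tau> T * emeasure (law (enat k)) A"
proof -
  let ?P = "law (enat k)" and ?F = "bit_filtration U \<tau> (enat k)" and ?f = "\<lambda>\<omega>. ennreal_of_enat (T \<omega> - enat k)"
  interpret prob_space ?P by (rule prob_law)
  interpret finite_measure_subalgebra ?P ?F by unfold_locales (rule bit_filtration_subalgebra[OF pol])
  have AP: "A \<in> sets ?P" using A bit_filtration_subalgebra[OF pol, of "enat k" k] by (auto simp: subalgebra_def)
  have "(\<integral>\<^sup>+\<omega>. ?f \<omega> * indicator A \<omega> \<partial>?P) = (\<integral>\<^sup>+\<omega>. indicator A \<omega> * ?f \<omega> \<partial>?P)"
    by (simp add: mult.commute)
  also have "\<dots> = (\<integral>\<^sup>+\<omega>. indicator A \<omega> * nn_cond_exp ?P ?F ?f \<omega> \<partial>?P)"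
    using A by (intro nn_cond_exp_intg[symmetric] delay_measurable T) auto
  also have "\<dots> \<le> (\<integral>\<^sup>+\<omega>. WADD U \<X> p \<theta>0 \<theta>1 \<tau> T * indicator A \<omega> \<partial>?P)"
  proof (rule nn_integral_mono_AE)
    have "esssup ?P (nn_cond_exp ?P ?F ?f) \<le> WADD U \<X> p \<theta>0 \<theta>1 \<tau> T"
      unfolding WADD_def by (rule SUP_upper) simp
    then show "AE \<omega> in ?P. indicator A \<omega> * nn_cond_exp ?P ?F ?f \<omega> \<le> WADD U \<X> p \<theta>0 \<theta>1 \<tau> T * indicator A \<omega>"
      using esssup_AE[where M="?P" and f="nn_cond_exp ?P ?F ?f"] by (auto split: split_indicator elim: order_trans)
  qed
  also have "\<dots> = WADD U \<X> p \<theta>0 \<theta>1 \<tau> T * emeasure ?P A"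
    using AP by (rule nn_integral_cmult_indicator)
  finally show ?thesis .
qed

lemma ARL_eq: "ARL U \<X> p \<theta>0 T = (\<integral>\<^sup>+\<omega>. ennreal_of_enat (T \<omega>) \<partial>law \<infinity>)"
  by (simp add: ARL_def sample_law_def path_law_def)

lemma joint_procedure_policy:
  assumes "joint_procedure U \<tau>min \<tau>max \<tau> T" shows "randomized_policy U \<tau>min \<tau>max \<tau>"
  unfolding randomized_policy_def
proof (intro allI conjI ballI)
  fix n
  have *: "\<tau> (Suc n) \<in> borel_measurable (bit_filtration U \<tau> (enat n))"
    "\<forall>\<omega>\<in>sample_space U. \<tau> (Suc n) \<omega> \<in> thresholds"
    using assms unfolding joint_procedure_def by (metis diff_Suc_1 le_add1 plus_1_eq_Suc)+
  show "\<tau> (Suc n) \<in> borel_measurable (policy_info U \<tau> n)" by (rule bit_filtration_measurable[OF *(1)])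
  show "\<tau> (Suc n) \<omega> \<in> thresholds" if "\<omega> \<in> sample_space U" for \<omega> using *(2) that by blast
qed

text \<open>The free parameter \<open>K\<close> is the ratio of the horizon \<open>m\<close> to the delay \<open>d\<close>.\<close>

lemma horizon:
  fixes K d I :: real
  assumes "1 < K" "0 < d" "0 \<le> I"
  defines "c \<equiv> (I * d + 2) / (1 - 1 / K) - 1" and "m \<equiv> nat \<lceil>K * d\<rceil>"
  shows "0 < m" "real m \<le> K * d + 1" "I * d + 2 \<le> (1 + c) * (1 - d / real m)" "- 1 \<le> c"
proof -
  have Kd: "0 \<le> K * d" using assms by simp
  have m: "K * d \<le> real m" unfolding m_def by (rule of_nat_ceiling)
  have "real m = of_int \<lceil>K * d\<rceil>" using Kd unfolding m_def by simp
  also have "\<dots> \<le> K * d + 1" by (rule of_int_ceiling_le_add_one)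
  finally show "real m \<le> K * d + 1" .
  show "0 < m" using m assms by (metis gr0I mult_pos_pos not_le of_nat_0 order.strict_trans zero_less_one)
  have K: "0 < 1 - 1 / K" using assms by simp
  show "- 1 \<le> c" unfolding c_def using assms K by simp
  have "d / real m \<le> 1 / K" using m \<open>0 < m\<close> assms by (simp add: field_simps)
  then have "(1 + c) * (1 - 1 / K) \<le> (1 + c) * (1 - d / real m)"
    using \<open>- 1 \<le> c\<close> by (intro mult_left_mono) auto
  moreover have "(1 + c) * (1 - 1 / K) = I * d + 2" unfolding c_def using assms(1) by simp
  ultimately show "I * d + 2 \<le> (1 + c) * (1 - d / real m)" by simp
qed

text \<open>The early-alarm bound is applied with changes at all multiples of \<open>m\<close>, each
  time on the event of survival up to that point.\<close>

lemma joint_procedure_bound: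
  assumes joint: "joint_procedure U \<tau>min \<tau>max \<tau> T" and ARL: "ennreal \<gamma> \<le> ARL U \<X> p \<theta>0 T"
    and W: "WADD U \<X> p \<theta>0 \<theta>1 \<tau> T \<le> ennreal d" and d: "0 < d" and K: "1 < K"
  shows "\<gamma> \<le> (K * d + 1) * exp ((KLM * d + 2) / (1 - 1 / K) - 1)"
proof -
  note pol = joint_procedure_policy[OF joint]
  interpret bit_model law "policy_info U \<tau>" "bit_one \<tau>" "\<lambda>n \<omega>. q \<theta>0 (\<tau> (Suc n) \<omega>)" "\<lambda>n \<omega>. q \<theta>1 (\<tau> (Suc n) \<omega>)" \<eta>
    by (rule bit_model[OF pol])
  define c where "c = (KLM * d + 2) / (1 - 1 / K) - 1"
  define m where "m = nat \<lceil>K * d\<rceil>"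
  note h = horizon[OF K d less_imp_le[OF KLM_pos], folded c_def, folded m_def]
  have alive_F: "alive T n \<in> sets (bit_filtration U \<tau> (enat n))" for n
  proof -
    have "Measurable.pred (bit_filtration U \<tau> (enat n)) (\<lambda>x. enat n < T x)"
      using joint by (auto simp: joint_procedure_def intro: stopping_timeD2)
    then show ?thesis by (simp add: pred_def alive_def space_policy_info space_bit_filtration)
  qed
  have T: "adapted_time T"
    unfolding adapted_time_def using alive_F bit_filtration_policy_info by blast
  have Tm: "T \<in> measurable (law k) (count_space UNIV)" for k by (rule adapted_time_measurable[OF T])
  have early: "exp (- c) * measure (law \<infinity>) (alive T (m * j)) \<le> measure (law \<infinity>) (alive T (m * j) - alive T (m * j + m))" for j
  proof (rule early_alarm_prob[OF T _ _ _ _ _ _ h(1,3,4)])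
    show "alive T (m * j) \<in> sets (policy_info U \<tau> (m * j))" using T by (simp add: adapted_time_def)
    show "(\<integral>\<^sup>+\<omega>. ennreal_of_enat (T \<omega> - enat (m * j)) * indicator (alive T (m * j)) \<omega> \<partial>law (enat (m * j)))
        \<le> ennreal d * emeasure (law (enat (m * j))) (alive T (m * j))"
      by (rule order_trans[OF delay_le_WADD[OF pol Tm alive_F]]) (intro mult_right_mono W zero_le)
    show "bit_kl (q \<theta>1 (\<tau> (Suc n) \<omega>)) (q \<theta>0 (\<tau> (Suc n) \<omega>)) \<le> KLM" if "\<omega> \<in> space (policy_info U \<tau> 0)" for n \<omega>
      using that pol by (intro KL_le_KLM) (auto simp: randomized_policy_def space_policy_info)
  qed (use d KLM_pos in auto)
  have "ennreal \<gamma> \<le> ennreal (real m / exp (- c))"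
    by (rule order_trans[OF ARL[unfolded ARL_eq] ARL_le_of_early_alarm[OF T h(1) _ early]]) simp
  then have "\<gamma> \<le> real m / exp (- c)" by (subst (asm) ennreal_le_iff) auto
  also have "\<dots> = real m * exp c" by (simp add: exp_minus field_simps)
  also have "\<dots> \<le> (K * d + 1) * exp c" using h(2) by (intro mult_right_mono) auto
  finally show ?thesis by (simp add: c_def)
qed

end

text \<open>Neither the estimate nor the threshold is required to be a maximizer, so this covers
  AQuTe-CUSUM and also the test for known \<open>\<theta>1\<close> with constant threshold, where
  \<open>w\<close> is 0.\<close>

locale plug_in_cusum = change_detection +
  fixes \<tau> f S :: "nat \<Rightarrow> 'a \<times> (nat \<Rightarrow> real) \<Rightarrow> real" and T :: "'a \<times> (nat \<Rightarrow> real) \<Rightarrow> enat"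
    and w :: nat and \<nu> :: real
  assumes policy: "randomized_policy U \<tau>min \<tau>max \<tau>"
    and f_measurable: "w \<le> n \<Longrightarrow> f n \<in> borel_measurable (policy_info U \<tau> n)"
    and f_in: "w \<le> n \<Longrightarrow> \<omega> \<in> sample_space U \<Longrightarrow> f n \<omega> \<in> \<Theta>1"
    and \<nu>_gt_0: "0 < \<nu>"
    and S_start: "\<omega> \<in> sample_space U \<Longrightarrow> S w \<omega> = 0"
    and S_step: "w \<le> n \<Longrightarrow> \<omega> \<in> sample_space U \<Longrightarrow> S (Suc n) \<omega> = max (S n \<omega>) 0 +
      ln (one_bit_prob \<X> p (obs_bit \<tau> (Suc n) \<omega>) (f n \<omega>) (\<tau> (Suc n) \<omega>) /
          one_bit_prob \<X> p (obs_bit \<tau> (Suc n) \<omega>) \<theta>0 (\<tau> (Suc n) \<omega>))"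
    and T_def': "\<omega> \<in> sample_space U \<Longrightarrow> T \<omega> = Inf {enat t | t. w < t \<and> \<nu> \<le> S t \<omega>}"
begin

lemma threshold_in: "\<omega> \<in> sample_space U \<Longrightarrow> \<tau> (Suc n) \<omega> \<in> thresholds"
  using policy by (simp add: randomized_policy_def)

sublocale cs: bit_cusum law "policy_info U \<tau>" "bit_one \<tau>"
  "\<lambda>n \<omega>. q \<theta>0 (\<tau> (Suc n) \<omega>)" "\<lambda>n \<omega>. q \<theta>1 (\<tau> (Suc n) \<omega>)" \<eta>
  "\<lambda>n \<omega>. ln (q (f n \<omega>) (\<tau> (Suc n) \<omega>) / q \<theta>0 (\<tau> (Suc n) \<omega>))"
  "\<lambda>n \<omega>. ln ((1 - q (f n \<omega>) (\<tau> (Suc n) \<omega>)) / (1 - q \<theta>0 (\<tau> (Suc n) \<omega>)))"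
  S T w \<nu> "- ln \<eta>"
proof (rule bit_cusum.intro[OF bit_model[OF policy]], rule bit_cusum_axioms.intro)
  fix n assume n: "w \<le> n"
  have [measurable]: "\<tau> (Suc n) \<in> borel_measurable (policy_info U \<tau> n)"
    using policy by (simp add: randomized_policy_def)
  have [measurable]: "(\<lambda>\<omega>. q (f n \<omega>) (\<tau> (Suc n) \<omega>)) \<in> borel_measurable (policy_info U \<tau> n)"
    using f_measurable[OF n] f_in[OF n] threshold_in by (intro q_measurable_comp) (auto simp: space_policy_info)
  have [measurable]: "q \<theta>0 \<in> borel_measurable borel" by (intro borel_measurable_mono q_mono \<theta>0_in)
  show "(\<lambda>\<omega>. ln (q (f n \<omega>) (\<tau> (Suc n) \<omega>) / q \<theta>0 (\<tau> (Suc n) \<omega>))) \<in> borel_measurable (policy_info U \<tau> n)"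
    "(\<lambda>\<omega>. ln ((1 - q (f n \<omega>) (\<tau> (Suc n) \<omega>)) / (1 - q \<theta>0 (\<tau> (Suc n) \<omega>)))) \<in> borel_measurable (policy_info U \<tau> n)"
    by measurable
  fix \<omega> assume "\<omega> \<in> space (policy_info U \<tau> 0)"
  then have \<omega>: "\<omega> \<in> sample_space U" by (simp add: space_policy_info)
  note b = q_bounds[OF f_in[OF n \<omega>] threshold_in[OF \<omega>, of n]] q\<theta>0_bounds[OF threshold_in[OF \<omega>, of n]]
  show "\<bar>ln (q (f n \<omega>) (\<tau> (Suc n) \<omega>) / q \<theta>0 (\<tau> (Suc n) \<omega>))\<bar> \<le> - ln \<eta>"
    "\<bar>ln ((1 - q (f n \<omega>) (\<tau> (Suc n) \<omega>)) / (1 - q \<theta>0 (\<tau> (Suc n) \<omega>)))\<bar> \<le> - ln \<eta>"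
    using abs_ln_ratio_le[OF \<eta>_gt_0] b \<eta>_gt_0 by auto
  show "S (Suc n) \<omega> = max (S n \<omega>) 0 + (if \<omega> \<in> bit_one \<tau> n
      then ln (q (f n \<omega>) (\<tau> (Suc n) \<omega>) / q \<theta>0 (\<tau> (Suc n) \<omega>))
      else ln ((1 - q (f n \<omega>) (\<tau> (Suc n) \<omega>)) / (1 - q \<theta>0 (\<tau> (Suc n) \<omega>))))"
    unfolding S_step[OF n \<omega>] using \<omega>
    by (cases "obs_bit \<tau> (Suc n) \<omega> = 1") (auto simp: one_bit_prob_neq_1 in_\<Theta> f_in[OF n \<omega>] \<theta>0_in)
qed (use \<nu>_gt_0 S_start T_def' in \<open>auto simp: space_policy_info\<close>)

lemma unit_mean: "cs.unit_mean"
  unfolding cs.unit_mean_def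
proof (intro allI impI ballI)
  fix n \<omega> assume n: "w \<le> n" and "\<omega> \<in> space (policy_info U \<tau> 0)"
  then have \<omega>: "\<omega> \<in> sample_space U" by (simp add: space_policy_info)
  note b = q_\<Theta>1_01[OF f_in[OF n \<omega>] threshold_in[OF \<omega>, of n]] q_\<theta>0_01[OF threshold_in[OF \<omega>, of n]]
  show "q \<theta>0 (\<tau> (Suc n) \<omega>) * exp (ln (q (f n \<omega>) (\<tau> (Suc n) \<omega>) / q \<theta>0 (\<tau> (Suc n) \<omega>))) +
      (1 - q \<theta>0 (\<tau> (Suc n) \<omega>)) * exp (ln ((1 - q (f n \<omega>) (\<tau> (Suc n) \<omega>)) / (1 - q \<theta>0 (\<tau> (Suc n) \<omega>)))) = 1"
    using b by simp
qed

lemma T_measurable: "T \<in> measurable (law k) (count_space UNIV)"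
  by (rule cs.adapted_time_measurable[OF cs.T_adapted])

lemma ARL_bound: "ennreal (exp \<nu>) \<le> ARL U \<X> p \<theta>0 T"
  unfolding ARL_eq by (rule cs.ARL_ge[OF unit_mean])

lemma WADD_bound:
  assumes bad: "\<And>n. w \<le> n \<Longrightarrow> bad n \<in> sets (policy_info U \<tau> n)"
    and drift: "\<And>n \<omega>. w \<le> n \<Longrightarrow> \<omega> \<in> sample_space U - bad n \<Longrightarrow>
      J \<le> cross_entropy_gain (q \<theta>1 (\<tau> (Suc n) \<omega>)) (q (f n \<omega>) (\<tau> (Suc n) \<omega>)) (q \<theta>0 (\<tau> (Suc n) \<omega>))"
    and bad_prob: "\<And>k n A. k + w \<le> n \<Longrightarrow> A \<in> sets (policy_info U \<tau> (n - w)) \<Longrightarrow>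
      measure (law (enat k)) (A \<inter> bad n) \<le> \<alpha> * measure (law (enat k)) A"
    and J: "0 \<le> J" "0 \<le> \<alpha>" "(J - ln \<eta>) * \<alpha> < J"
  shows "WADD U \<X> p \<theta>0 \<theta>1 \<tau> T
    \<le> ennreal (w + (\<nu> - ln \<eta> + (J - ln \<eta>) * \<alpha> * w) / (J - (J - ln \<eta>) * \<alpha>))"
proof (rule WADD_leI[OF policy T_measurable])
  fix k A assume A: "A \<in> sets (policy_info U \<tau> k)"
  show "(\<integral>\<^sup>+\<omega>. ennreal_of_enat (T \<omega> - enat k) * indicator A \<omega> \<partial>law (enat k))
      \<le> ennreal (w + (\<nu> - ln \<eta> + (J - ln \<eta>) * \<alpha> * w) / (J - (J - ln \<eta>) * \<alpha>)) * emeasure (law (enat k)) A"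
    using cs.delay_le[OF A, of bad J \<alpha>] bad drift bad_prob J
    by (simp add: space_policy_info cross_entropy_gain_def)
qed

lemma WADD_lower:
  assumes W: "WADD U \<X> p \<theta>0 \<theta>1 \<tau> T \<le> ennreal d" and d: "0 < d" and K: "1 < K"
  shows "exp \<nu> \<le> (K * d + 1) * exp ((KLM * d + 2) / (1 - 1 / K) - 1)"
proof -
  define c where "c = (KLM * d + 2) / (1 - 1 / K) - 1"
  define m where "m = nat \<lceil>K * d\<rceil>"
  note h = horizon[OF K d less_imp_le[OF KLM_pos], folded c_def, folded m_def]
  let ?\<Omega> = "sample_space U"
  have top: "?\<Omega> \<in> sets (policy_info U \<tau> 0)" "?\<Omega> \<in> sets (bit_filtration U \<tau> (enat 0))"
    using sets.top[of "policy_info U \<tau> 0"] sets.top[of "bit_filtration U \<tau> (enat 0)"]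
    by (simp_all add: space_policy_info space_bit_filtration)
  have "exp (- c) * measure (law \<infinity>) ?\<Omega> \<le> measure (law \<infinity>) (?\<Omega> - cs.alive T (0 + m))"
  proof (rule cs.early_alarm_prob[OF cs.T_adapted top(1) _ _ _ _ _ h(1,3,4)])
    \<comment> \<open>No alarm is possible at time 0, so the whole space, trivially an event of the
      bits, can serve as the survival event.\<close>
    show "?\<Omega> \<subseteq> cs.alive T 0" using cs.alive_w[of 0] by (simp add: space_policy_info)
    show "(\<integral>\<^sup>+\<omega>. ennreal_of_enat (T \<omega> - enat 0) * indicator ?\<Omega> \<omega> \<partial>law (enat 0)) \<le> ennreal d * emeasure (law (enat 0)) ?\<Omega>"
      by (rule order_trans[OF delay_le_WADD[OF policy T_measurable top(2)]]) (intro mult_right_mono W zero_le)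
    show "bit_kl (q \<theta>1 (\<tau> (Suc n) \<omega>)) (q \<theta>0 (\<tau> (Suc n) \<omega>)) \<le> KLM" if "\<omega> \<in> space (policy_info U \<tau> 0)" for n \<omega>
      using that by (intro KL_le_KLM threshold_in) (simp add: space_policy_info)
  qed (use d KLM_pos in auto)
  also have "\<dots> \<le> real m / exp \<nu>"
    using cs.early_false_alarm[OF unit_mean, of m] by (simp add: space_policy_info)
  also have "measure (law \<infinity>) ?\<Omega> = 1"
    using prob_space.prob_space[OF prob_law, of \<infinity>] by (simp add: space_sample_law)
  finally have "exp \<nu> \<le> real m * exp c" by (simp add: exp_minus field_simps)
  also have "\<dots> \<le> (K * d + 1) * exp c" using h(2) by (intro mult_right_mono) auto
  finally show ?thesis by (simp add: c_def)
qed

end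

section \<open>First-order asymptotics\<close>

text \<open>The remainder \<open>r\<close> is read off through \<open>enn2real\<close>, which is
  faithful because \<open>up\<close> makes \<open>W x\<close> eventually finite. The lower bound is
  a negated inequality, the form that a proof by contradiction delivers.\<close>

lemma ennreal_asymp_equiv:
  fixes W :: "real \<Rightarrow> ennreal" and L :: "real \<Rightarrow> real"
  assumes L: "\<forall>\<^sub>F x in F. 0 < L x"
    and up: "\<And>e. 0 < e \<Longrightarrow> \<forall>\<^sub>F x in F. W x \<le> ennreal ((1 + e) * L x)"
    and low: "\<And>e. 0 < e \<Longrightarrow> e < 1 \<Longrightarrow> \<forall>\<^sub>F x in F. \<not> W x \<le> ennreal ((1 - e) * L x)"
  shows "\<exists>r. (r \<longlongrightarrow> 0) F \<and> (\<forall>\<^sub>F x in F. W x = ennreal (L x * (1 + r x)))"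
proof (intro exI conjI)
  define r where "r x = enn2real (W x) / L x - 1" for x
  have fin: "W x = ennreal (enn2real (W x))" if "W x \<le> ennreal y" for x y
    using that by (intro ennreal_enn2real[symmetric]) (auto simp: less_top[symmetric] top_unique)
  show "(r \<longlongrightarrow> 0) F"
  proof (rule tendstoI)
    fix e :: real assume e: "0 < e"
    define e' where "e' = min (e / 2) (1 / 2)"
    have e': "0 < e'" "e' < 1" "e' < e" using e by (auto simp: e'_def)
    from L up[OF e'(1)] low[OF e'(1,2)] show "\<forall>\<^sub>F x in F. dist (r x) 0 < e"
    proof eventually_elim
      case (elim x)
      define y where "y = enn2real (W x)"
      have W: "W x = ennreal y" "0 \<le> y" using fin[OF elim(2)] by (auto simp: y_def)
      have "y \<le> (1 + e') * L x" using elim(1,2) e' W by (simp add: ennreal_le_iff)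
      moreover have "(1 - e') * L x < y" using elim(3) e' W elim(1) by (simp add: ennreal_le_iff not_le)
      ultimately have "y / L x \<le> 1 + e'" "1 - e' < y / L x" using elim(1) by (auto simp: field_simps)
      then show ?case using e' by (simp add: r_def y_def dist_real_def abs_less_iff)
    qed
  qed
  from L up[of 1, simplified] show "\<forall>\<^sub>F x in F. W x = ennreal (L x * (1 + r x))"
  proof eventually_elim
    case (elim x)
    then show ?case using fin[OF elim(2)] by (simp add: r_def)
  qed
qed

text \<open>The ratio \<open>2 / e\<close> turns \<open>1 - 1 / K\<close> into
  \<open>1 - e / 2\<close>, so the right side is logarithmic in \<open>\<gamma>\<close> times a
  power with exponent \<open>s = (1 - e) / (1 - e / 2) < 1\<close>, and eventually falls below
  \<open>\<gamma>\<close>.\<close>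

lemma lower_bound_asymp:
  fixes I e :: real
  assumes I: "0 < I" and e: "0 < e" "e < 1"
  shows "\<forall>\<^sub>F \<gamma> in at_top. \<not> \<gamma> \<le> (2 / e * ((1 - e) * (ln \<gamma> / I)) + 1) *
    exp ((I * ((1 - e) * (ln \<gamma> / I)) + 2) / (1 - 1 / (2 / e)) - 1)"
proof -
  define A where "A = 2 / e * (1 - e) / I"
  define s where "s = (1 - e) / (1 - e / 2)"
  define B where "B = 2 / (1 - e / 2) - 1"
  have A: "0 < A" using I e by (simp add: A_def)
  have s: "0 < s" "s < 1" using e by (auto simp: s_def field_simps)
  have "filterlim (\<lambda>x. (1 - s) * x - ln (A * x + 1) - B) at_top at_top"
    using A s by real_asymp
  then have "\<forall>\<^sub>F x in at_top. 0 < (1 - s) * x - ln (A * x + 1) - B"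
    unfolding filterlim_at_top_dense by (rule spec)
  then have "\<forall>\<^sub>F \<gamma> in at_top. 0 < (1 - s) * ln \<gamma> - ln (A * ln \<gamma> + 1) - B"
    by (rule eventually_compose_filterlim[OF _ ln_at_top])
  moreover have "\<forall>\<^sub>F \<gamma> in at_top. (1::real) < \<gamma>" by (rule eventually_gt_at_top)
  ultimately show ?thesis
  proof eventually_elim
    case (elim \<gamma>)
    have pos: "0 < A * ln \<gamma> + 1" using elim(2) A by (intro add_pos_pos mult_pos_pos) auto
    have eq: "2 / e * ((1 - e) * (ln \<gamma> / I)) + 1 = A * ln \<gamma> + 1"
      by (simp add: A_def)
    have "I * ((1 - e) * (ln \<gamma> / I)) = (1 - e) * ln \<gamma>" using I by simp
    then have eq2: "(I * ((1 - e) * (ln \<gamma> / I)) + 2) / (1 - 1 / (2 / e)) - 1 = s * ln \<gamma> + B"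
      by (simp add: s_def B_def add_divide_distrib)
    have "ln ((A * ln \<gamma> + 1) * exp (s * ln \<gamma> + B)) = ln (A * ln \<gamma> + 1) + (s * ln \<gamma> + B)"
      using pos by (subst ln_mult_pos) auto
    also have "\<dots> < ln \<gamma>" using elim(1) by (simp add: algebra_simps)
    finally have "(A * ln \<gamma> + 1) * exp (s * ln \<gamma> + B) < \<gamma>"
      using pos elim(2) by (subst (asm) ln_less_cancel_iff) auto
    then show ?case unfolding eq eq2 by simp
  qed
qed

section \<open>The optimal delay and the delay of AQuTe-CUSUM\<close>

context change_detection
begin

text \<open>AQuTe-CUSUM itself need not be a joint procedure, because of its random initialization. The
  infimum over joint procedures is bounded instead by the CUSUM test for known \<open>\<theta>1\<close> with the
  constant optimal threshold.\<close>

definition cusum_step :: "('a \<times> (nat \<Rightarrow> real) \<Rightarrow> int) \<Rightarrow> 'a \<times> (nat \<Rightarrow> real) \<Rightarrow> real" where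
  "cusum_step B \<omega> = ln (one_bit_prob \<X> p (B \<omega>) \<theta>1 best / one_bit_prob \<X> p (B \<omega>) \<theta>0 best)"

primrec oracle_cusum :: "nat \<Rightarrow> 'a \<times> (nat \<Rightarrow> real) \<Rightarrow> real" where
  "oracle_cusum 0 \<omega> = 0"
| "oracle_cusum (Suc n) \<omega> = max (oracle_cusum n \<omega>) 0 + cusum_step (obs_bit (\<lambda>_ _. best) (Suc n)) \<omega>"

definition oracle_time :: "real \<Rightarrow> 'a \<times> (nat \<Rightarrow> real) \<Rightarrow> enat" where
  "oracle_time \<nu> \<omega> = Inf {enat t | t. 0 < t \<and> \<nu> \<le> oracle_cusum t \<omega>}"

lemma oracle_plug_in:
  assumes "0 < \<nu>"
  shows "plug_in_cusum U \<X> \<Theta> p \<theta>0 \<theta>1 \<Theta>1 \<tau>min \<tau>max (\<lambda>_ _. best) (\<lambda>_ _. \<theta>1) oracle_cusum (oracle_time \<nu>) 0 \<nu>"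
  by unfold_locales
    (use best(1) \<theta>1_in_\<Theta>1 assms in \<open>auto simp: randomized_policy_def cusum_step_def oracle_time_def\<close>)

text \<open>A joint procedure must stop by the bits alone, whereas the general CUSUM lemmas only
  give measurability with the seed included.\<close>

lemma oracle_cusum_measurable:
  "oracle_cusum n \<in> borel_measurable (bit_filtration U (\<lambda>_ _. best) (enat n))"
proof (induction n)
  case 0
  show ?case by (simp add: oracle_cusum.simps[abs_def])
next
  case (Suc n)
  let ?\<tau> = "\<lambda>_ _. best" and ?F = "bit_filtration U (\<lambda>_ _. best) (enat (Suc n))"
  have [measurable]: "oracle_cusum n \<in> borel_measurable ?F"
    using bit_filtration_mono[of "enat n" "enat (Suc n)" U ?\<tau>]
    by (intro measurable_from_subalg[OF _ Suc.IH]) (auto simp: subalgebra_def space_bit_filtration)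
  have b: "obs_bit ?\<tau> (Suc n) \<in> measurable ?F (count_space UNIV)"
  proof (rule measurableI)
    show "obs_bit ?\<tau> (Suc n) -` A \<inter> space ?F \<in> sets ?F" for A
      unfolding space_bit_filtration sets_bit_filtration by (rule sigma_sets.Basic) auto
  qed simp
  have [measurable]: "cusum_step (obs_bit ?\<tau> (Suc n)) \<in> borel_measurable ?F"
    unfolding cusum_step_def[abs_def] by (rule measurable_compose[OF b]) simp
  show ?case unfolding oracle_cusum.simps[abs_def] by measurable
qed

lemma oracle_joint:
  assumes "0 < \<nu>" shows "joint_procedure U \<tau>min \<tau>max (\<lambda>_ _. best) (oracle_time \<nu>)"
proof -
  interpret plug_in_cusum U \<X> \<Theta> p \<theta>0 \<theta>1 \<Theta>1 \<tau>min \<tau>max "\<lambda>_ _. best" "\<lambda>_ _. \<theta>1" oracle_cusum "oracle_time \<nu>" 0 \<nu>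
    by (rule oracle_plug_in[OF assms])
  let ?F = "bit_filtration U (\<lambda>_ _. best)"
  have "stopping_time ?F (oracle_time \<nu>)"
  proof (rule stopping_timeI)
    fix t :: enat
    show "Measurable.pred (?F t) (\<lambda>\<omega>. oracle_time \<nu> \<omega> \<le> t)"
    proof (cases t)
      case (enat n)
      have "{\<omega> \<in> space (?F (enat n)). oracle_cusum i \<omega> < \<nu>} \<in> sets (?F (enat n))" if "i \<in> {0<..n}" for i
      proof -
        have [measurable]: "oracle_cusum i \<in> borel_measurable (?F (enat n))"
          using bit_filtration_mono[of "enat i" "enat n" U "\<lambda>_ _. best"] that
          by (intro measurable_from_subalg[OF _ oracle_cusum_measurable]) (auto simp: subalgebra_def space_bit_filtration)
        show ?thesis by measurable
      qed
      then have "{\<omega> \<in> space (?F (enat n)). \<forall>i\<in>{0<..n}. oracle_cusum i \<omega> < \<nu>} \<in> sets (?F (enat n))"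
        by (intro sets.sets_Collect_finite_All) auto
      then have "{\<omega> \<in> space (?F (enat n)). enat n < oracle_time \<nu> \<omega>} \<in> sets (?F (enat n))"
        using cs.less_T_iff[of _ n] by (simp add: space_bit_filtration space_policy_info cong: conj_cong)
      then have "Measurable.pred (?F (enat n)) (\<lambda>\<omega>. enat n < oracle_time \<nu> \<omega>)" by (simp add: pred_def)
      then have "Measurable.pred (?F (enat n)) (\<lambda>\<omega>. \<not> enat n < oracle_time \<nu> \<omega>)" by (rule pred_intros_logic)
      then show ?thesis by (simp add: enat not_less)
    qed simp
  qed
  then show ?thesis using best(1) by (simp add: joint_procedure_def)
qed

lemma optimal_WADD_upper:
  assumes "0 < e"
  shows "\<forall>\<^sub>F \<gamma> in at_top. optimal_WADD U \<X> p \<theta>0 \<theta>1 \<tau>min \<tau>max \<gamma> \<le> ennreal ((1 + e) * (ln \<gamma> / KLM))"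
proof -
  have "filterlim (\<lambda>x. e * x) at_top at_top"
    using assms by real_asymp
  then have "\<forall>\<^sub>F x in at_top. - ln \<eta> \<le> e * x" by (simp add: filterlim_at_top)
  then have "\<forall>\<^sub>F \<gamma> in at_top. - ln \<eta> \<le> e * ln \<gamma>" by (rule eventually_compose_filterlim[OF _ ln_at_top])
  moreover have "\<forall>\<^sub>F \<gamma> in at_top. (1::real) < \<gamma>" by (rule eventually_gt_at_top)
  ultimately show ?thesis
  proof eventually_elim
    case (elim \<gamma>)
    have \<nu>: "0 < ln \<gamma>" using elim(2) by simp
    interpret plug_in_cusum U \<X> \<Theta> p \<theta>0 \<theta>1 \<Theta>1 \<tau>min \<tau>max "\<lambda>_ _. best" "\<lambda>_ _. \<theta>1" oracle_cusum "oracle_time (ln \<gamma>)" 0 "ln \<gamma>"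
      by (rule oracle_plug_in[OF \<nu>])
    have "optimal_WADD U \<X> p \<theta>0 \<theta>1 \<tau>min \<tau>max \<gamma> \<le> WADD U \<X> p \<theta>0 \<theta>1 (\<lambda>_ _. best) (oracle_time (ln \<gamma>))"
      unfolding optimal_WADD_def using oracle_joint[OF \<nu>] ARL_bound elim(2)
      by (intro INF_lower2[of "(\<lambda>_ _. best, oracle_time (ln \<gamma>))"]) auto
    \<comment> \<open>With known \<open>\<theta>1\<close> there are no bad events, the drift is
      exactly \<open>KLM\<close> and the window is empty; only the overshoot
      \<open>- ln \<eta>\<close> remains.\<close>
    also have "\<dots> \<le> ennreal (real 0 + (ln \<gamma> - ln \<eta> + (KLM - ln \<eta>) * 0 * real 0) / (KLM - (KLM - ln \<eta>) * 0))"
      using KLM_pos by (intro WADD_bound[of "\<lambda>_. {}"]) (auto simp: KLM_eq bit_kl_eq_gain)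
    also have "\<dots> \<le> ennreal ((1 + e) * (ln \<gamma> / KLM))"
    proof (rule ennreal_leI)
      have "(ln \<gamma> - ln \<eta>) / KLM \<le> ((1 + e) * ln \<gamma>) / KLM"
        using elim(1) KLM_pos by (intro divide_right_mono) (auto simp: algebra_simps)
      then show "real 0 + (ln \<gamma> - ln \<eta> + (KLM - ln \<eta>) * 0 * real 0) / (KLM - (KLM - ln \<eta>) * 0)
          \<le> (1 + e) * (ln \<gamma> / KLM)" by simp
    qed
    finally show ?case .
  qed
qed

lemma optimal_WADD_lower:
  assumes "0 < e" "e < 1"
  shows "\<forall>\<^sub>F \<gamma> in at_top. \<not> optimal_WADD U \<X> p \<theta>0 \<theta>1 \<tau>min \<tau>max \<gamma> \<le> ennreal ((1 - e) * (ln \<gamma> / KLM))"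
proof -
  \<comment> \<open>The infimum need not be attained. The gap between \<open>e'\<close> and
    \<open>e\<close> yields a procedure strictly below the level for \<open>e'\<close>.\<close>
  define e' where "e' = e / 2"
  have e': "0 < e'" "e' < e" "e' < 1" using assms by (auto simp: e'_def)
  from lower_bound_asymp[OF KLM_pos e'(1,3)] eventually_gt_at_top[of "1::real"]
  show ?thesis
  proof eventually_elim
    case (elim \<gamma>)
    have L: "0 < ln \<gamma> / KLM" using elim(2) KLM_pos by simp
    let ?d = "(1 - e') * (ln \<gamma> / KLM)"
    show ?case
    proof
      assume "optimal_WADD U \<X> p \<theta>0 \<theta>1 \<tau>min \<tau>max \<gamma> \<le> ennreal ((1 - e) * (ln \<gamma> / KLM))"
      also have "\<dots> < ennreal ?d" using L e' assms by (intro ennreal_lessI mult_pos_pos mult_strict_right_mono) auto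
      finally obtain \<tau> T where *: "joint_procedure U \<tau>min \<tau>max \<tau> T" "ennreal \<gamma> \<le> ARL U \<X> p \<theta>0 T"
        and "WADD U \<X> p \<theta>0 \<theta>1 \<tau> T < ennreal ?d"
        unfolding optimal_WADD_def by (auto simp: INF_less_iff)
      then have "\<gamma> \<le> (2 / e' * ?d + 1) * exp ((KLM * ?d + 2) / (1 - 1 / (2 / e')) - 1)"
        using e' L by (intro joint_procedure_bound[OF *] mult_pos_pos) auto
      with elim(1) show False by simp
    qed
  qed
qed

lemma aqute_plug_in:
  assumes aq: "aqute_cusum U \<X> p \<theta>0 \<Theta>1 \<tau>min \<tau>max w \<nu> \<tau> \<theta>h S T" and \<nu>: "0 < \<nu>"
  shows "plug_in_cusum U \<X> \<Theta> p \<theta>0 \<theta>1 \<Theta>1 \<tau>min \<tau>max \<tau> \<theta>h S T w \<nu>"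
    and "\<And>n \<omega>. w \<le> n \<Longrightarrow> \<omega> \<in> sample_space U \<Longrightarrow>
      is_arg_max (\<lambda>\<theta>. \<Sum>s=Suc n - w..n. ln (one_bit_prob \<X> p (obs_bit \<tau> s \<omega>) \<theta> (\<tau> s \<omega>))) (\<lambda>\<theta>. \<theta> \<in> \<Theta>1) (\<theta>h n \<omega>)"
    and "\<And>n \<omega>. w \<le> n \<Longrightarrow> \<omega> \<in> sample_space U \<Longrightarrow>
      is_arg_max (one_bit_KL \<X> p \<theta>0 (\<theta>h n \<omega>)) (\<lambda>x. x \<in> thresholds) (\<tau> (Suc n) \<omega>)"
proof -
  have w: "1 \<le> w" and init: "\<forall>t\<in>{1..w}. (\<exists>V\<in>borel_measurable U. (\<forall>u\<in>space U. V u \<in> thresholds) \<and>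
                     (\<forall>\<omega>\<in>sample_space U. \<tau> t \<omega> = V (fst \<omega>))) \<and> (\<forall>\<omega>\<in>sample_space U. S t \<omega> = 0)"
    and T: "\<forall>\<omega>\<in>sample_space U. T \<omega> = Inf {enat t | t. w < t \<and> \<nu> \<le> S t \<omega>}"
    using aq unfolding aqute_cusum_def by blast+
  have later: "\<theta>h n \<in> borel_measurable (aqute_info U w \<tau> n) \<and> \<tau> (Suc n) \<in> borel_measurable (aqute_info U w \<tau> n) \<and>
            (\<forall>\<omega>\<in>sample_space U.
               is_arg_max (\<lambda>\<theta>. \<Sum>s=Suc n-w..n. ln (one_bit_prob \<X> p (obs_bit \<tau> s \<omega>) \<theta> (\<tau> s \<omega>)))
                 (\<lambda>\<theta>. \<theta> \<in> \<Theta>1) (\<theta>h n \<omega>) \<and>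
               is_arg_max (one_bit_KL \<X> p \<theta>0 (\<theta>h n \<omega>)) (\<lambda>x. x \<in> thresholds) (\<tau> (Suc n) \<omega>) \<and>
               S (Suc n) \<omega> = max (S n \<omega>) 0 +
                 ln (one_bit_prob \<X> p (obs_bit \<tau> (Suc n) \<omega>) (\<theta>h n \<omega>) (\<tau> (Suc n) \<omega>) /
                     one_bit_prob \<X> p (obs_bit \<tau> (Suc n) \<omega>) \<theta>0 (\<tau> (Suc n) \<omega>)))" if "w \<le> n" for n
  proof -
    have "w < Suc n" using that by simp
    from aq[unfolded aqute_cusum_def, THEN conjunct2, THEN conjunct2, THEN conjunct1, THEN spec, THEN mp, OF this]
    show ?thesis unfolding diff_Suc_1 .
  qed
  show mle: "\<And>n \<omega>. w \<le> n \<Longrightarrow> \<omega> \<in> sample_space U \<Longrightarrow>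
      is_arg_max (\<lambda>\<theta>. \<Sum>s=Suc n - w..n. ln (one_bit_prob \<X> p (obs_bit \<tau> s \<omega>) \<theta> (\<tau> s \<omega>))) (\<lambda>\<theta>. \<theta> \<in> \<Theta>1) (\<theta>h n \<omega>)"
    and am: "\<And>n \<omega>. w \<le> n \<Longrightarrow> \<omega> \<in> sample_space U \<Longrightarrow>
      is_arg_max (one_bit_KL \<X> p \<theta>0 (\<theta>h n \<omega>)) (\<lambda>x. x \<in> thresholds) (\<tau> (Suc n) \<omega>)"
    using later by blast+
  from init have "\<forall>s\<in>{1..w}. \<exists>V. V \<in> borel_measurable U \<and> (\<forall>u\<in>space U. V u \<in> thresholds) \<and>
      (\<forall>\<omega>\<in>sample_space U. \<tau> s \<omega> = V (fst \<omega>))" by blast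
  then obtain V where V: "\<And>s. s \<in> {1..w} \<Longrightarrow> V s \<in> borel_measurable U \<and> (\<forall>u\<in>space U. V s u \<in> thresholds) \<and>
      (\<forall>\<omega>\<in>sample_space U. \<tau> s \<omega> = V s (fst \<omega>))" by metis
  have lift: "g \<in> measurable (policy_info U \<tau> n) N" if "g \<in> measurable (aqute_info U w \<tau> n) N" for g n N
    using V by (intro aqute_info_measurable[where V = V, OF _ that]) blast
  have pol: "randomized_policy U \<tau>min \<tau>max \<tau>"
    unfolding randomized_policy_def
  proof (intro allI conjI ballI)
    fix n
    show "\<tau> (Suc n) \<in> borel_measurable (policy_info U \<tau> n)"
    proof (cases "w \<le> n")
      case True
      then show ?thesis using later lift by blast
    next
      case False
      then have s: "Suc n \<in> {1..w}" by simp
      have "(\<lambda>\<omega>. V (Suc n) (fst \<omega>)) \<in> borel_measurable (policy_info U \<tau> n)"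
      proof (rule measurable_compose[of fst])
        show "fst \<in> measurable (policy_info U \<tau> n) U"
          using fst_policy_info[of _ U \<tau> n] by (intro measurableI) (auto simp: space_policy_info sample_space_eq)
      qed (use V[OF s] in blast)
      then show ?thesis
        by (rule measurable_cong[THEN iffD1, rotated]) (use V[OF s] in \<open>auto simp: space_policy_info\<close>)
    qed
    show "\<tau> (Suc n) \<omega> \<in> thresholds" if "\<omega> \<in> sample_space U" for \<omega>
    proof (cases "w \<le> n")
      case True
      then show ?thesis using am[OF True that] by (auto simp: is_arg_max_def)
    next
      case False
      then have s: "Suc n \<in> {1..w}" by simp
      moreover have "fst \<omega> \<in> space U" using that by (auto simp: sample_space_eq)
      ultimately show ?thesis using V[OF s] that by simp
    qed
  qed
  show "plug_in_cusum U \<X> \<Theta> p \<theta>0 \<theta>1 \<Theta>1 \<tau>min \<tau>max \<tau> \<theta>h S T w \<nu>"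
  proof (rule plug_in_cusum.intro[OF change_detection_axioms], rule plug_in_cusum_axioms.intro)
    show "\<theta>h n \<in> borel_measurable (policy_info U \<tau> n)" if "w \<le> n" for n using later[OF that] lift by blast
    show "\<theta>h n \<omega> \<in> \<Theta>1" if "w \<le> n" "\<omega> \<in> sample_space U" for n \<omega>
      using mle[OF that] by (simp add: is_arg_max_def)
    show "S w \<omega> = 0" if "\<omega> \<in> sample_space U" for \<omega> using init w that by auto
  qed (use pol \<nu> later T in blast)+
qed

lemma aqute_WADD_lower:
  assumes aq: "\<forall>\<^sub>F \<gamma> in at_top.
      aqute_cusum U \<X> p \<theta>0 \<Theta>1 \<tau>min \<tau>max (w \<gamma>) (ln \<gamma>) (\<tau> \<gamma>) (\<theta>h \<gamma>) (S \<gamma>) (T \<gamma>)"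
    and e: "0 < e" "e < 1"
  shows "\<forall>\<^sub>F \<gamma> in at_top. \<not> WADD U \<X> p \<theta>0 \<theta>1 (\<tau> \<gamma>) (T \<gamma>) \<le> ennreal ((1 - e) * (ln \<gamma> / KLM))"
  using lower_bound_asymp[OF KLM_pos e] eventually_gt_at_top[of "1::real"] aq
proof eventually_elim
  case (elim \<gamma>)
  have \<nu>: "0 < ln \<gamma>" using elim(2) by simp
  interpret plug_in_cusum U \<X> \<Theta> p \<theta>0 \<theta>1 \<Theta>1 \<tau>min \<tau>max "\<tau> \<gamma>" "\<theta>h \<gamma>" "S \<gamma>" "T \<gamma>" "w \<gamma>" "ln \<gamma>"
    by (rule aqute_plug_in(1)[OF elim(3) \<nu>])
  show ?case
  proof
    assume "WADD U \<X> p \<theta>0 \<theta>1 (\<tau> \<gamma>) (T \<gamma>) \<le> ennreal ((1 - e) * (ln \<gamma> / KLM))"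
    from WADD_lower[OF this, of "2 / e"] elim(1,2) e KLM_pos \<nu> show False by simp
  qed
qed

lemma aqute_WADD_upper:
  assumes aq: "\<forall>\<^sub>F \<gamma> in at_top.
      aqute_cusum U \<X> p \<theta>0 \<Theta>1 \<tau>min \<tau>max (w \<gamma>) (ln \<gamma>) (\<tau> \<gamma>) (\<theta>h \<gamma>) (S \<gamma>) (T \<gamma>)"
    and w: "filterlim w at_top at_top" and wo: "(\<lambda>\<gamma>. real (w \<gamma>)) \<in> o[at_top](ln)"
    and e: "0 < e"
  shows "\<forall>\<^sub>F \<gamma> in at_top. WADD U \<X> p \<theta>0 \<theta>1 (\<tau> \<gamma>) (T \<gamma>) \<le> ennreal ((1 + e) * (ln \<gamma> / KLM))"
proof -
  \<comment> \<open>Since \<open>1 / J = (1 + e / 2) / KLM\<close>, half of the allowance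
    \<open>e\<close> is left for the vanishing terms.\<close>
  define J where "J = KLM / (1 + e / 2)"
  have J: "0 < J" "J < KLM" using KLM_pos e by (auto simp: J_def field_simps)
  obtain d where d: "0 < d" and drift: "\<And>\<theta> x. \<theta> \<in> \<Theta>1 \<Longrightarrow> \<bar>\<theta> - \<theta>1\<bar> < d \<Longrightarrow>
      is_arg_max (one_bit_KL \<X> p \<theta>0 \<theta>) (\<lambda>x. x \<in> thresholds) x \<Longrightarrow>
      J \<le> cross_entropy_gain (q \<theta>1 x) (q \<theta> x) (q \<theta>0 x)"
    using plug_in_drift[of "KLM - J"] J by auto
  obtain \<alpha> :: "nat \<Rightarrow> real" where \<alpha>: "\<alpha> \<longlonglongrightarrow> 0" "\<And>w. 0 \<le> \<alpha> w" and consistent: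
    "\<And>\<tau> k n w f A. randomized_policy U \<tau>min \<tau>max \<tau> \<Longrightarrow> k + w \<le> n \<Longrightarrow>
      f \<in> borel_measurable (policy_info U \<tau> n) \<Longrightarrow>
      (\<And>\<omega>. \<omega> \<in> sample_space U \<Longrightarrow>
         is_arg_max (\<lambda>\<theta>. \<Sum>s=Suc n - w..n. ln (one_bit_prob \<X> p (obs_bit \<tau> s \<omega>) \<theta> (\<tau> s \<omega>))) (\<lambda>\<theta>. \<theta> \<in> \<Theta>1) (f \<omega>)) \<Longrightarrow>
      A \<in> sets (policy_info U \<tau> (n - w)) \<Longrightarrow>
      measure (law (enat k)) (A \<inter> {\<omega> \<in> sample_space U. d \<le> \<bar>f \<omega> - \<theta>1\<bar>}) \<le> \<alpha> w * measure (law (enat k)) A"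
    using estimate_consistent[OF d] by blast
  define C where "C = J - ln \<eta>"
  have \<alpha>w: "((\<lambda>\<gamma>. \<alpha> (w \<gamma>)) \<longlongrightarrow> 0) at_top" by (rule filterlim_compose[OF \<alpha>(1) w])
  have wl: "((\<lambda>\<gamma>. real (w \<gamma>) / ln \<gamma>) \<longlongrightarrow> 0) at_top" by (rule smalloD_tendsto[OF wo])
  have cl: "((\<lambda>\<gamma>. - ln \<eta> / ln \<gamma>) \<longlongrightarrow> 0) at_top"
    by (intro tendsto_divide_0[OF tendsto_const] filterlim_at_top_imp_at_infinity ln_at_top)
  \<comment> \<open>This is the delay bound divided by \<open>ln \<gamma>\<close>. Both growth
    conditions enter: \<open>w = o(ln)\<close> removes the window terms, and \<open>w\<close>
    tending to infinity removes the error probability \<open>\<alpha>\<close>.\<close>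
  have "((\<lambda>\<gamma>. real (w \<gamma>) / ln \<gamma> + (1 + - ln \<eta> / ln \<gamma> + C * \<alpha> (w \<gamma>) * (real (w \<gamma>) / ln \<gamma>)) / (J - C * \<alpha> (w \<gamma>)))
      \<longlongrightarrow> 0 + (1 + 0 + C * 0 * 0) / (J - C * 0)) at_top"
    using J by (intro tendsto_intros \<alpha>w wl cl) auto
  moreover have "0 + (1 + 0 + C * 0 * 0) / (J - C * 0) < (1 + e) / KLM"
    using KLM_pos e by (simp add: J_def field_simps)
  ultimately have ev1: "\<forall>\<^sub>F \<gamma> in at_top. real (w \<gamma>) / ln \<gamma> + (1 + - ln \<eta> / ln \<gamma> + C * \<alpha> (w \<gamma>) * (real (w \<gamma>) / ln \<gamma>)) / (J - C * \<alpha> (w \<gamma>)) < (1 + e) / KLM"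
    by (rule order_tendstoD(2))
  have "((\<lambda>\<gamma>. C * \<alpha> (w \<gamma>)) \<longlongrightarrow> C * 0) at_top" by (intro tendsto_intros \<alpha>w)
  then have ev2: "\<forall>\<^sub>F \<gamma> in at_top. C * \<alpha> (w \<gamma>) < J" using J by (intro order_tendstoD(2)) auto
  from ev1 ev2 eventually_gt_at_top[of "1::real"] aq show ?thesis
  proof eventually_elim
    case (elim \<gamma>)
    have \<nu>: "0 < ln \<gamma>" using elim(3) by simp
    interpret plug_in_cusum U \<X> \<Theta> p \<theta>0 \<theta>1 \<Theta>1 \<tau>min \<tau>max "\<tau> \<gamma>" "\<theta>h \<gamma>" "S \<gamma>" "T \<gamma>" "w \<gamma>" "ln \<gamma>"
      by (rule aqute_plug_in(1)[OF elim(4) \<nu>])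
    let ?bad = "\<lambda>n. {\<omega> \<in> sample_space U. d \<le> \<bar>\<theta>h \<gamma> n \<omega> - \<theta>1\<bar>}"
    have "WADD U \<X> p \<theta>0 \<theta>1 (\<tau> \<gamma>) (T \<gamma>) \<le> ennreal (real (w \<gamma>) +
        (ln \<gamma> - ln \<eta> + (J - ln \<eta>) * \<alpha> (w \<gamma>) * real (w \<gamma>)) / (J - (J - ln \<eta>) * \<alpha> (w \<gamma>)))"
    proof (rule WADD_bound[of ?bad])
      fix n assume n: "w \<gamma> \<le> n"
      note [measurable] = f_measurable[OF n]
      have "{\<omega> \<in> space (policy_info U (\<tau> \<gamma>) n). d \<le> \<bar>\<theta>h \<gamma> n \<omega> - \<theta>1\<bar>} \<in> sets (policy_info U (\<tau> \<gamma>) n)" by measurable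
      then show "?bad n \<in> sets (policy_info U (\<tau> \<gamma>) n)" by (simp add: space_policy_info)
      show "J \<le> cross_entropy_gain (q \<theta>1 (\<tau> \<gamma> (Suc n) \<omega>)) (q (\<theta>h \<gamma> n \<omega>) (\<tau> \<gamma> (Suc n) \<omega>)) (q \<theta>0 (\<tau> \<gamma> (Suc n) \<omega>))"
        if "\<omega> \<in> sample_space U - ?bad n" for \<omega>
        using that f_in[OF n] aqute_plug_in(3)[OF elim(4) \<nu> n] by (intro drift) auto
    next
      fix k n A assume kn: "k + w \<gamma> \<le> n" and A: "A \<in> sets (policy_info U (\<tau> \<gamma>) (n - w \<gamma>))"
      then have n: "w \<gamma> \<le> n" by simp
      show "measure (law (enat k)) (A \<inter> ?bad n) \<le> \<alpha> (w \<gamma>) * measure (law (enat k)) A"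
        by (rule consistent[OF policy kn f_measurable[OF n] aqute_plug_in(2)[OF elim(4) \<nu> n] A])
    qed (use J \<alpha>(2) elim(2) in \<open>auto simp: C_def\<close>)
    also have "\<dots> \<le> ennreal ((1 + e) * (ln \<gamma> / KLM))"
    proof (rule ennreal_leI)
      have "real (w \<gamma>) + (ln \<gamma> - ln \<eta> + C * \<alpha> (w \<gamma>) * real (w \<gamma>)) / (J - C * \<alpha> (w \<gamma>))
        = (real (w \<gamma>) / ln \<gamma> + (1 + - ln \<eta> / ln \<gamma> + C * \<alpha> (w \<gamma>) * (real (w \<gamma>) / ln \<gamma>)) / (J - C * \<alpha> (w \<gamma>))) * ln \<gamma>"
        using \<nu> elim(2) by (simp add: field_simps)
      also have "\<dots> \<le> (1 + e) / KLM * ln \<gamma>" using elim(1) \<nu> by (intro mult_right_mono) auto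
      finally show "real (w \<gamma>) + (ln \<gamma> - ln \<eta> + (J - ln \<eta>) * \<alpha> (w \<gamma>) * real (w \<gamma>)) / (J - (J - ln \<eta>) * \<alpha> (w \<gamma>))
          \<le> (1 + e) * (ln \<gamma> / KLM)" by (simp add: C_def)
    qed
    finally show ?case .
  qed
qed

end

theorem theorem2:
  fixes U :: "'u measure"
    and \<X> \<Theta> \<Theta>1 :: "real set"
    and p :: "real \<Rightarrow> real \<Rightarrow> real"
    and \<theta>0 \<theta>1 \<tau>min \<tau>max :: real
    and w :: "real \<Rightarrow> nat"
    and \<tau> \<theta>h S :: "real \<Rightarrow> nat \<Rightarrow> 'u \<times> (nat \<Rightarrow> real) \<Rightarrow> real"
    and T :: "real \<Rightarrow> 'u \<times> (nat \<Rightarrow> real) \<Rightarrow> enat"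
  assumes "prob_space U"
    and "density_family \<X> \<Theta> p"
    and "\<theta>0 \<in> \<Theta>" and "\<Theta>1 \<subseteq> \<Theta>" and "\<theta>0 \<notin> \<Theta>1"
    and "\<tau>min \<in> \<X>" and "\<tau>max \<in> \<X>" and "\<tau>min \<le> \<tau>max"
    and "assm_A1 \<Theta>1 \<theta>1"
    and "assm_A2 \<X> p \<Theta>1 \<tau>min \<tau>max"
    and "assm_A3 \<X> p \<Theta>1 \<tau>min \<tau>max"
    and "assm_A4 \<X> p \<Theta>1 \<tau>min \<tau>max"
    and "assm_A5 \<X> p \<theta>1 \<tau>min \<tau>max"
    and "assm_A6 \<X> p \<theta>0 \<theta>1 \<tau>min \<tau>max"
    and "\<forall>\<^sub>F \<gamma> in at_top.
           aqute_cusum U \<X> p \<theta>0 \<Theta>1 \<tau>min \<tau>max (w \<gamma>) (ln \<gamma>) (\<tau> \<gamma>) (\<theta>h \<gamma>) (S \<gamma>) (T \<gamma>)"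
    and "filterlim w at_top at_top"
    and "(\<lambda>\<gamma>. real (w \<gamma>)) \<in> o[at_top](ln)"
  shows "(\<exists>r :: real \<Rightarrow> real. (r \<longlongrightarrow> 0) at_top \<and>
            (\<forall>\<^sub>F \<gamma> in at_top. WADD U \<X> p \<theta>0 \<theta>1 (\<tau> \<gamma>) (T \<gamma>)
               \<le> ennreal (ln \<gamma> / real_of_ereal (KL_max \<X> p \<theta>0 \<theta>1 \<tau>min \<tau>max) * (1 + r \<gamma>)))) \<and>
         (\<exists>r :: real \<Rightarrow> real. (r \<longlongrightarrow> 0) at_top \<and>
            (\<forall>\<^sub>F \<gamma> in at_top. WADD U \<X> p \<theta>0 \<theta>1 (\<tau> \<gamma>) (T \<gamma>)
               = ennreal (ln \<gamma> / real_of_ereal (KL_max \<X> p \<theta>0 \<theta>1 \<tau>min \<tau>max) * (1 + r \<gamma>)))) \<and>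
         (\<forall>\<^sub>F \<gamma> in at_top. ennreal \<gamma> \<le> ARL U \<X> p \<theta>0 (T \<gamma>)) \<and>
         (\<exists>r :: real \<Rightarrow> real. (r \<longlongrightarrow> 0) at_top \<and>
            (\<forall>\<^sub>F \<gamma> in at_top. WADD U \<X> p \<theta>0 \<theta>1 (\<tau> \<gamma>) (T \<gamma>)
               = optimal_WADD U \<X> p \<theta>0 \<theta>1 \<tau>min \<tau>max \<gamma> * ennreal (1 + r \<gamma>)))"
proof -
  have "\<theta>1 \<in> \<Theta>" using assms(4,9) interior_subset by (auto simp: assm_A1_def)
  interpret change_detection U \<X> \<Theta> p \<theta>0 \<theta>1 \<Theta>1 \<tau>min \<tau>max
    by (intro change_detection.intro one_bit_law.intro change_detection_axioms.intro assms \<open>\<theta>1 \<in> \<Theta>\<close>)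
  note aq = assms(15)
  let ?W = "\<lambda>\<gamma>. WADD U \<X> p \<theta>0 \<theta>1 (\<tau> \<gamma>) (T \<gamma>)" and ?O = "optimal_WADD U \<X> p \<theta>0 \<theta>1 \<tau>min \<tau>max"
  let ?L = "\<lambda>\<gamma>. ln \<gamma> / KLM"
  have L: "\<forall>\<^sub>F \<gamma> in at_top. 0 < ?L \<gamma>"
    using eventually_gt_at_top[of "1::real"] by eventually_elim (use KLM_pos in auto)
  obtain r where r: "(r \<longlongrightarrow> 0) at_top" "\<forall>\<^sub>F \<gamma> in at_top. ?W \<gamma> = ennreal (?L \<gamma> * (1 + r \<gamma>))"
    using ennreal_asymp_equiv[OF L aqute_WADD_upper[OF aq assms(16,17)] aqute_WADD_lower[OF aq]] by blast
  obtain s where s: "(s \<longlongrightarrow> 0) at_top" "\<forall>\<^sub>F \<gamma> in at_top. ?O \<gamma> = ennreal (?L \<gamma> * (1 + s \<gamma>))"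
    using ennreal_asymp_equiv[OF L optimal_WADD_upper optimal_WADD_lower] by blast
  have ARL: "\<forall>\<^sub>F \<gamma> in at_top. ennreal \<gamma> \<le> ARL U \<X> p \<theta>0 (T \<gamma>)"
    using eventually_gt_at_top[of "1::real"] aq
  proof eventually_elim
    case (elim \<gamma>)
    then have \<nu>: "0 < ln \<gamma>" by simp
    interpret plug_in_cusum U \<X> \<Theta> p \<theta>0 \<theta>1 \<Theta>1 \<tau>min \<tau>max "\<tau> \<gamma>" "\<theta>h \<gamma>" "S \<gamma>" "T \<gamma>" "w \<gamma>" "ln \<gamma>"
      by (rule aqute_plug_in(1)[OF elim(2) \<nu>])
    show ?case using ARL_bound elim(1) by simp
  qed
  have ratio: "((\<lambda>\<gamma>. (1 + r \<gamma>) / (1 + s \<gamma>) - 1) \<longlongrightarrow> (1 + 0) / (1 + 0) - 1) at_top"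
    by (intro tendsto_intros r s) auto
  \<comment> \<open>Keeping both remainders above -1/2 makes the quotient meaningful and
    nonnegative, as the product rule in \<open>ennreal\<close> requires.\<close>
  have half: "\<forall>\<^sub>F \<gamma> in at_top. - 1 / 2 < s \<gamma>" "\<forall>\<^sub>F \<gamma> in at_top. - 1 / 2 < r \<gamma>"
    using s(1) r(1) by (auto intro!: order_tendstoD(1))
  have "\<forall>\<^sub>F \<gamma> in at_top. ?W \<gamma> = ?O \<gamma> * ennreal (1 + ((1 + r \<gamma>) / (1 + s \<gamma>) - 1))"
    using r(2) s(2) half L
  proof eventually_elim
    case (elim \<gamma>)
    let ?q = "(1 + r \<gamma>) / (1 + s \<gamma>)"
    have "1 + s \<gamma> \<noteq> 0" using elim(3) by simp
    then have eq: "?L \<gamma> * (1 + r \<gamma>) = ?L \<gamma> * (1 + s \<gamma>) * ?q" by simp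
    have "0 \<le> ?L \<gamma> * (1 + s \<gamma>)"
      by (intro mult_nonneg_nonneg; use elim(3-5) in linarith)
    moreover have "0 \<le> ?q"
      by (intro divide_nonneg_nonneg; use elim(3-5) in linarith)
    moreover have "1 + (?q - 1) = ?q" by simp
    ultimately show ?case unfolding elim(1,2) eq by (simp only: ennreal_mult)
  qed
  with ratio have opt: "\<exists>r. (r \<longlongrightarrow> 0) at_top \<and> (\<forall>\<^sub>F \<gamma> in at_top. ?W \<gamma> = ?O \<gamma> * ennreal (1 + r \<gamma>))"
    by (intro exI[of _ "\<lambda>\<gamma>. (1 + r \<gamma>) / (1 + s \<gamma>) - 1"]) simp
  have "\<forall>\<^sub>F \<gamma> in at_top. ?W \<gamma> \<le> ennreal (?L \<gamma> * (1 + r \<gamma>))"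
    using r(2) by eventually_elim simp
  with r(1) r(2) ARL opt show ?thesis unfolding KLM_def by blast
qed

end
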